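(* If $h_0\in\mathbb C\setminus\{\mathbb Q\cdot\pi\sqrt{-1}\}$ and $q=e^{h_0}$, then the assignment $$e_i\mapsto Z^iD,\quad f_i\mapsto-D^{-1}Z^i,\quad H_i\mapsto-(1-q^{-i})Z^i-q^{-i}c_{\mathfrak d}\qquad(i\in\mathbb Z)$$ induces an isomorphism of $\mathbb C$-algebras $\theta:\ddot U_{h_0}(\mathfrak{gl}_1)\to U(\bar{\mathfrak d}^0_q)$, where $\bar{\mathfrak d}^0_q\subset\bar{\mathfrak d}_q$ is the $\mathbb C$-Lie subalgebra spanned by $\{c_{\mathfrak d}\}\cup\{Z^iD^j\}_{(i,j)\ne(0,0)}$.
   Context: For $h_0\in\mathbb C$ and $q=e^{h_0}\in\mathbb C^*$, $\ddot U_{h_0}(\mathfrak{gl}_1)$ is the unital associative $\mathbb C$-algebra generated by $e_i,f_i,H_i$ ($i\in\mathbb Z$) subject to the following relations, where $e(z)=\sum_{i\in\mathbb Z}e_iz^{-i}$, $f(z)=\sum_{i\in\mathbb Z}f_iz^{-i}$, $q_1=q^{-1}$, $q_2=q$, $q_3=1$, and $\mathrm{Sym}_{\mathfrak S_3}$ is the sum over permutations of $i_1,i_2,i_3$: - $[H_i,H_j]=0$, $[e_i,f_j]=H_{i+j}$; - $e(z)e(w)(z-q_1w)(z-q_2w)(z-q_3w)=-e(w)e(z)(w-q_1z)(w-q_2z)(w-q_3z)$; - $f(z)f(w)(w-q_1z)(w-q_2z)(w-q_3z)=-f(w)f(z)(z-q_1w)(z-q_2w)(z-q_3w)$; - $[H_i,e_j]=-(1-q^i)(1-q^{-i})e_{i+j}$,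 $[H_i,f_j]=(1-q^i)(1-q^{-i})f_{i+j}$; - $\mathrm{Sym}_{\mathfrak S_3}[e_{i_1},[e_{i_2+1},e_{i_3-1}]]=0$, $\mathrm{Sym}_{\mathfrak S_3}[f_{i_1},[f_{i_2+1},f_{i_3-1}]]=0$. $\mathfrak d_q$ is the unital associative $\mathbb C$-algebra generated by $Z^{\pm1},D^{\pm1}$ with $DZ=qZD$ (and $ZZ^{-1}=Z^{-1}Z=1=DD^{-1}=D^{-1}D$), viewed as a Lie algebra with the commutator bracket; $\bar{\mathfrak d}_q=\mathfrak d_q\oplus\mathbb C c_{\mathfrak d}$ is its central extension by the 2-cocycle $$\phi_{\mathfrak d}(Z^aD^j,Z^bD^{-j'})=\begin{cases}\sum_{i=-j}^{-1}q^{ai+b(i+j)}&j=j'>0\\-\sum_{i=j}^{-1}q^{bi+a(i-j)}&j=j'<0\\0&\text{otherwise.}\end{cases}$$ $U(\cdot)$ denotes the universal enveloping algebra. *)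

theory Defs
  imports Complex_Main "HOL-Library.Poly_Mapping" "HOL-Algebra.Module" "HOL-Algebra.QuotRing"
begin

section \<open>Algebras presented by generators and relations\<close>

text \<open>
  The free monoid, written additively because the convolution product on the type
  \<open>'w \<Rightarrow>\<^sub>0 complex\<close> of finitely supported functions is defined for additive monoids \<open>'w\<close>.
  So \<open>'x word \<Rightarrow>\<^sub>0 complex\<close> is the free unital associative algebra on the type \<open>'x\<close>.
\<close>

datatype 'x word = Word (letters: "'x list")

instantiation word :: (type) monoid_add
begin
definition "0 = Word []"
definition "u + v = Word (letters u @ letters v)"
instance by standard (simp_all add: zero_word_def plus_word_def)
end

type_synonym 'x free_alg = "'x word \<Rightarrow>\<^sub>0 complex"

definition letter :: "'x \<Rightarrow> 'x free_alg" where
  "letter x = Poly_Mapping.single (Word [x]) 1"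

definition scalar :: "complex \<Rightarrow> 'x free_alg" where
  "scalar c = Poly_Mapping.single 0 c"

definition commutator :: "'a::ring \<Rightarrow> 'a \<Rightarrow> 'a" where
  "commutator x y = x * y - y * x"

text \<open>
  A not necessarily commutative unital algebra over the complex numbers is represented by
  the record type \<open>(complex, _) module\<close>, which has ring operations and a scalar
  multiplication (the locales \<open>module\<close> and \<open>algebra\<close> of the library are for commutative
  rings only and are not used).
\<close>

definition free_algebra :: "'x set \<Rightarrow> (complex, 'x free_alg) module" where
  "free_algebra X =
    \<lparr>carrier = {p. \<forall>w \<in> Poly_Mapping.keys p. set (letters w) \<subseteq> X},
     mult = (*), one = 1, zero = 0, add = (+), smult = (\<lambda>c p. scalar c * p)\<rparr>"

definition quotient_algebra ::
    "(complex, 'a) module \<Rightarrow> 'a set \<Rightarrow> (complex, 'a set) module" where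
  "quotient_algebra A I =
    ring.extend (A Quot I)
      \<lparr>smult = (\<lambda>c P. \<Union>x\<in>P. I +>\<^bsub>A\<^esub> (c \<odot>\<^bsub>A\<^esub> x))\<rparr>"

definition presented_algebra ::
    "'x set \<Rightarrow> 'x free_alg set \<Rightarrow> (complex, 'x free_alg set) module" where
  "presented_algebra X R = quotient_algebra (free_algebra X) (Idl\<^bsub>free_algebra X\<^esub> R)"

definition presented_gen ::
    "'x set \<Rightarrow> 'x free_alg set \<Rightarrow> 'x \<Rightarrow> 'x free_alg set" where
  "presented_gen X R x = (Idl\<^bsub>free_algebra X\<^esub> R) +>\<^bsub>free_algebra X\<^esub> letter x"

definition algebra_iso ::
    "(complex, 'a) module \<Rightarrow> (complex, 'b) module \<Rightarrow> ('a \<Rightarrow> 'b) set" where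
  "algebra_iso A B =
    {h \<in> ring_iso A B. \<forall>c. \<forall>x \<in> carrier A. h (c \<odot>\<^bsub>A\<^esub> x) = c \<odot>\<^bsub>B\<^esub> h x}"


section \<open>The quantum toroidal algebra\<close>

datatype toroidal_letter = Le int | Lf int | LH int

text \<open>
  A formal series \<open>\<Sum>i j. F i j z\<^bsup>-i\<^esup> w\<^bsup>-j\<^esup>\<close>, infinite in all directions, is represented
  by its coefficient family \<open>F\<close>.
\<close>

type_synonym 'a series2 = "int \<Rightarrow> int \<Rightarrow> 'a"

text \<open>The product of a series with the polynomial \<open>a z + b w\<close>:\<close>

definition times_linear ::
    "complex \<Rightarrow> complex \<Rightarrow> 'x free_alg series2 \<Rightarrow> 'x free_alg series2" where
  "times_linear a b F = (\<lambda>i j. scalar a * F (i + 1) j + scalar b * F i (j + 1))"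

text \<open>For \<open>q\<^sub>1, q\<^sub>2, q\<^sub>3\<close> equal to \<open>1/q, q, 1\<close>, the products of a series with
  \<open>(z - q\<^sub>1 w) (z - q\<^sub>2 w) (z - q\<^sub>3 w)\<close> and with \<open>(w - q\<^sub>1 z) (w - q\<^sub>2 z) (w - q\<^sub>3 z)\<close>:\<close>

definition times_zw :: "complex \<Rightarrow> 'x free_alg series2 \<Rightarrow> 'x free_alg series2" where
  "times_zw q F =
    times_linear 1 (- inverse q) (times_linear 1 (- q) (times_linear 1 (- 1) F))"

definition times_wz :: "complex \<Rightarrow> 'x free_alg series2 \<Rightarrow> 'x free_alg series2" where
  "times_wz q F =
    times_linear (- inverse q) 1 (times_linear (- q) 1 (times_linear (- 1) 1 F))"

definition sym3 :: "(int \<Rightarrow> int \<Rightarrow> int \<Rightarrow> 'a::comm_monoid_add) \<Rightarrow> int \<Rightarrow> int \<Rightarrow> int \<Rightarrow> 'a" where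
  "sym3 G i1 i2 i3 =
    G i1 i2 i3 + G i1 i3 i2 + G i2 i1 i3 + G i2 i3 i1 + G i3 i1 i2 + G i3 i2 i1"

definition toroidal_relations :: "complex \<Rightarrow> toroidal_letter free_alg set" where
  "toroidal_relations q =
    (let e = (\<lambda>i. letter (Le i)); f = (\<lambda>i. letter (Lf i)); H = (\<lambda>i. letter (LH i)) in
       {commutator (H i) (H j) | i j. True}
     \<union> {commutator (e i) (f j) - H (i + j) | i j. True}
     \<union> {times_zw q (\<lambda>k l. e k * e l) i j + times_wz q (\<lambda>k l. e l * e k) i j | i j. True}
     \<union> {times_wz q (\<lambda>k l. f k * f l) i j + times_zw q (\<lambda>k l. f l * f k) i j | i j. True}
     \<union> {commutator (H i) (e j)
          + scalar ((1 - q powi i) * (1 - q powi (- i))) * e (i + j) | i j. True}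
     \<union> {commutator (H i) (f j)
          - scalar ((1 - q powi i) * (1 - q powi (- i))) * f (i + j) | i j. True}
     \<union> {sym3 (\<lambda>k1 k2 k3. commutator (e k1) (commutator (e (k2 + 1)) (e (k3 - 1)))) i1 i2 i3
          | i1 i2 i3. True}
     \<union> {sym3 (\<lambda>k1 k2 k3. commutator (f k1) (commutator (f (k2 + 1)) (f (k3 - 1)))) i1 i2 i3
          | i1 i2 i3. True})"

definition toroidal_algebra :: "complex \<Rightarrow> (complex, toroidal_letter free_alg set) module" where
  "toroidal_algebra h = presented_algebra UNIV (toroidal_relations (exp h))"

definition toroidal_gen :: "complex \<Rightarrow> toroidal_letter \<Rightarrow> toroidal_letter free_alg set" where
  "toroidal_gen h = presented_gen UNIV (toroidal_relations (exp h))"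


section \<open>Complex Lie algebras and their universal enveloping algebras\<close>

record 'v lie_algebra = "'v partial_object" +
  lie_zero :: 'v
  lie_add :: "'v \<Rightarrow> 'v \<Rightarrow> 'v"
  lie_smult :: "complex \<Rightarrow> 'v \<Rightarrow> 'v"
  lie_bracket :: "'v \<Rightarrow> 'v \<Rightarrow> 'v"

definition commutator_lie_algebra :: "(complex, 'a) module \<Rightarrow> 'a lie_algebra" where
  "commutator_lie_algebra A =
    \<lparr>carrier = carrier A, lie_zero = \<zero>\<^bsub>A\<^esub>, lie_add = add A, lie_smult = smult A,
     lie_bracket = (\<lambda>x y. (x \<otimes>\<^bsub>A\<^esub> y) \<ominus>\<^bsub>A\<^esub> (y \<otimes>\<^bsub>A\<^esub> x))\<rparr>"

definition central_extension ::
    "'v lie_algebra \<Rightarrow> ('v \<Rightarrow> 'v \<Rightarrow> complex) \<Rightarrow> ('v \<times> complex) lie_algebra" where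
  "central_extension L \<phi> =
    \<lparr>carrier = carrier L \<times> UNIV,
     lie_zero = (lie_zero L, 0),
     lie_add = (\<lambda>(x, s) (y, t). (lie_add L x y, s + t)),
     lie_smult = (\<lambda>c (x, s). (lie_smult L c x, c * s)),
     lie_bracket = (\<lambda>(x, s) (y, t). (lie_bracket L x y, \<phi> x y))\<rparr>"

inductive_set lie_span :: "'v lie_algebra \<Rightarrow> 'v set \<Rightarrow> 'v set"
  for L :: "'v lie_algebra" and S :: "'v set" where
  zero: "lie_zero L \<in> lie_span L S"
| base: "x \<in> S \<Longrightarrow> x \<in> lie_span L S"
| add: "x \<in> lie_span L S \<Longrightarrow> y \<in> lie_span L S \<Longrightarrow> lie_add L x y \<in> lie_span L S"
| smult: "x \<in> lie_span L S \<Longrightarrow> lie_smult L c x \<in> lie_span L S"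

text \<open>
  The universal enveloping algebra is the tensor algebra modulo \<open>xy - yx = [x,y]\<close>; the
  tensor algebra in turn is the free algebra on the underlying set of the Lie algebra modulo
  the relations that make the inclusion of generators linear.
\<close>

definition enveloping_relations :: "'v lie_algebra \<Rightarrow> 'v free_alg set" where
  "enveloping_relations L =
     {letter (lie_add L x y) - (letter x + letter y) | x y. x \<in> carrier L \<and> y \<in> carrier L}
   \<union> {letter (lie_smult L c x) - scalar c * letter x | c x. x \<in> carrier L}
   \<union> {commutator (letter x) (letter y) - letter (lie_bracket L x y)
        | x y. x \<in> carrier L \<and> y \<in> carrier L}"

definition enveloping_algebra :: "'v lie_algebra \<Rightarrow> (complex, 'v free_alg set) module" where
  "enveloping_algebra L = presented_algebra (carrier L) (enveloping_relations L)"

definition enveloping_incl :: "'v lie_algebra \<Rightarrow> 'v \<Rightarrow> 'v free_alg set" where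
  "enveloping_incl L = presented_gen (carrier L) (enveloping_relations L)"


section \<open>The algebra of q-difference operators and its central extension\<close>

datatype torus_letter = LZ | LZinv | LD | LDinv

definition torus_relations :: "complex \<Rightarrow> torus_letter free_alg set" where
  "torus_relations q =
     {letter LZ * letter LZinv - 1, letter LZinv * letter LZ - 1,
      letter LD * letter LDinv - 1, letter LDinv * letter LD - 1,
      letter LD * letter LZ - scalar q * (letter LZ * letter LD)}"

definition torus :: "complex \<Rightarrow> (complex, torus_letter free_alg set) module" where
  "torus q = presented_algebra UNIV (torus_relations q)"

definition torus_Z :: "complex \<Rightarrow> torus_letter free_alg set" where
  "torus_Z q = presented_gen UNIV (torus_relations q) LZ"

definition torus_D :: "complex \<Rightarrow> torus_letter free_alg set" where
  "torus_D q = presented_gen UNIV (torus_relations q) LD"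

definition torus_monomial :: "complex \<Rightarrow> int \<Rightarrow> int \<Rightarrow> torus_letter free_alg set" where
  "torus_monomial q a j = (torus_Z q [^]\<^bsub>torus q\<^esub> a) \<otimes>\<^bsub>torus q\<^esub> (torus_D q [^]\<^bsub>torus q\<^esub> j)"

definition bilinear_form_on :: "(complex, 'a) module \<Rightarrow> ('a \<Rightarrow> 'a \<Rightarrow> complex) \<Rightarrow> bool" where
  "bilinear_form_on A \<phi> \<longleftrightarrow>
    (\<forall>x \<in> carrier A. \<forall>y \<in> carrier A. \<forall>z \<in> carrier A.
       \<phi> (x \<oplus>\<^bsub>A\<^esub> y) z = \<phi> x z + \<phi> y z \<and> \<phi> z (x \<oplus>\<^bsub>A\<^esub> y) = \<phi> z x + \<phi> z y) \<and>
    (\<forall>c. \<forall>x \<in> carrier A. \<forall>y \<in> carrier A.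
       \<phi> (c \<odot>\<^bsub>A\<^esub> x) y = c * \<phi> x y \<and> \<phi> x (c \<odot>\<^bsub>A\<^esub> y) = c * \<phi> x y)"

text \<open>The value of the cocycle at the pair \<open>Z\<^sup>a D\<^sup>j\<close>, \<open>Z\<^sup>b D\<^bsup>-j'\<^esup>\<close>:\<close>

definition torus_cocycle_value :: "complex \<Rightarrow> int \<Rightarrow> int \<Rightarrow> int \<Rightarrow> int \<Rightarrow> complex" where
  "torus_cocycle_value q a j b j' =
    (if j = j' \<and> j > 0 then (\<Sum>i = -j..-1. q powi (a * i + b * (i + j)))
     else if j = j' \<and> j < 0 then - (\<Sum>i = j..-1. q powi (b * i + a * (i - j)))
     else 0)"

definition is_torus_cocycle ::
    "complex \<Rightarrow> (torus_letter free_alg set \<Rightarrow> torus_letter free_alg set \<Rightarrow> complex) \<Rightarrow> bool" where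
  "is_torus_cocycle q \<phi> \<longleftrightarrow> bilinear_form_on (torus q) \<phi> \<and>
    (\<forall>a j b j'. \<phi> (torus_monomial q a j) (torus_monomial q b (- j')) =
       torus_cocycle_value q a j b j')"

text \<open>
  The monomials form a basis of the torus when \<open>q \<noteq> 0\<close>, so the form chosen here is unique on
  the carrier; that it exists is lemma \<open>torus_cocycle\<close> below.
\<close>

definition torus_cocycle ::
    "complex \<Rightarrow> torus_letter free_alg set \<Rightarrow> torus_letter free_alg set \<Rightarrow> complex" where
  "torus_cocycle q = (SOME \<phi>. is_torus_cocycle q \<phi>)"

definition torus_ext :: "complex \<Rightarrow> (torus_letter free_alg set \<times> complex) lie_algebra" where
  "torus_ext q = central_extension (commutator_lie_algebra (torus q)) (torus_cocycle q)"

definition torus_ext_incl ::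
    "complex \<Rightarrow> torus_letter free_alg set \<Rightarrow> torus_letter free_alg set \<times> complex" where
  "torus_ext_incl q x = (x, 0)"

definition torus_ext_central :: "complex \<Rightarrow> torus_letter free_alg set \<times> complex" where
  "torus_ext_central q = (\<zero>\<^bsub>torus q\<^esub>, 1)"

definition torus_ext0 :: "complex \<Rightarrow> (torus_letter free_alg set \<times> complex) lie_algebra" where
  "torus_ext0 q = (torus_ext q)\<lparr>carrier :=
     lie_span (torus_ext q)
       ({torus_ext_central q}
        \<union> {torus_ext_incl q (torus_monomial q i j) | i j. (i, j) \<noteq> (0, 0)})\<rparr>"


section \<open>Existence of the cocycle\<close>

lemma free_algebra_simps [simp]:
  "carrier (free_algebra X) = {p. \<forall>w \<in> Poly_Mapping.keys p. set (letters w) \<subseteq> X}"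
  "mult (free_algebra X) = (*)" "one (free_algebra X) = 1" "zero (free_algebra X) = 0"
  "add (free_algebra X) = (+)" "smult (free_algebra X) = (\<lambda>c p. scalar c * p)"
  by (simp_all add: free_algebra_def)

lemma letters_plus [simp]: "letters (u + v) = letters u @ letters v"
  by (simp add: plus_word_def)

lemma letters_zero [simp]: "letters 0 = []"
  by (simp add: zero_word_def)

lemma ring_free_algebra: "ring (free_algebra X)"
proof (rule ringI)
  show "abelian_group (free_algebra X)"
  proof (rule abelian_groupI)
    fix x y assume "x \<in> carrier (free_algebra X)" "y \<in> carrier (free_algebra X)"
    then show "x \<oplus>\<^bsub>free_algebra X\<^esub> y \<in> carrier (free_algebra X)"
      using Poly_Mapping.keys_add[of x y] by auto
  next
    fix x assume "x \<in> carrier (free_algebra X)"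
    then show "\<exists>y \<in> carrier (free_algebra X). y \<oplus>\<^bsub>free_algebra X\<^esub> x = \<zero>\<^bsub>free_algebra X\<^esub>"
      by (intro bexI[of _ "- x"]) auto
  qed (auto simp: algebra_simps)
  show "Group.monoid (free_algebra X)"
  proof (rule monoidI)
    fix x y assume "x \<in> carrier (free_algebra X)" "y \<in> carrier (free_algebra X)"
    then show "x \<otimes>\<^bsub>free_algebra X\<^esub> y \<in> carrier (free_algebra X)"
      using keys_mult[of x y] by fastforce
  qed (auto simp: algebra_simps)
qed (auto simp: algebra_simps)

definition lin :: "('w \<Rightarrow> complex) \<Rightarrow> ('w \<Rightarrow>\<^sub>0 complex) \<Rightarrow> complex" where
  "lin u p = (\<Sum>w \<in> Poly_Mapping.keys p. Poly_Mapping.lookup p w * u w)"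

lemma lin_superset:
  assumes "finite S" "Poly_Mapping.keys p \<subseteq> S"
  shows "lin u p = (\<Sum>w \<in> S. Poly_Mapping.lookup p w * u w)"
  unfolding lin_def using assms by (intro sum.mono_neutral_left) (auto simp: in_keys_iff)

lemma lin_add: "lin u (p + r) = lin u p + lin u r"
proof -
  let ?S = "Poly_Mapping.keys p \<union> Poly_Mapping.keys r"
  have "lin u (p + r) = (\<Sum>w \<in> ?S. Poly_Mapping.lookup (p + r) w * u w)"
    using Poly_Mapping.keys_add[of p r] by (intro lin_superset) auto
  also have "\<dots> = lin u p + lin u r"
    by (simp add: lin_superset[of ?S p] lin_superset[of ?S r] lookup_add algebra_simps sum.distrib)
  finally show ?thesis .
qed

lemma lin_0 [simp]: "lin u 0 = 0"
  by (simp add: lin_def)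

lemma lin_uminus: "lin u (- p) = - lin u p"
  using lin_add[of u p "- p"] by (simp add: add_eq_0_iff)

lemma lin_diff: "lin u (p - r) = lin u p - lin u r"
  using lin_add[of u p "- r"] by (simp add: lin_uminus)

lemma lin_sum: "lin u (sum F A) = (\<Sum>x \<in> A. lin u (F x))"
  by (induction A rule: infinite_finite_induct) (auto simp: lin_add)

lemma lin_single [simp]: "lin u (Poly_Mapping.single w c) = c * u w"
  by (cases "c = 0") (simp_all add: lin_def)

lemma sum_singles:
  "p = (\<Sum>w \<in> Poly_Mapping.keys p. Poly_Mapping.single w (Poly_Mapping.lookup p w))"
proof (rule poly_mapping_eqI)
  fix k
  show "Poly_Mapping.lookup p k = Poly_Mapping.lookup
     (\<Sum>w \<in> Poly_Mapping.keys p. Poly_Mapping.single w (Poly_Mapping.lookup p w)) k"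
    by (auto simp: lookup_sum lookup_single when_def in_keys_iff)
qed

lemma lin_single_mult:
  "lin u (Poly_Mapping.single v c * p) = c * lin (\<lambda>w. u (v + w)) (p :: 'x free_alg)"
proof -
  have "lin u (Poly_Mapping.single v c * p) = lin u (Poly_Mapping.single v c *
     (\<Sum>w \<in> Poly_Mapping.keys p. Poly_Mapping.single w (Poly_Mapping.lookup p w)))"
    using sum_singles[of p] by simp
  also have "\<dots> = c * lin (\<lambda>w. u (v + w)) p"
    by (simp add: sum_distrib_left lin_sum mult_single mult.assoc) (simp add: lin_def sum_distrib_left)
  finally show ?thesis .
qed

lemma lin_mult_single:
  "lin u (p * Poly_Mapping.single v c) = c * lin (\<lambda>w. u (w + v)) (p :: 'x free_alg)"
proof -
  have "lin u (p * Poly_Mapping.single v c) = lin u (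
     (\<Sum>w \<in> Poly_Mapping.keys p. Poly_Mapping.single w (Poly_Mapping.lookup p w)) *
      Poly_Mapping.single v c)"
    using sum_singles[of p] by simp
  also have "\<dots> = c * lin (\<lambda>w. u (w + v)) p"
    by (simp add: sum_distrib_right lin_sum mult_single) (simp add: lin_def sum_distrib_left ac_simps)
  finally show ?thesis .
qed

lemma lin_scalar_mult: "lin u (scalar c * p) = c * lin u (p :: 'x free_alg)"
  by (simp add: scalar_def lin_single_mult)

lemma lin_mult_left_eq_0:
  fixes p :: "'x free_alg"
  assumes "\<And>v. lin (\<lambda>w. u (v + w)) p = 0"
  shows "lin u (r * p) = 0"
  by (subst sum_singles[of r]) (simp add: sum_distrib_right lin_sum lin_single_mult assms)

lemma lin_mult_right_eq_0:
  fixes p :: "'x free_alg"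
  assumes "\<And>v. lin (\<lambda>w. u (w + v)) p = 0"
  shows "lin u (p * r) = 0"
  by (subst sum_singles[of r]) (simp add: sum_distrib_left lin_sum lin_mult_single assms)

fun zdeg1 :: "torus_letter \<Rightarrow> int" where
  "zdeg1 LZ = 1" | "zdeg1 LZinv = -1" | "zdeg1 _ = 0"

fun ddeg1 :: "torus_letter \<Rightarrow> int" where
  "ddeg1 LD = 1" | "ddeg1 LDinv = -1" | "ddeg1 _ = 0"

definition zdeg :: "torus_letter list \<Rightarrow> int" where "zdeg xs = (\<Sum>x \<leftarrow> xs. zdeg1 x)"
definition ddeg :: "torus_letter list \<Rightarrow> int" where "ddeg xs = (\<Sum>x \<leftarrow> xs. ddeg1 x)"

text \<open>The word \<open>xs\<close> represents \<open>word_coeff q xs\<close> times the monomial of its bidegree.\<close>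

fun word_coeff :: "complex \<Rightarrow> torus_letter list \<Rightarrow> complex" where
  "word_coeff q [] = 1"
| "word_coeff q (x # xs) = q powi (ddeg1 x * zdeg xs) * word_coeff q xs"

lemma deg_simps [simp]:
  "zdeg [] = 0" "zdeg (x # xs) = zdeg1 x + zdeg xs" "zdeg (xs @ ys) = zdeg xs + zdeg ys"
  "ddeg [] = 0" "ddeg (x # xs) = ddeg1 x + ddeg xs" "ddeg (xs @ ys) = ddeg xs + ddeg ys"
  by (simp_all add: zdeg_def ddeg_def)

lemma word_coeff_append:
  assumes "q \<noteq> 0"
  shows "word_coeff q (xs @ ys) = word_coeff q xs * word_coeff q ys * q powi (ddeg xs * zdeg ys)"
  using assms by (induction xs) (auto simp: algebra_simps power_int_add)

definition torus_functional ::
    "complex \<Rightarrow> (int \<Rightarrow> int \<Rightarrow> complex) \<Rightarrow> torus_letter word \<Rightarrow> complex" where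
  "torus_functional q g w =
     word_coeff q (letters w) * g (zdeg (letters w)) (ddeg (letters w))"

abbreviation "torus_ideal q \<equiv> Idl\<^bsub>free_algebra UNIV\<^esub> (torus_relations q)"

lemma torus_functional_plus:
  assumes "q \<noteq> 0"
  shows "torus_functional q g (v + w) =
     word_coeff q (letters v) *
       torus_functional q (\<lambda>a j. q powi (ddeg (letters v) * a) *
         g (zdeg (letters v) + a) (ddeg (letters v) + j)) w"
    and "torus_functional q g (w + v) =
     word_coeff q (letters v) *
       torus_functional q (\<lambda>a j. q powi (j * zdeg (letters v)) *
         g (a + zdeg (letters v)) (j + ddeg (letters v))) w"
  using assms by (simp_all add: torus_functional_def word_coeff_append mult_ac)

lemma lin_times: "lin (\<lambda>w. c * u w) p = c * lin u p"
  by (simp add: lin_def sum_distrib_left mult_ac)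

lemma torus_functional_linear:
  "lin (torus_functional q (\<lambda>a j. g a j + h a j)) p =
     lin (torus_functional q g) p + lin (torus_functional q h) p"
  "lin (torus_functional q (\<lambda>a j. c * g a j)) p = c * lin (torus_functional q g) p"
  "lin (torus_functional q (\<lambda>a j. 0)) p = 0"
  by (simp_all add: lin_def torus_functional_def sum_distrib_left algebra_simps flip: sum.distrib)

lemma torus_functional_ideal:
  assumes q: "q \<noteq> 0" and p: "p \<in> torus_ideal q"
  shows "lin (torus_functional q g) p = 0"
proof -
  define K where "K = {p. \<forall>g. lin (torus_functional q g) p = 0}"
  have one: "lin (torus_functional q g) 1 = g 0 0" for g
    by (simp add: torus_functional_def flip: single_one)
  have "ideal K (free_algebra UNIV)"
  proof (rule idealI[OF ring_free_algebra])
    show "subgroup K (add_monoid (free_algebra UNIV))"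
    proof
      interpret ring "free_algebra (UNIV :: torus_letter set)" by (rule ring_free_algebra)
      fix x assume x: "x \<in> K"
      have "\<ominus>\<^bsub>free_algebra UNIV\<^esub> x = - x"
        by (rule minus_equality) auto
      then show "inv\<^bsub>add_monoid (free_algebra UNIV)\<^esub> x \<in> K"
        using x by (simp add: a_inv_def K_def lin_uminus)
    qed (auto simp: K_def lin_add)
  next
    fix x a assume "x \<in> K"
    then have x: "lin (torus_functional q g) x = 0" for g
      by (simp add: K_def)
    have "lin (torus_functional q g) (a * x) = 0" "lin (torus_functional q g) (x * a) = 0" for g
      by (rule lin_mult_left_eq_0, simp only: torus_functional_plus(1)[OF q] lin_times x mult_zero_right)
        (rule lin_mult_right_eq_0, simp only: torus_functional_plus(2)[OF q] lin_times x mult_zero_right)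
    then show "a \<otimes>\<^bsub>free_algebra UNIV\<^esub> x \<in> K" "x \<otimes>\<^bsub>free_algebra UNIV\<^esub> a \<in> K"
      by (auto simp: K_def)
  qed
  moreover have "torus_relations q \<subseteq> K"
    using q by (auto simp: torus_relations_def K_def lin_diff one letter_def mult_single
        lin_scalar_mult plus_word_def torus_functional_def power_int_minus)
  ultimately have "torus_ideal q \<subseteq> K"
    by (intro ring.genideal_minimal[OF ring_free_algebra])
  then show ?thesis using p by (auto simp: K_def)
qed

abbreviation torus_class :: "complex \<Rightarrow> torus_letter free_alg \<Rightarrow> torus_letter free_alg set" where
  "torus_class q p \<equiv> torus_ideal q +>\<^bsub>free_algebra UNIV\<^esub> p"

lemma ideal_torus_ideal: "ideal (torus_ideal q) (free_algebra UNIV)"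
  by (rule ring.genideal_ideal[OF ring_free_algebra]) auto

lemma torus_eq: "torus q = quotient_algebra (free_algebra UNIV) (torus_ideal q)"
  by (simp add: torus_def presented_algebra_def)

lemma quotient_algebra_sel:
  "carrier (quotient_algebra A I) = carrier (A Quot I)"
  "mult (quotient_algebra A I) = mult (A Quot I)"
  "one (quotient_algebra A I) = one (A Quot I)"
  "zero (quotient_algebra A I) = zero (A Quot I)"
  "add (quotient_algebra A I) = add (A Quot I)"
  "smult (quotient_algebra A I) = (\<lambda>c P. \<Union>x\<in>P. I +>\<^bsub>A\<^esub> (c \<odot>\<^bsub>A\<^esub> x))"
  by (simp_all add: quotient_algebra_def ring.defs FactRing_def)

lemma torus_class_add: "torus_class q x \<oplus>\<^bsub>torus q\<^esub> torus_class q y = torus_class q (x + y)"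
  using ring_hom_add[OF ideal.rcos_ring_hom[OF ideal_torus_ideal]]
  by (simp add: torus_eq quotient_algebra_sel)

lemma torus_class_mult: "torus_class q x \<otimes>\<^bsub>torus q\<^esub> torus_class q y = torus_class q (x * y)"
  using ring_hom_mult[OF ideal.rcos_ring_hom[OF ideal_torus_ideal]]
  by (simp add: torus_eq quotient_algebra_sel)

lemma torus_class_one: "\<one>\<^bsub>torus q\<^esub> = torus_class q 1"
  using ring_hom_one[OF ideal.rcos_ring_hom[OF ideal_torus_ideal]]
  by (simp add: torus_eq quotient_algebra_sel)

lemma torus_carrier: "carrier (torus q) = range (torus_class q)"
  by (auto simp: torus_eq quotient_algebra_sel FactRing_def A_RCOSETS_def')

lemma torus_class_iff: "p \<in> torus_class q r \<longleftrightarrow> p - r \<in> torus_ideal q"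
  by (force simp: a_r_coset_def' algebra_simps)

lemma torus_ideal_closed:
  "0 \<in> torus_ideal q"
  "x \<in> torus_ideal q \<Longrightarrow> y \<in> torus_ideal q \<Longrightarrow> x + y \<in> torus_ideal q"
  "x \<in> torus_ideal q \<Longrightarrow> a * x \<in> torus_ideal q"
  using ideal_torus_ideal[of q]
    additive_subgroup.zero_closed[OF ideal.axioms(1)[OF ideal_torus_ideal]]
    additive_subgroup.a_closed[OF ideal.axioms(1)[OF ideal_torus_ideal]]
    ideal.I_l_closed[OF ideal_torus_ideal]
  by fastforce+

lemma torus_class_eqI:
  assumes "p - r \<in> torus_ideal q"
  shows "torus_class q p = torus_class q r"
proof -
  have "- (p - r) \<in> torus_ideal q"
    using torus_ideal_closed(3)[OF assms, of "- 1"] by simp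
  then have "r - p \<in> torus_ideal q" by simp
  have "x - p \<in> torus_ideal q \<longleftrightarrow> x - r \<in> torus_ideal q" for x
    using torus_ideal_closed(2)[of "x - p" q "p - r"] assms
      torus_ideal_closed(2)[of "x - r" q "r - p"] \<open>r - p \<in> torus_ideal q\<close> by auto
  then show ?thesis by (auto simp: torus_class_iff)
qed

lemma torus_class_smult: "c \<odot>\<^bsub>torus q\<^esub> torus_class q x = torus_class q (scalar c * x)"
proof -
  have "torus_class q (scalar c * y) = torus_class q (scalar c * x)"
    if "y \<in> torus_class q x" for y
    using torus_ideal_closed(3)[of "y - x" q "scalar c"] that
    by (intro torus_class_eqI) (simp add: torus_class_iff algebra_simps)
  moreover have "x \<in> torus_class q x"
    by (simp add: torus_class_iff torus_ideal_closed)
  ultimately have "(\<Union>y \<in> torus_class q x. torus_class q (scalar c * y)) = torus_class q (scalar c * x)"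
    by blast
  then show ?thesis
    by (simp only: torus_eq quotient_algebra_sel free_algebra_simps)
qed

lemma monoid_torus: "Group.monoid (torus q)"
proof -
  have "Group.monoid (free_algebra UNIV Quot torus_ideal q)"
    by (rule ring.is_monoid[OF ideal.quotient_is_ring[OF ideal_torus_ideal]])
  then show ?thesis
    unfolding Group.monoid_def torus_eq quotient_algebra_sel .
qed

lemma torus_class_letter_power:
  "torus_class q (letter x) [^]\<^bsub>torus q\<^esub> n =
     torus_class q (Poly_Mapping.single (Word (replicate n x)) 1)"
proof (induction n)
  case 0
  show ?case
    by (simp add: nat_pow_def torus_class_one flip: single_one zero_word_def)
next
  case (Suc n)
  then show ?case
    by (simp add: torus_class_mult letter_def mult_single plus_word_def
        flip: replicate_append_same)
qed

lemma torus_letter_int_power: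
  assumes xy: "letter x * letter y - 1 \<in> torus_ideal q" "letter y * letter x - 1 \<in> torus_ideal q"
  shows "torus_class q (letter x) [^]\<^bsub>torus q\<^esub> (a::int) =
     torus_class q (Poly_Mapping.single (Word (replicate (nat \<bar>a\<bar>) (if a < 0 then y else x))) 1)"
proof -
  interpret M: Group.monoid "torus q" by (rule monoid_torus)
  let ?x = "torus_class q (letter x)" and ?y = "torus_class q (letter y)"
  have c: "?x \<in> carrier (torus q)" "?y \<in> carrier (torus q)"
    by (auto simp: torus_carrier)
  have xy': "?x \<otimes>\<^bsub>torus q\<^esub> ?y = \<one>\<^bsub>torus q\<^esub>" "?y \<otimes>\<^bsub>torus q\<^esub> ?x = \<one>\<^bsub>torus q\<^esub>"
    using xy by (auto simp: torus_class_mult torus_class_one intro!: torus_class_eqI)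
  have pow: "u [^]\<^bsub>torus q\<^esub> n \<otimes>\<^bsub>torus q\<^esub> (v [^]\<^bsub>torus q\<^esub> n) = \<one>\<^bsub>torus q\<^esub>"
    if "u \<in> carrier (torus q)" "v \<in> carrier (torus q)" "u \<otimes>\<^bsub>torus q\<^esub> v = \<one>\<^bsub>torus q\<^esub>"
    for u v and n :: nat
  proof (induction n)
    case (Suc n)
    have "u [^]\<^bsub>torus q\<^esub> Suc n \<otimes>\<^bsub>torus q\<^esub> (v [^]\<^bsub>torus q\<^esub> Suc n) =
      u [^]\<^bsub>torus q\<^esub> n \<otimes>\<^bsub>torus q\<^esub> (u \<otimes>\<^bsub>torus q\<^esub> v) \<otimes>\<^bsub>torus q\<^esub> (v [^]\<^bsub>torus q\<^esub> n)"
      using that(1,2) by (subst M.nat_pow_Suc2[OF that(2)]) (simp add: M.m_assoc)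
    then show ?case using Suc that by simp
  qed simp
  have "inv\<^bsub>torus q\<^esub> (?x [^]\<^bsub>torus q\<^esub> n) = ?y [^]\<^bsub>torus q\<^esub> n" for n :: nat
    using c xy' by (intro M.inv_char pow) auto
  then show ?thesis
    by (auto simp: int_pow_def2 torus_class_letter_power)
qed

lemma torus_monomial_eq:
  "torus_monomial q a j = torus_class q (Poly_Mapping.single
     (Word (replicate (nat \<bar>a\<bar>) (if a < 0 then LZinv else LZ) @
            replicate (nat \<bar>j\<bar>) (if j < 0 then LDinv else LD))) 1)"
proof -
  have "torus_relations q \<subseteq> torus_ideal q"
    by (intro ring.genideal_self[OF ring_free_algebra]) auto
  then show ?thesis
    unfolding torus_monomial_def torus_Z_def torus_D_def presented_gen_def
    by (subst torus_letter_int_power[where y = LZinv], simp add: torus_relations_def,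
        simp add: torus_relations_def,
        subst torus_letter_int_power[where y = LDinv], simp add: torus_relations_def,
        simp add: torus_relations_def)
      (simp add: torus_class_mult mult_single plus_word_def)
qed

lemma torus_cocycle_exists:
  assumes q: "q \<noteq> 0"
  shows "\<exists>\<phi>. is_torus_cocycle q \<phi>"
proof -
  define B where "B p r = lin (torus_functional q (\<lambda>a j.
      lin (torus_functional q (\<lambda>b k. torus_cocycle_value q a j b (- k))) r)) p" for p r
  define \<phi> where "\<phi> X Y = B (SOME p. p \<in> X) (SOME r. r \<in> Y)" for X Y
  have B_add: "B (p + p') r = B p r + B p' r" "B r (p + p') = B r p + B r p'" for p p' r
    by (simp_all add: B_def lin_add torus_functional_linear)
  have B_scalar: "B (scalar c * p) r = c * B p r" "B p (scalar c * r) = c * B p r" for c p r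
    by (simp_all add: B_def lin_scalar_mult torus_functional_linear)
  have B_0: "B p r = 0" if "p \<in> torus_ideal q \<or> r \<in> torus_ideal q" for p r
    using that
  proof
    assume "r \<in> torus_ideal q"
    then show ?thesis
      by (simp add: B_def torus_functional_ideal[OF q] torus_functional_linear)
  qed (simp add: B_def torus_functional_ideal[OF q])
  have \<phi>: "\<phi> (torus_class q p) (torus_class q r) = B p r" for p r
  proof -
    have "x \<in> torus_class q x" for x by (simp add: torus_class_iff torus_ideal_closed)
    then obtain p' r' where pr: "p' - p \<in> torus_ideal q" "r' - r \<in> torus_ideal q"
      "\<phi> (torus_class q p) (torus_class q r) = B p' r'"
      unfolding \<phi>_def by (metis someI torus_class_iff)
    have "B p' r' = B (p + (p' - p)) (r + (r' - r))" by simp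
    also have "\<dots> = B p r" using pr by (simp only: B_add B_0 simp_thms add_0_right)
    finally show ?thesis using pr by simp
  qed
  have "bilinear_form_on (torus q) \<phi>"
    by (auto simp: bilinear_form_on_def torus_carrier torus_class_add torus_class_smult \<phi>
        B_add B_scalar)
  moreover have "\<phi> (torus_monomial q a j) (torus_monomial q b (- j')) =
      torus_cocycle_value q a j b j'" for a j b j'
  proof -
    have deg: "zdeg (replicate n x) = int n * zdeg1 x" "ddeg (replicate n x) = int n * ddeg1 x"
      for n x by (induction n) (auto simp: algebra_simps)
    have coeff: "word_coeff q (replicate n x) = 1" if "zdeg1 x = 0 \<or> ddeg1 x = 0" for n x
      using that by (induction n) (auto simp: deg)
    show ?thesis
      by (auto simp: torus_monomial_eq \<phi> B_def torus_functional_def word_coeff_append[OF q]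
          deg coeff)
  qed
  ultimately show ?thesis by (auto simp: is_torus_cocycle_def)
qed

lemma torus_cocycle:
  assumes "q \<noteq> 0"
  shows "is_torus_cocycle q (torus_cocycle q)"
  unfolding torus_cocycle_def using torus_cocycle_exists[OF assms] by (rule someI_ex)

end

theory Submission
  imports Defs
begin

text \<open>
  Everything happens at the level of Lie algebras. For \<open>q\<^sub>3 = 1\<close> the polynomial
  \<open>(z - w) (z - q w) (z - w/q)\<close> is antisymmetric in \<open>z, w\<close>, so the quadratic relations only
  involve the commutators of the \<open>e\<^sub>i\<close> and of the \<open>f\<^sub>i\<close>, and all the defining relations of
  the toroidal algebra are Lie relations. On the other side, replacing \<open>Z\<^sup>i\<close> by
  \<open>Z\<^sup>i + c/(q\<^sup>i - 1)\<close> for \<open>i \<noteq> 0\<close> makes the cocycle homogeneous, and in terms of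
  \<open>E\<^bsub>a,j\<^esub> = Z\<^sup>a D\<^sup>j\<close> (with \<open>E\<^bsub>0,0\<^esub> = 0\<close> and the modified \<open>E\<^bsub>a,0\<^esub>\<close>) the Lie algebra is
  given by one bracket rule: \<open>[E\<^bsub>a,j\<^esub>, E\<^bsub>b,k\<^esub>]\<close> is
  \<open>(q\<^bsup>jb\<^esup> - q\<^bsup>ka\<^esup>) E\<^bsub>a+b,j+k\<^esub>\<close>, plus \<open>j q\<^bsup>-aj\<^esup> c\<close> if \<open>a + b = j + k = 0\<close>.
  The map \<open>\<theta>\<close> exists because the bracket rule implies the toroidal relations. It has an
  inverse as soon as the toroidal algebra contains elements \<open>E\<^bsub>a,j\<^esub>\<close> that obey the bracket
  rule; the inverse then sends \<open>Z\<^sup>a D\<^sup>j\<close> to these elements.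

  The heart of the proof is therefore that the Lie algebra generated by the \<open>e\<^sub>i\<close> is no larger
  than the span of the \<open>Z\<^sup>a D\<^sup>j\<close> with \<open>j > 0\<close>. Its part of bidegree \<open>(N, m + 1)\<close> is spanned
  by the brackets \<open>y\<^sub>a = [e\<^sub>a, E\<^bsub>N-a,m\<^esub>]\<close>, and one has to see that all of them are multiples
  \<open>(q\<^bsup>N-a\<^esup> - q\<^bsup>ma\<^esup>) Y\<close> of one element. Since a subspace is cut out by the linear functionals that
  vanish on it, it suffices to treat the \<open>y\<^sub>a\<close> as complex numbers. For \<open>m = 1\<close> the quadratic
  relation is a recurrence of order three with characteristic roots \<open>1, q, 1/q\<close>, and antisymmetry
  leaves a line of solutions. For \<open>m = 2\<close> the Jacobi identity and the cubic relation are two linear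
  equations between any three values \<open>y\<^sub>a, y\<^sub>b, y\<^sub>c\<close> with \<open>a + b + c = N\<close>. For \<open>m \<ge> 3\<close> the Jacobi
  identity for \<open>e\<^sub>a, e\<^sub>b, E\<^bsub>c,m-1\<^esub>\<close> is enough (\<open>higher_degree_solution\<close>). The coefficients that
  have to be inverted in these arguments are nonzero because \<open>q\<close> is not a root of unity, which is
  what the condition on \<open>h\<^sub>0\<close> says.

  The remaining brackets follow by induction, because the Jacobi identity propagates the bracket
  rule from two elements to their bracket (\<open>obeys_sum\<close>).
\<close>

section \<open>Free algebras\<close>

lemma lin_indicator: "lin (\<lambda>w. if w = k then 1 else 0) p = Poly_Mapping.lookup p k"
  by (auto simp: lin_def if_distrib sum.delta in_keys_iff cong: if_cong)

lemma free_alg_eqI: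
  assumes "\<And>u. lin u p = lin u r"
  shows "p = r"
  using assms[of "\<lambda>w. if w = k then 1 else 0" for k]
  by (intro poly_mapping_eqI) (simp add: lin_indicator)

lemma free_alg_induct [case_names single add]:
  fixes p :: "'x free_alg"
  assumes "\<And>w c. P (Poly_Mapping.single w c)" and "\<And>p r. P p \<Longrightarrow> P r \<Longrightarrow> P (p + r)"
  shows "P p"
proof -
  have "P (\<Sum>w\<in>A. Poly_Mapping.single w (Poly_Mapping.lookup p w))" for A
    by (induction A rule: infinite_finite_induct)
      (use assms(1)[of 0 0] assms in simp_all)
  then show ?thesis using sum_singles[of p] by metis
qed

lemmas lin_simps = lin_add lin_diff lin_uminus lin_scalar_mult

lemma scalar_central: "p * scalar c = scalar c * (p :: 'x free_alg)"
  by (rule free_alg_eqI) (simp add: scalar_def lin_mult_single lin_single_mult)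

lemma scalar_left_commute: "p * (scalar c * r) = scalar c * (p * (r :: 'x free_alg))"
  by (metis mult.assoc scalar_central)

lemma scalar_simps [simp]: "scalar 0 = 0" "scalar 1 = 1"
  by (simp_all add: scalar_def flip: single_one)

lemma scalar_add: "scalar (a + b) = scalar a + scalar b"
  by (simp add: scalar_def single_add)

lemma scalar_uminus: "scalar (- a) = - scalar a"
  by (simp add: scalar_def single_uminus)

lemma scalar_diff: "scalar (a - b) = scalar a - scalar b"
  by (simp add: scalar_def single_diff)

lemma scalar_scalar: "scalar a * scalar b = scalar (a * b)"
  by (simp add: scalar_def mult_single)

lemma commutator_linear:
  fixes x y z :: "'x free_alg"
  shows "commutator (x + y) z = commutator x z + commutator y z"
    "commutator z (x + y) = commutator z x + commutator z y"
    "commutator (x - y) z = commutator x z - commutator y z"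
    "commutator z (x - y) = commutator z x - commutator z y"
    "commutator (- x) z = - commutator x z"
    "commutator z (- x) = - commutator z x"
    "commutator (scalar c * x) z = scalar c * commutator x z"
    "commutator z (scalar c * x) = scalar c * commutator z x"
    "commutator 0 z = 0" "commutator z 0 = 0"
  by (simp_all add: commutator_def algebra_simps scalar_left_commute)

lemma commutator_swap: "commutator x y = - commutator y (x :: 'x free_alg)"
  by (simp add: commutator_def)

lemma Jacobi:
  "commutator (commutator x y) z + commutator (commutator y z) x
     = commutator (commutator x z) (y :: 'x free_alg)"
  by (simp add: commutator_def algebra_simps)

subsection \<open>Substitution\<close>

text \<open>
  The algebra homomorphism between free algebras that sends each letter \<open>x\<close> to \<open>f x\<close>.
\<close>

definition subst :: "('x \<Rightarrow> 'y free_alg) \<Rightarrow> 'x free_alg \<Rightarrow> 'y free_alg" where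
  "subst f p = (\<Sum>w \<in> Poly_Mapping.keys p.
     scalar (Poly_Mapping.lookup p w) * prod_list (map f (letters w)))"

lemma lin_subst: "lin u (subst f p) = lin (\<lambda>w. lin u (prod_list (map f (letters w)))) p"
  by (simp add: subst_def lin_sum lin_scalar_mult lin_def[of _ p])

lemma subst_add: "subst f (p + r) = subst f p + subst f r"
  and subst_diff: "subst f (p - r) = subst f p - subst f r"
  and subst_uminus: "subst f (- p) = - subst f p"
  and subst_0: "subst f 0 = 0"
  by (rule free_alg_eqI, simp add: lin_subst lin_simps)+

lemma subst_single: "subst f (Poly_Mapping.single w c) = scalar c * prod_list (map f (letters w))"
  by (rule free_alg_eqI) (simp add: lin_subst lin_simps)

lemma subst_scalar: "subst f (scalar c) = scalar c"
  by (simp add: scalar_def subst_single)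

lemma subst_1: "subst f 1 = 1"
  using subst_scalar[of f 1] by simp

lemma subst_letter: "subst f (letter x) = f x"
  by (simp add: letter_def subst_single)

lemma subst_mult: "subst f (p * r) = subst f p * subst f r"
proof -
  have "subst f (Poly_Mapping.single v c * Poly_Mapping.single w d) =
      subst f (Poly_Mapping.single v c) * subst f (Poly_Mapping.single w d)" for v w c d
    unfolding subst_single mult_single letters_plus map_append prod_list.append
      scalar_scalar[symmetric] mult.assoc
    by (metis scalar_central mult.assoc)
  then have "subst f (Poly_Mapping.single v c * r) = subst f (Poly_Mapping.single v c) * subst f r"
    for v c
    by (induction r rule: free_alg_induct) (simp_all add: distrib_left subst_add)
  then show ?thesis
    by (induction p rule: free_alg_induct) (simp_all add: distrib_right subst_add)
qed

lemma subst_commutator: "subst f (commutator x y) = commutator (subst f x) (subst f y)"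
  by (simp add: commutator_def subst_diff subst_mult)

lemmas subst_simps = subst_add subst_diff subst_uminus subst_0 subst_scalar subst_1
  subst_letter subst_mult subst_commutator

lemma prod_list_letters: "prod_list (map letter xs) = Poly_Mapping.single (Word xs) 1"
  by (induction xs) (simp_all add: letter_def mult_single plus_word_def flip: single_one zero_word_def)

lemma letter_power: "letter x ^ n = Poly_Mapping.single (Word (replicate n x)) 1"
  using prod_list_letters[of "replicate n x"] by simp

subsection \<open>Subalgebras on subsets of the letters, and their ideals\<close>

text \<open>
  A constant for the carrier of the free algebra on \<open>X\<close>, because the simplifier unfolds that carrier.
\<close>

definition subalg :: "'x set \<Rightarrow> 'x free_alg set" where
  "subalg X = carrier (free_algebra X)"

lemma subalg_UNIV [simp]: "x \<in> subalg UNIV"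
  by (simp add: subalg_def)

lemma subalg_closed [intro]:
  "0 \<in> subalg X" "1 \<in> subalg X" "scalar c \<in> subalg X"
  "x \<in> X \<Longrightarrow> letter x \<in> subalg X"
  "p \<in> subalg X \<Longrightarrow> r \<in> subalg X \<Longrightarrow> p + r \<in> subalg X"
  "p \<in> subalg X \<Longrightarrow> r \<in> subalg X \<Longrightarrow> p * r \<in> subalg X"
  "p \<in> subalg X \<Longrightarrow> - p \<in> subalg X"
  "p \<in> subalg X \<Longrightarrow> r \<in> subalg X \<Longrightarrow> p - r \<in> subalg X"
  "p \<in> subalg X \<Longrightarrow> r \<in> subalg X \<Longrightarrow> commutator p r \<in> subalg X"
proof -
  interpret ring "free_algebra X" by (rule ring_free_algebra)
  show *: "0 \<in> subalg X" "1 \<in> subalg X"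
    "p \<in> subalg X \<Longrightarrow> r \<in> subalg X \<Longrightarrow> p + r \<in> subalg X"
    "p \<in> subalg X \<Longrightarrow> r \<in> subalg X \<Longrightarrow> p * r \<in> subalg X" for p r
    using zero_closed one_closed a_closed[of p r] m_closed[of p r]
    by (simp_all add: subalg_def del: free_algebra_simps(1))
  show "x \<in> X \<Longrightarrow> letter x \<in> subalg X" "scalar c \<in> subalg X"
    by (auto simp: subalg_def letter_def scalar_def split: if_splits)
  show m: "p \<in> subalg X \<Longrightarrow> - p \<in> subalg X" for p
    by (simp add: subalg_def)
  show d: "p \<in> subalg X \<Longrightarrow> r \<in> subalg X \<Longrightarrow> p - r \<in> subalg X" for p r
    using *(3)[of p "- r"] m[of r] by simp
  show "p \<in> subalg X \<Longrightarrow> r \<in> subalg X \<Longrightarrow> commutator p r \<in> subalg X"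
    unfolding commutator_def by (intro d *)
qed

lemma subalg_induct [consumes 1, case_names scalar letter add mult]:
  fixes p :: "'x free_alg"
  assumes "p \<in> subalg X"
    and "\<And>c. P (scalar c)" "\<And>x. x \<in> X \<Longrightarrow> P (letter x)"
    and add: "\<And>p r. p \<in> subalg X \<Longrightarrow> r \<in> subalg X \<Longrightarrow> P p \<Longrightarrow> P r \<Longrightarrow> P (p + r)"
    and mult: "\<And>p r. p \<in> subalg X \<Longrightarrow> r \<in> subalg X \<Longrightarrow> P p \<Longrightarrow> P r \<Longrightarrow> P (p * r)"
  shows "P p"
proof -
  have word: "P (Poly_Mapping.single (Word xs) 1) \<and> Poly_Mapping.single (Word xs) 1 \<in> subalg X"
    if "set xs \<subseteq> X" for xs
    using that
  proof (induction xs)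
    case Nil
    then show ?case
      using assms(2)[of 1] subalg_closed(2)[of X] prod_list_letters[of "[] :: 'x list"] by simp
  next
    case (Cons x xs)
    have "Poly_Mapping.single (Word (x # xs)) 1 = letter x * Poly_Mapping.single (Word xs) 1"
      by (simp add: letter_def mult_single plus_word_def)
    moreover have "x \<in> X" "set xs \<subseteq> X" using Cons.prems by auto
    ultimately show ?case
      using Cons.IH assms(3)[of x] mult[of "letter x"] subalg_closed(4,6) by metis
  qed
  have "P (sum (\<lambda>w. Poly_Mapping.single w (Poly_Mapping.lookup p w)) A) \<and>
      sum (\<lambda>w. Poly_Mapping.single w (Poly_Mapping.lookup p w)) A \<in> subalg X"
    if "\<And>w. w \<in> A \<Longrightarrow> set (letters w) \<subseteq> X" "finite A" for A
    using that(2,1)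
  proof (induction A)
    case empty
    then show ?case using assms(2)[of 0] by (simp add: subalg_closed(1))
  next
    case (insert w A)
    have "Poly_Mapping.single w d = scalar d * Poly_Mapping.single (Word (letters w)) 1" for d
      by (simp add: scalar_def mult_single)
    moreover have "P (Poly_Mapping.single (Word (letters w)) 1) \<and>
        Poly_Mapping.single (Word (letters w)) 1 \<in> subalg X"
      by (rule word) (simp add: insert.prems)
    ultimately have "P (Poly_Mapping.single w d) \<and> Poly_Mapping.single w d \<in> subalg X" for d
      using assms(2)[of d] mult[of "scalar d"] subalg_closed(3,6) by metis
    moreover note insert.IH[OF insert.prems]
    ultimately show ?case unfolding sum.insert[OF insert.hyps]
      by (simp add: add subalg_closed(5))
  qed
  then have "P (sum (\<lambda>w. Poly_Mapping.single w (Poly_Mapping.lookup p w)) (Poly_Mapping.keys p))"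
    using assms(1) by (simp add: subalg_def)
  then show ?thesis using sum_singles[of p] by (rule back_subst[of P, OF _ sym])
qed

lemma subst_subalg:
  assumes "p \<in> subalg X" "\<And>x. x \<in> X \<Longrightarrow> f x \<in> subalg Y"
  shows "subst f p \<in> subalg Y"
  using assms(1) by (induction rule: subalg_induct) (auto simp: subst_simps assms(2))

locale free_ideal =
  fixes X :: "'x set" and I :: "'x free_alg set"
  assumes ideal: "ideal I (free_algebra X)"
begin

lemma subset: "I \<subseteq> subalg X"
  using additive_subgroup.a_subset[OF ideal.axioms(1)[OF ideal]] by (simp add: subalg_def)

lemma closed:
  shows zero: "0 \<in> I"
    and add: "p \<in> I \<Longrightarrow> r \<in> I \<Longrightarrow> p + r \<in> I"
    and mult_left: "p \<in> I \<Longrightarrow> a \<in> subalg X \<Longrightarrow> a * p \<in> I"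
    and mult_right: "p \<in> I \<Longrightarrow> a \<in> subalg X \<Longrightarrow> p * a \<in> I"
    and smult: "p \<in> I \<Longrightarrow> scalar c * p \<in> I"
    and uminus: "p \<in> I \<Longrightarrow> - p \<in> I"
    and diff: "p \<in> I \<Longrightarrow> r \<in> I \<Longrightarrow> p - r \<in> I"
proof -
  interpret ideal I "free_algebra X" by (rule ideal)
  show "0 \<in> I" "p \<in> I \<Longrightarrow> r \<in> I \<Longrightarrow> p + r \<in> I" for p r
    using additive_subgroup.zero_closed[OF is_additive_subgroup]
      additive_subgroup.a_closed[OF is_additive_subgroup, of p r] by simp_all
  show l: "p \<in> I \<Longrightarrow> a \<in> subalg X \<Longrightarrow> a * p \<in> I"
    and "p \<in> I \<Longrightarrow> a \<in> subalg X \<Longrightarrow> p * a \<in> I" for p a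
    using I_l_closed[of p a] I_r_closed[of p a] by (simp_all add: subalg_def)
  show s: "p \<in> I \<Longrightarrow> scalar c * p \<in> I" for p c
    using l[of p "scalar c"] by auto
  show m: "p \<in> I \<Longrightarrow> - p \<in> I" for p
    using l[of p "- 1"] by auto
  show "p - r \<in> I" if "p \<in> I" "r \<in> I" for p r
    using additive_subgroup.a_closed[OF is_additive_subgroup that(1) m[OF that(2)]] by simp
qed

lemma commutator_left: "p \<in> I \<Longrightarrow> a \<in> subalg X \<Longrightarrow> commutator p a \<in> I"
  and commutator_right: "p \<in> I \<Longrightarrow> a \<in> subalg X \<Longrightarrow> commutator a p \<in> I"
  by (simp_all add: commutator_def diff mult_left mult_right)

text \<open>
  Every linear functional on the free algebra is of the form \<open>lin u\<close>, so the annihilator of the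
  ideal is a set of functions on words.
\<close>

definition ann :: "('x word \<Rightarrow> complex) set" where
  "ann = {u. \<forall>p \<in> I. lin u p = 0}"

lemma annD: "u \<in> ann \<Longrightarrow> p \<in> I \<Longrightarrow> lin u p = 0"
  by (simp add: ann_def)

text \<open>
  A linear functional that vanishes on \<open>I\<close> but not at a given point outside is obtained by extending
  a basis of \<open>I\<close>. This turns congruences modulo \<open>I\<close> into identities of complex numbers, where
  division and the arithmetic of \<open>q\<close> are available.
\<close>

lemma separation:
  assumes "\<And>u. u \<in> ann \<Longrightarrow> lin u x = 0"
  shows "x \<in> I"
proof (rule ccontr)
  assume x: "x \<notin> I"
  let ?s = "\<lambda>c (p :: 'x free_alg). scalar c * p"
  interpret V: vector_space ?s
    by unfold_locales (simp_all add: distrib_left distrib_right scalar_add scalar_scalar[symmetric] mult.assoc)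
  interpret vector_space_pair ?s "(*) :: complex \<Rightarrow> complex \<Rightarrow> complex"
    by unfold_locales (simp_all add: algebra_simps)
  have sub: "V.subspace I"
    by (rule V.subspaceI) (simp_all add: zero add smult)
  obtain B where B: "B \<subseteq> I" "V.independent B" "I \<subseteq> V.span B"
    by (rule V.basis_exists[of I])
  have span: "V.span B = I"
    by (rule V.span_subspace[OF B(1,3) sub])
  have indep: "V.independent (insert x B)"
    using x B(2) unfolding span[symmetric] by (rule V.independent_insertI)
  define f :: "'x free_alg \<Rightarrow> complex" where "f y = (if y = x then 1 else 0)" for y
  obtain g where g: "Vector_Spaces.linear ?s (*) g" "\<forall>y \<in> insert x B. g y = f y"
    using linear_independent_extend[OF indep, of f] by (elim exE conjE)
  interpret g: Vector_Spaces.linear ?s "(*)" g by (rule g(1))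
  define u where "u w = g (Poly_Mapping.single w 1)" for w
  have "g (scalar c * Poly_Mapping.single w 1) = c * u w" for w c
    by (simp add: u_def g.scale)
  then have gs: "g (Poly_Mapping.single w c) = c * u w" for w c
    by (simp add: scalar_def mult_single)
  have g_lin: "lin u p = g p" for p
    by (subst (2) sum_singles[of p]) (simp add: g.sum gs lin_def)
  have "g y = 0" if "y \<in> V.span B" for y
    using that
  proof (rule V.span_induct)
    show "V.subspace (Collect (\<lambda>y. g y = 0))"
      by (rule V.subspaceI) (simp_all add: g.add g.scale g.zero)
    show "\<And>y. y \<in> B \<Longrightarrow> g y = 0" using g(2) x B(1) by (auto simp: f_def)
  qed
  then have "u \<in> ann" by (simp add: ann_def g_lin span)
  moreover have "lin u x = 1" by (simp add: g_lin g(2) f_def)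
  ultimately show False using assms by fastforce
qed

lemma mem_iff: "x \<in> I \<longleftrightarrow> (\<forall>u \<in> ann. lin u x = 0)"
  using separation annD by blast

end

section \<open>Recurrences with geometric solutions\<close>

lemma geometric1:
  fixes y :: "int \<Rightarrow> complex"
  assumes "\<alpha> \<noteq> 0" and y: "\<And>k. y (k + 1) = \<alpha> * y k"
  shows "y k = y 0 * \<alpha> powi k"
proof (induction k rule: int_induct[where k = 0])
  case (step1 i)
  then show ?case using y[of i] assms(1) by (simp add: power_int_add)
next
  case (step2 i)
  then show ?case using y[of "i - 1"] assms(1) by (simp add: power_int_diff field_simps)
qed simp

text \<open>
  The operators \<open>S - \<beta>\<close> and \<open>S - \<alpha>\<close>, for the shift \<open>S\<close>, map \<open>y\<close> to solutions of first
  order recurrences, and \<open>y\<close> is a combination of the two images. The next lemma repeats the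
  argument one order higher.
\<close>

lemma geometric2:
  fixes y :: "int \<Rightarrow> complex"
  assumes nz: "\<alpha> \<noteq> 0" "\<beta> \<noteq> 0" and ne: "\<alpha> \<noteq> \<beta>"
    and y: "\<And>k. y (k + 2) = (\<alpha> + \<beta>) * y (k + 1) - \<alpha> * \<beta> * y k"
  shows "\<exists>A B. \<forall>k. y k = A * \<alpha> powi k + B * \<beta> powi k"
proof -
  define c d where "c = y 1 - \<beta> * y 0" and "d = y 1 - \<alpha> * y 0"
  have "y (k + 1) - \<beta> * y k = c * \<alpha> powi k" "y (k + 1) - \<alpha> * y k = d * \<beta> powi k" for k
    using geometric1[OF nz(1), of "\<lambda>k. y (k + 1) - \<beta> * y k" k]
      geometric1[OF nz(2), of "\<lambda>k. y (k + 1) - \<alpha> * y k" k] y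
    by (simp_all add: algebra_simps c_def d_def)
  moreover have "(\<alpha> - \<beta>) * y k = (y (k + 1) - \<beta> * y k) - (y (k + 1) - \<alpha> * y k)" for k
    by (simp add: algebra_simps)
  ultimately have "(\<alpha> - \<beta>) * y k = c * \<alpha> powi k - d * \<beta> powi k" for k
    by simp
  then have "y k = (c * \<alpha> powi k - d * \<beta> powi k) / (\<alpha> - \<beta>)" for k
    using ne by (metis nonzero_mult_div_cancel_left right_minus_eq)
  then have "y k = c / (\<alpha> - \<beta>) * \<alpha> powi k + (- d / (\<alpha> - \<beta>)) * \<beta> powi k" for k
    by (simp add: diff_divide_distrib)
  then show ?thesis by (intro exI allI)
qed

lemma geometric3:
  fixes y :: "int \<Rightarrow> complex"
  assumes nz: "\<alpha> \<noteq> 0" "\<beta> \<noteq> 0" "\<gamma> \<noteq> 0" and ne: "\<alpha> \<noteq> \<beta>" "\<alpha> \<noteq> \<gamma>" "\<beta> \<noteq> \<gamma>"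
    and y: "\<And>k. y (k + 3) = (\<alpha> + \<beta> + \<gamma>) * y (k + 2)
        - (\<alpha> * \<beta> + \<alpha> * \<gamma> + \<beta> * \<gamma>) * y (k + 1) + \<alpha> * \<beta> * \<gamma> * y k"
  shows "\<exists>A B C. \<forall>k. y k = A * \<alpha> powi k + B * \<beta> powi k + C * \<gamma> powi k"
proof -
  obtain A B where A: "y (k + 1) - \<gamma> * y k = A * \<alpha> powi k + B * \<beta> powi k" for k
    using geometric2[OF nz(1,2) ne(1), of "\<lambda>k. y (k + 1) - \<gamma> * y k"] y
    by (auto simp: algebra_simps)
  obtain A' C where C: "y (k + 1) - \<beta> * y k = A' * \<alpha> powi k + C * \<gamma> powi k" for k
    using geometric2[OF nz(1,3) ne(2), of "\<lambda>k. y (k + 1) - \<beta> * y k"] y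
    by (auto simp: algebra_simps)
  have "(\<beta> - \<gamma>) * y k = (A - A') * \<alpha> powi k + B * \<beta> powi k - C * \<gamma> powi k" for k
  proof -
    have "(\<beta> - \<gamma>) * y k = (y (k + 1) - \<gamma> * y k) - (y (k + 1) - \<beta> * y k)"
      by (simp add: algebra_simps)
    then show ?thesis unfolding A C by (simp add: algebra_simps)
  qed
  then have "y k = ((A - A') * \<alpha> powi k + B * \<beta> powi k - C * \<gamma> powi k) / (\<beta> - \<gamma>)" for k
    using ne by (metis nonzero_mult_div_cancel_left right_minus_eq)
  then have "y k = (A - A') / (\<beta> - \<gamma>) * \<alpha> powi k + B / (\<beta> - \<gamma>) * \<beta> powi k
      + (- C / (\<beta> - \<gamma>)) * \<gamma> powi k" for k
    by (simp add: add_divide_distrib diff_divide_distrib left_diff_distrib)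
  then show ?thesis by (intro exI allI)
qed

locale not_root_of_unity =
  fixes q :: complex
  assumes q_nonzero [simp]: "q \<noteq> 0"
    and powi_eq_1: "\<And>n :: int. q powi n = 1 \<Longrightarrow> n = 0"
begin

lemma powi_inj: "q powi a = q powi b \<longleftrightarrow> a = b"
  using powi_eq_1[of "a - b"] q_nonzero by (auto simp: power_int_diff)

lemma powi_add: "q powi (a + b) = q powi a * q powi b"
  and powi_diff: "q powi (a - b) = q powi a / q powi b"
  using q_nonzero by (simp_all add: power_int_add power_int_diff)

lemma powi_nonzero [simp]: "q powi a \<noteq> 0"
  using q_nonzero by simp

lemma power_ne: "m \<noteq> n \<Longrightarrow> q ^ m \<noteq> q ^ n"
  using powi_inj[of "int m" "int n"] by simp

lemma q_ne: "q \<noteq> 1" "q * q \<noteq> 1" "q * q \<noteq> q"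
  using power_ne[of 1 0] power_ne[of 2 0] power_ne[of 2 1] by (simp_all add: power2_eq_square)

text \<open>
  The case \<open>m = 1\<close>: here \<open>x k\<close> stands for \<open>[e\<^sub>k, e\<^bsub>N-k\<^esub>]\<close>. The recurrence comes from the quadratic
  relation and leaves three parameters, of which the antisymmetry of the bracket kills two.
\<close>

lemma quadratic_relation_solution:
  fixes x :: "int \<Rightarrow> complex" and N :: int
  assumes anti: "\<And>k. x (N - k) = - x k"
    and rec: "\<And>k. x (k + 3) - (1 + q + inverse q) * x (k + 2)
      + (1 + q + inverse q) * x (k + 1) - x k = 0"
  obtains Y where "\<And>k. x k = (q powi (N - k) - q powi k) * Y"
proof -
  have ne: "1 \<noteq> q" "1 \<noteq> inverse q" "q \<noteq> inverse q"
    using q_ne q_nonzero by (auto simp: field_simps)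
  obtain A B C where x: "x k = A * 1 powi k + B * q powi k + C * inverse q powi k" for k
  proof -
    have "x (k + 3) = (1 + q + inverse q) * x (k + 2) - (1 * q + 1 * inverse q + q * inverse q) * x (k + 1)
        + 1 * q * inverse q * x k" for k
      using rec[of k] by (simp add: algebra_simps)
    then show thesis
      using geometric3[of 1 q "inverse q" x] ne that by auto
  qed
  have x: "x k = A + B * q powi k + C / q powi k" for k
    unfolding x by (simp add: power_int_inverse divide_inverse)
  define n where "n = q powi N"
  have n: "n \<noteq> 0" by (simp add: n_def)
  define D where "D = B + C / n"
  have D: "2 * A + D * q powi k + D * n / q powi k = 0" for k
  proof -
    have "(B + C / n) * n = B * n + C" using n by (simp add: field_simps)
    then show ?thesis
      using anti[of k] unfolding x powi_diff n_def[symmetric] D_def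
      by (simp add: algebra_simps add_divide_distrib)
  qed
  have D3: "2 * A + D + D * n = 0" "2 * A + D * q + D * n / q = 0" "2 * A + D / q + D * n * q = 0"
    using D[of 0] D[of 1] D[of "-1"] q_nonzero by (simp_all add: power_int_minus field_simps)
  have "D * ((1 - q) * (1 - n / q)) = (2 * A + D + D * n) - (2 * A + D * q + D * n / q)"
    "D * ((1 - q) * (n - 1 / q)) = (2 * A + D + D * n) - (2 * A + D / q + D * n * q)"
    using q_nonzero by (simp_all add: field_simps)
  then have "D * ((1 - q) * (1 - n / q)) = 0" "D * ((1 - q) * (n - 1 / q)) = 0"
    unfolding D3 by simp_all
  then have "D = 0 \<or> n / q = 1 \<and> n = 1 / q"
    using q_ne(1) by auto
  then have "D = 0"
    using q_ne by (auto simp: field_simps)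
  with D3(1) have A: "A = 0" by simp
  have B: "B = - (C / n)" using \<open>D = 0\<close> unfolding D_def by (simp add: eq_neg_iff_add_eq_0)
  then have "x k = (q powi (N - k) - q powi k) * (C / n)" for k
    using n unfolding x A B powi_diff n_def[symmetric] by (simp add: algebra_simps)
  then show thesis by (rule that)
qed

text \<open>
  The case \<open>m = 2\<close>: here \<open>y a\<close> stands for \<open>[e\<^sub>a, E\<^bsub>N-a,2\<^esub>]\<close>. The sum and the difference of the two
  equations say that \<open>(y a, y b, y c)\<close> is orthogonal to \<open>(q\<^sup>c, q\<^sup>a, q\<^sup>b)\<close> and to
  \<open>(q\<^sup>b, q\<^sup>c, q\<^sup>a)\<close>, hence a multiple of their cross product.
\<close>

lemma cubic_relation_solution:
  fixes y :: "int \<Rightarrow> complex" and N :: int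
  assumes jac: "\<And>a b c. a + b + c = N \<Longrightarrow> (q powi c - q powi b) * y a
      + (q powi a - q powi c) * y b + (q powi b - q powi a) * y c = 0"
    and serre: "\<And>a b c. a + b + c = N \<Longrightarrow> (q powi c + q powi b) * y a
      + (q powi a + q powi c) * y b + (q powi b + q powi a) * y c = 0"
  obtains Y where "\<And>a. y a = (q powi (N - a) - q powi (2 * a)) * Y"
proof -
  have rel: "(q powi (N - b) - q powi (2 * b)) * y a = (q powi (N - a) - q powi (2 * a)) * y b" for a b
  proof -
    define c where "c = N - a - b"
    have c: "a + b + c = N" "N - a = b + c" "N - b = a + c" by (simp_all add: c_def)
    define A B C where "A = q powi a" "B = q powi b" "C = q powi c"
    have "2 * (C * y a + A * y b + B * y c) =
        ((C - B) * y a + (A - C) * y b + (B - A) * y c) + ((C + B) * y a + (A + C) * y b + (B + A) * y c)"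
      "2 * (B * y a + C * y b + A * y c) =
        ((C + B) * y a + (A + C) * y b + (B + A) * y c) - ((C - B) * y a + (A - C) * y b + (B - A) * y c)"
      by (simp_all add: algebra_simps)
    then have "2 * (C * y a + A * y b + B * y c) = 0" "2 * (B * y a + C * y b + A * y c) = 0"
      unfolding jac[OF c(1), folded A_B_C_def] serre[OF c(1), folded A_B_C_def] by (simp_all only: add_0 diff_0_right)
    then have eq: "C * y a + A * y b + B * y c = 0" "B * y a + C * y b + A * y c = 0"
      by (metis mult_eq_0_iff zero_neq_numeral)+
    have "(A * C - B * B) * y a + (A * A - B * C) * y b =
        A * (C * y a + A * y b + B * y c) - B * (B * y a + C * y b + A * y c)"
      by (simp add: algebra_simps)
    then have "(A * C - B * B) * y a + (A * A - B * C) * y b = 0"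
      unfolding eq by simp
    then show ?thesis
      unfolding c powi_add mult_2 A_B_C_def by (simp add: algebra_simps)
  qed
  have "\<exists>b. N \<noteq> 3 * b" by presburger
  then obtain b where "N \<noteq> 3 * b" ..
  then have "q powi (N - b) - q powi (2 * b) \<noteq> 0"
    by (simp add: powi_inj)
  then have "y a = (q powi (N - a) - q powi (2 * a)) * y b / (q powi (N - b) - q powi (2 * b))" for a
    unfolding rel[of b a, symmetric] by (rule nonzero_mult_div_cancel_left[symmetric])
  then have "y a = (q powi (N - a) - q powi (2 * a)) * (y b / (q powi (N - b) - q powi (2 * b)))" for a
    unfolding times_divide_eq_right .
  then show thesis by (rule that)
qed

text \<open>
  The case \<open>m \<ge> 3\<close>: here \<open>y a\<close> stands for \<open>[e\<^sub>a, E\<^bsub>N-a,m\<^esub>]\<close> and \<open>\<Psi> d\<close> for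
  \<open>[E\<^bsub>d,2\<^esub>, E\<^bsub>N-d,m-1\<^esub>]\<close>, so \<open>jac\<close> is the Jacobi identity for \<open>e\<^sub>a, e\<^sub>b, E\<^bsub>N-a-b,m-1\<^esub>\<close>. As \<open>\<Psi>\<close>
  enters only through \<open>a + b\<close>, it can be eliminated between two pairs \<open>(a, b)\<close> with the same sum.
  Let \<open>S\<close> be the shift of \<open>y\<close>, and let \<open>u = (1 - q S) (S - q\<^sup>m) y\<close>. Two different combinations
  of the eliminated equations give \<open>(S - q) (S - 1) u = 0\<close> and
  \<open>(S - q\<^bsup>m-1\<^esup>) (S - q\<^bsup>m-2\<^esup>) u = 0\<close>. For \<open>m > 3\<close> these have no common solution, so \<open>u = 0\<close>
  and \<open>y\<close> is spanned by \<open>q\<^bsup>-a\<^esup>\<close> and \<open>q\<^bsup>ma\<^esup>\<close>; any one of the eliminated equations then fixes the ratio.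
  For \<open>m = 3\<close> the common root \<open>q\<close> leaves a further summand \<open>C q\<^sup>a\<close>, which is excluded because then
  \<open>\<Psi> d\<close> is a bracket of two elements of the same kind and so antisymmetric.
\<close>

lemma higher_degree_solution:
  fixes y \<Psi> :: "int \<Rightarrow> complex" and N m :: int
  assumes m: "m \<ge> 3"
    and jac: "\<And>a b. (q powi (N - a - b) - q powi ((m - 1) * b)) * y a
      - (q powi (N - a - b) - q powi ((m - 1) * a)) * y b = (q powi b - q powi a) * \<Psi> (a + b)"
    and anti: "\<And>d. m = 3 \<Longrightarrow> \<Psi> (N - d) = - \<Psi> d"
  obtains Y where "\<And>a. y a = (q powi (N - a) - q powi (m * a)) * Y"
proof -
  define P where "P = q powi (m - 1)"
  have Pq: "q powi m = P * q"
    by (simp add: P_def powi_diff)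
  have P_ne: "P \<noteq> 0" "P \<noteq> 1" "P \<noteq> q" "P * q \<noteq> 1" "P * q\<^sup>2 \<noteq> 1"
    and P3: "P = q\<^sup>2 \<longleftrightarrow> m = 3"
    using m powi_inj[of "m - 1" 0] powi_inj[of "m - 1" 1] powi_inj[of m 0]
      powi_inj[of "m + 1" 0] powi_inj[of "m - 1" 2]
    by (auto simp: P_def powi_diff powi_add power2_eq_square)
  have q1: "1 + q \<noteq> 0" "q\<^sup>2 \<noteq> 1"
    using q_ne(2) by (auto simp: power2_eq_square add_eq_0_iff)
  \<comment> \<open>\<open>jac\<close> at \<open>(k + i, k + j)\<close>. The base exponent \<open>N - 2 k - 5\<close> of \<open>v\<close> avoids negative powers, as \<open>i + j \<le> 5\<close>.\<close>
  have inst: "(v * q ^ (5 - i - j) - z * P ^ j) * y (k + int i) - (v * q ^ (5 - i - j) - z * P ^ i) * y (k + int j)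
      = x * (q ^ j - q ^ i) * \<Psi> (2 * k + int (i + j))"
    if "i + j \<le> 5" "v = q powi (N - 2 * k - 5)" "z = q powi ((m - 1) * k)" "x = q powi k" for i j k v z x
  proof -
    have 1: "q powi (N - (k + int i) - (k + int j)) = v * q ^ (5 - i - j)"
    proof -
      have "N - (k + int i) - (k + int j) = N - 2 * k - 5 + int (5 - i - j)"
        using that(1) by simp
      then show ?thesis unfolding that(2) by (simp only: powi_add power_int_of_nat)
    qed
    have 2: "q powi ((m - 1) * (k + int j)) = z * P ^ j" for j
      unfolding that(3) P_def distrib_left powi_add power_int_mult power_int_of_nat ..
    have 3: "q powi (k + int j) = x * q ^ j" for j
      unfolding that(4) powi_add power_int_of_nat ..
    show ?thesis
      using jac[of "k + int i" "k + int j"] unfolding 1 2 3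
      by (simp add: algebra_simps)
  qed
  \<comment> \<open>The equations free of \<open>\<Psi>\<close> from the pairs \<open>(3, 0), (2, 1)\<close>, then \<open>(4, 0), (3, 1)\<close>, then \<open>(4, 1), (3, 2)\<close>.\<close>
  define s where "s = 1 + q + q\<^sup>2"
  have R3: "- q * ((v * q\<^sup>2 - z) * y (k + 3) - (v * q\<^sup>2 - z * P ^ 3) * y k)
      + s * ((v * q\<^sup>2 - z * P) * y (k + 2) - (v * q\<^sup>2 - z * P\<^sup>2) * y (k + 1)) = 0"
    and R4: "- q * ((v * q - z) * y (k + 4) - (v * q - z * P ^ 4) * y k)
      + (1 + q\<^sup>2) * ((v * q - z * P) * y (k + 3) - (v * q - z * P ^ 3) * y (k + 1)) = 0"
    and R5: "- q * ((v - z * P) * y (k + 4) - (v - z * P ^ 4) * y (k + 1))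
      + s * ((v - z * P\<^sup>2) * y (k + 3) - (v - z * P ^ 3) * y (k + 2)) = 0"
    if vz: "v = q powi (N - 2 * k - 5)" "z = q powi ((m - 1) * k)" for k v z
  proof -
    note i = inst[OF _ vz refl]
    have Psi3: "(v * q\<^sup>2 - z) * y (k + 3) - (v * q\<^sup>2 - z * P ^ 3) * y k = q powi k * (1 - q ^ 3) * \<Psi> (2 * k + 3)"
      "(v * q\<^sup>2 - z * P) * y (k + 2) - (v * q\<^sup>2 - z * P\<^sup>2) * y (k + 1) = q powi k * (q - q\<^sup>2) * \<Psi> (2 * k + 3)"
      using i[of 3 0] i[of 2 1] by simp_all
    have Psi4: "(v * q - z) * y (k + 4) - (v * q - z * P ^ 4) * y k = q powi k * (1 - q ^ 4) * \<Psi> (2 * k + 4)"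
      "(v * q - z * P) * y (k + 3) - (v * q - z * P ^ 3) * y (k + 1) = q powi k * (q - q ^ 3) * \<Psi> (2 * k + 4)"
      using i[of 4 0] i[of 3 1] by simp_all
    have Psi5: "(v - z * P) * y (k + 4) - (v - z * P ^ 4) * y (k + 1) = q powi k * (q - q ^ 4) * \<Psi> (2 * k + 5)"
      "(v - z * P\<^sup>2) * y (k + 3) - (v - z * P ^ 3) * y (k + 2) = q powi k * (q\<^sup>2 - q ^ 3) * \<Psi> (2 * k + 5)"
      using i[of 4 1] i[of 3 2] by simp_all
    show "- q * ((v * q\<^sup>2 - z) * y (k + 3) - (v * q\<^sup>2 - z * P ^ 3) * y k)
      + s * ((v * q\<^sup>2 - z * P) * y (k + 2) - (v * q\<^sup>2 - z * P\<^sup>2) * y (k + 1)) = 0"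
      "- q * ((v * q - z) * y (k + 4) - (v * q - z * P ^ 4) * y k)
      + (1 + q\<^sup>2) * ((v * q - z * P) * y (k + 3) - (v * q - z * P ^ 3) * y (k + 1)) = 0"
      "- q * ((v - z * P) * y (k + 4) - (v - z * P ^ 4) * y (k + 1))
      + s * ((v - z * P\<^sup>2) * y (k + 3) - (v - z * P ^ 3) * y (k + 2)) = 0"
      unfolding Psi3 Psi4 Psi5 s_def by (simp_all add: algebra_simps power_numeral_reduce)
  qed
  define u where "u k = - q * y (k + 2) + (1 + P * q\<^sup>2) * y (k + 1) - P * q * y k" for k
  have u_step: "(1 + q) * u (k + 1) = (q + P) * u k"
    and u_rec: "u (k + 2) = (1 + q) * u (k + 1) - q * u k" for k
  proof -
    define v where "v = q powi (N - 2 * k - 5)"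
    define z where "z = q powi ((m - 1) * k)"
    have vz: "v \<noteq> 0" "z \<noteq> 0" by (simp_all add: v_def z_def)
    have R: "- q * ((v * q\<^sup>2 - z) * y (k + 3) - (v * q\<^sup>2 - z * P ^ 3) * y k)
      + s * ((v * q\<^sup>2 - z * P) * y (k + 2) - (v * q\<^sup>2 - z * P\<^sup>2) * y (k + 1)) = 0"
      (is "?R3 = 0")
      "- q * ((v * q - z) * y (k + 4) - (v * q - z * P ^ 4) * y k)
      + (1 + q\<^sup>2) * ((v * q - z * P) * y (k + 3) - (v * q - z * P ^ 3) * y (k + 1)) = 0"
      (is "?R4 = 0")
      "- q * ((v - z * P) * y (k + 4) - (v - z * P ^ 4) * y (k + 1))
      + s * ((v - z * P\<^sup>2) * y (k + 3) - (v - z * P ^ 3) * y (k + 2)) = 0"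
      (is "?R5 = 0")
      by (fact R3[OF v_def z_def] R4[OF v_def z_def] R5[OF v_def z_def])+
    have u: "u k = - q * y (k + 2) + (1 + P * q\<^sup>2) * y (k + 1) - P * q * y k"
      "u (k + 1) = - q * y (k + 3) + (1 + P * q\<^sup>2) * y (k + 2) - P * q * y (k + 1)"
      "u (k + 2) = - q * y (k + 4) + (1 + P * q\<^sup>2) * y (k + 3) - P * q * y (k + 2)"
      by (simp_all add: u_def algebra_simps)
    \<comment> \<open>The terms in \<open>z\<close> cancel here, and the terms in \<open>v\<close> in the next combination.\<close>
    have "v * (1 - P * q) * (u (k + 2) - (1 + q) * u (k + 1) + q * u k) = 0"
    proof -
      have "v * (1 - P * q) * (u (k + 2) - (1 + q) * u (k + 1) + q * u k) = ?R5 - P * ?R4 + P\<^sup>2 * ?R3"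
        unfolding u s_def by (simp add: algebra_simps power_numeral_reduce)
      then show ?thesis unfolding R by simp
    qed
    then have 1: "u (k + 2) - (1 + q) * u (k + 1) + q * u k = 0"
      using vz P_ne by simp
    then show "u (k + 2) = (1 + q) * u (k + 1) - q * u k"
      by (simp add: algebra_simps)
    have "z * (1 - P * q) * (q * u (k + 2) - P * (1 + q) * u (k + 1) + P\<^sup>2 * u k) = 0"
    proof -
      have "z * (1 - P * q) * (q * u (k + 2) - P * (1 + q) * u (k + 1) + P\<^sup>2 * u k) =
          q\<^sup>2 * ?R5 - q * ?R4 + ?R3"
        unfolding u s_def by (simp add: algebra_simps power_numeral_reduce)
      then show ?thesis unfolding R by simp
    qed
    then have 2: "q * u (k + 2) - P * (1 + q) * u (k + 1) + P\<^sup>2 * u k = 0"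
      using vz P_ne by simp
    have "(P - q) * ((1 + q) * u (k + 1) - (q + P) * u k) =
        q * (u (k + 2) - (1 + q) * u (k + 1) + q * u k)
        - (q * u (k + 2) - P * (1 + q) * u (k + 1) + P\<^sup>2 * u k)"
      by (simp add: algebra_simps power2_eq_square)
    then have "(P - q) * ((1 + q) * u (k + 1) - (q + P) * u k) = 0"
      unfolding 1 2 by simp
    then show "(1 + q) * u (k + 1) = (q + P) * u k" using P_ne by simp
  qed
  have u_zero: "u k = 0" if "m \<noteq> 3" for k
  proof -
    have "u (k + 2) = P * u k"
      unfolding u_rec u_step by (simp add: algebra_simps)
    moreover have "k + 1 + 1 = k + 2" by simp
    ultimately have 2: "(1 + q) * (P * u k) = (q + P) * u (k + 1)"
      using u_step[of "k + 1"] by metis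
    have "(P - 1) * (P - q\<^sup>2) * u k = (q + P) * ((q + P) * u k) - (1 + q) * ((1 + q) * (P * u k))"
      by (simp add: algebra_simps power2_eq_square)
    also have "\<dots> = 0"
      unfolding 2 u_step[of k, symmetric] by simp
    finally have "(P - 1) * (P - q\<^sup>2) * u k = 0" .
    then show ?thesis using P_ne P3 that by simp
  qed
  have "\<exists>A B C. (\<forall>k. y k = A * inverse q powi k + B * (P * q) powi k + C * q powi k) \<and> (m \<noteq> 3 \<longrightarrow> C = 0)"
  proof (cases "m = 3")
    case True
    have P: "P = q\<^sup>2" using True P3 by simp
    have "y (k + 3) = (inverse q + P * q + q) * y (k + 2)
        - (inverse q * (P * q) + inverse q * q + P * q * q) * y (k + 1) + inverse q * (P * q) * q * y k" for k
    proof -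
      have "(1 + q) * (u (k + 1) - q * u k) = 0"
        using u_step[of k] unfolding P by (simp add: algebra_simps power2_eq_square)
      then have "u (k + 1) = q * u k" using q1 by simp
      then have "q * y (k + 3) = (1 + P * q\<^sup>2) * y (k + 2) - P * q * y (k + 1)
          - q * (- q * y (k + 2) + (1 + P * q\<^sup>2) * y (k + 1) - P * q * y k)"
        by (simp add: u_def algebra_simps)
      then have "y (k + 3) = inverse q * ((1 + P * q\<^sup>2) * y (k + 2) - P * q * y (k + 1)
          - q * (- q * y (k + 2) + (1 + P * q\<^sup>2) * y (k + 1) - P * q * y k))"
        by (simp add: field_simps)
      then show ?thesis by (simp add: field_simps power2_eq_square)
    qed
    moreover have "inverse q \<noteq> P * q" "inverse q \<noteq> q" "P * q \<noteq> q"
      using P_ne q_ne by (auto simp: field_simps power2_eq_square)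
    ultimately show ?thesis
      using geometric3[of "inverse q" "P * q" q y] P_ne True by simp
  next
    case False
    have "y (k + 2) = (inverse q + P * q) * y (k + 1) - inverse q * (P * q) * y k" for k
      using u_zero[OF False, of k] unfolding u_def by (simp add: field_simps power2_eq_square)
    moreover have "inverse q \<noteq> P * q"
      using P_ne by (auto simp: field_simps power2_eq_square)
    ultimately have "\<exists>A B. \<forall>k. y k = A * inverse q powi k + B * (P * q) powi k"
      using geometric2[of "inverse q" "P * q" y] P_ne by simp
    then obtain A B where "\<forall>k. y k = A * inverse q powi k + B * (P * q) powi k" by blast
    then show ?thesis by (intro exI[of _ A] exI[of _ B] exI[of _ 0]) simp
  qed
  then obtain A B C where y: "\<And>k. y k = A * inverse q powi k + B * (P * q) powi k + C * q powi k"
    and C: "m \<noteq> 3 \<Longrightarrow> C = 0" by blast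
  define n where "n = q powi N"
  have A: "A = - n * B"
  proof -
    define r where "r = inverse q"
    have r: "q * r = 1" by (simp add: r_def)
    have v: "n * r ^ 5 = q powi (N - 2 * 0 - 5)"
      by (simp add: n_def r_def powi_diff field_simps)
    have z: "1 = q powi ((m - 1) * 0)" by simp
    have y0: "y 0 = A + B + C" "y 1 = A * r + B * (P * q) + C * q"
      "y 2 = A * r\<^sup>2 + B * (P * q)\<^sup>2 + C * q\<^sup>2" "y 3 = A * r ^ 3 + B * (P * q) ^ 3 + C * q ^ 3"
      unfolding y r_def by simp_all
    have rq: "r * (q * t) = t" "q * (r * t) = t" for t
      using r by (simp_all add: mult.assoc[symmetric] mult.commute[of r])
    have C': "C * (q ^ 4 - q * P ^ 3 - s * (P * q\<^sup>2 - P\<^sup>2 * q)) = 0"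
      using C P3 by (cases "m = 3") (simp_all add: s_def algebra_simps power_numeral_reduce)
    \<comment> \<open>Insert the general solution into the first equation at \<open>k = 0\<close>; the \<open>C\<close> term solves it.\<close>
    have "(1 - P) * (1 - P * q) * (1 - P * q\<^sup>2) * (A + n * B) =
        q\<^sup>2 * ((- q * ((n * r ^ 5 * q\<^sup>2 - 1) * y (0 + 3) - (n * r ^ 5 * q\<^sup>2 - 1 * P ^ 3) * y 0)
        + s * ((n * r ^ 5 * q\<^sup>2 - 1 * P) * y (0 + 2) - (n * r ^ 5 * q\<^sup>2 - 1 * P\<^sup>2) * y (0 + 1)))
        - C * (q ^ 4 - q * P ^ 3 - s * (P * q\<^sup>2 - P\<^sup>2 * q)))"
      unfolding s_def by (simp add: y0 algebra_simps power_numeral_reduce r rq)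
    also have "\<dots> = 0"
      unfolding R3[OF v z] C' by simp
    finally have "(1 - P) * (1 - P * q) * (1 - P * q\<^sup>2) * (A + n * B) = 0" .
    then show ?thesis using P_ne by (simp add: add_eq_0_iff)
  qed
  have y': "y k = (q powi (N - k) - q powi (m * k)) * (- B) + C * q powi k" for k
  proof -
    have "(P * q) powi k = q powi (m * k)" by (simp only: Pq[symmetric] power_int_mult)
    then show ?thesis
      unfolding y A n_def powi_diff power_int_inverse by (simp add: algebra_simps divide_inverse)
  qed
  have "C = 0"
  proof (cases "m = 3")
    case True
    \<comment> \<open>\<open>jac\<close> determines \<open>\<Psi>\<close>; the contribution of \<open>C\<close> is symmetric under \<open>d \<mapsto> N - d\<close>.\<close>
    have \<Psi>: "\<Psi> d = (q powi (2 * (N - d)) - q powi (2 * d)) * (- B) - C * (q powi (N - d) + q powi d)" for d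
    proof -
      have "\<exists>b. d \<noteq> 2 * b" by presburger
      then obtain b where b: "d \<noteq> 2 * b" ..
      define a where "a = d - b"
      have ab: "d = a + b" "q powi b - q powi a \<noteq> 0" using b by (simp_all add: a_def powi_inj)
      define X Y where "X = q powi a" and "Y = q powi b"
      define c where "c = q powi (N - a - b)"
      have "(c - Y\<^sup>2) * y a - (c - X\<^sup>2) * y b = (Y - X) * \<Psi> d"
      proof -
        have "q powi ((3 - 1) * b) = Y\<^sup>2" "q powi ((3 - 1) * a) = X\<^sup>2"
          unfolding X_def Y_def power2_eq_square powi_add[symmetric] by simp_all
        then show ?thesis
          using jac[of a b] unfolding True ab(1) c_def[symmetric] X_def[symmetric] Y_def[symmetric]
          by (simp only:)
      qed
      moreover have "y a = (c * Y - X ^ 3) * (- B) + C * X" "y b = (c * X - Y ^ 3) * (- B) + C * Y"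
      proof -
        have "q powi (3 * a) = X ^ 3" "q powi (3 * b) = Y ^ 3"
          unfolding X_def Y_def power3_eq_cube powi_add[symmetric] by simp_all
        moreover have "q powi (N - a) = c * Y" "q powi (N - b) = c * X"
          unfolding c_def X_def Y_def powi_add[symmetric] by simp_all
        ultimately show "y a = (c * Y - X ^ 3) * (- B) + C * X" "y b = (c * X - Y ^ 3) * (- B) + C * Y"
          unfolding y' True X_def[symmetric] Y_def[symmetric] by (simp_all only:)
      qed
      ultimately have "(Y - X) * \<Psi> d = (c - Y\<^sup>2) * ((c * Y - X ^ 3) * (- B) + C * X)
          - (c - X\<^sup>2) * ((c * X - Y ^ 3) * (- B) + C * Y)"
        by (simp only:)
      then have "(Y - X) * (\<Psi> d - ((c\<^sup>2 - (X * Y)\<^sup>2) * (- B) - C * (c + X * Y))) = 0"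
        by (simp add: algebra_simps power_numeral_reduce)
      then have "\<Psi> d = (c\<^sup>2 - (X * Y)\<^sup>2) * (- B) - C * (c + X * Y)"
        using ab(2) by (simp add: X_def Y_def)
      moreover have "q powi (2 * (N - d)) = c\<^sup>2" "q powi (2 * d) = (X * Y)\<^sup>2" "q powi (N - d) = c" "q powi d = X * Y"
          unfolding ab(1) c_def X_def Y_def power2_eq_square powi_add[symmetric] by (simp_all add: algebra_simps)
      ultimately show ?thesis by (simp only:)
    qed
    have "2 * (C * (q powi (N - d) + q powi d)) = 0" for d
    proof -
      have "2 * (C * (q powi (N - d) + q powi d)) = - (\<Psi> (N - d) + \<Psi> d)"
        unfolding \<Psi> by (simp add: algebra_simps)
      then show ?thesis using anti[OF True, of d] by simp
    qed
    then have "C * (q powi (N - d) + q powi d) = 0" for d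
      by (metis mult_eq_0_iff zero_neq_numeral)
    from this[of 0] this[of 1] have "C * (n + 1) = 0" "C * (n / q + q) = 0"
      by (simp_all add: n_def powi_diff)
    moreover have "C * (q\<^sup>2 - 1) = q * (C * (n / q + q)) - C * (n + 1)"
      by (simp add: algebra_simps power2_eq_square)
    ultimately have "C * (q\<^sup>2 - 1) = 0" by (simp only: mult_zero_right diff_zero)
    then show ?thesis using q1 by simp
  qed (use C in simp)
  then show thesis using y' by (intro that[of "- B"]) simp
qed

end

section \<open>The bracket rule\<close>

text \<open>
  The structure constants: the coefficient of \<open>Z\<^bsup>a+b\<^esup> D\<^bsup>j+k\<^esup>\<close> in the commutator of \<open>Z\<^sup>a D\<^sup>j\<close> and
  \<open>Z\<^sup>b D\<^sup>k\<close>.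
\<close>

definition weight :: "complex \<Rightarrow> int \<Rightarrow> int \<Rightarrow> int \<Rightarrow> int \<Rightarrow> complex" where
  "weight q a j b k = q powi (j * b) - q powi (k * a)"

text \<open>
  The cocycle in the basis that makes it homogeneous.
\<close>

definition central_term :: "complex \<Rightarrow> int \<Rightarrow> int \<Rightarrow> int \<Rightarrow> int \<Rightarrow> complex" where
  "central_term q a j b k = (if a + b = 0 \<and> j + k = 0 then of_int j * q powi (- (a * j)) else 0)"

locale graded_family = not_root_of_unity q + free_ideal X I
  for q :: complex and X :: "'x set" and I :: "'x free_alg set" +
  fixes E :: "int \<Rightarrow> int \<Rightarrow> 'x free_alg" and c :: "'x free_alg"
  assumes E_in: "E a j \<in> subalg X"
    and E_0: "E 0 0 = 0"
    and c_in: "c \<in> subalg X"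
    and c_central: "commutator c (E a j) \<in> I"
begin

definition obeys :: "int \<Rightarrow> int \<Rightarrow> int \<Rightarrow> int \<Rightarrow> bool" where
  "obeys a j b k \<longleftrightarrow> commutator (E a j) (E b k)
     - (scalar (weight q a j b k) * E (a + b) (j + k) + scalar (central_term q a j b k) * c) \<in> I"

lemma obeys_iff: "obeys a j b k \<longleftrightarrow> (\<forall>u \<in> ann. lin u (commutator (E a j) (E b k))
    = weight q a j b k * lin u (E (a + b) (j + k)) + central_term q a j b k * lin u c)"
  by (simp add: obeys_def mem_iff lin_simps)

lemma obeysD: "obeys a j b k \<Longrightarrow> u \<in> ann \<Longrightarrow> lin u (commutator (E a j) (E b k))
    = weight q a j b k * lin u (E (a + b) (j + k)) + central_term q a j b k * lin u c"
  by (simp add: obeys_iff)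

lemma obeys_swap:
  assumes "obeys a j b k"
  shows "obeys b k a j"
proof -
  have "weight q b k a j = - weight q a j b k"
    by (simp add: weight_def)
  moreover have "central_term q b k a j = - central_term q a j b k"
    by (auto simp: central_term_def add_eq_0_iff2)
  ultimately show ?thesis
    using assms unfolding obeys_iff commutator_swap[of "E b k"]
    by (simp add: lin_simps add.commute[of b] add.commute[of k])
qed

text \<open>
  The central term disappears in a double commutator.
\<close>

lemma obeys_nested:
  assumes "obeys a j b k" "u \<in> ann"
  shows "lin u (commutator (commutator (E a j) (E b k)) (E d l))
    = weight q a j b k * lin u (commutator (E (a + b) (j + k)) (E d l))"
proof -
  have "commutator (commutator (E a j) (E b k) - (scalar (weight q a j b k) * E (a + b) (j + k)
      + scalar (central_term q a j b k) * c)) (E d l) \<in> I"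
    using assms(1) unfolding obeys_def by (rule commutator_left) (rule E_in)
  from annD[OF assms(2) this] annD[OF assms(2) c_central[of d l]]
  show ?thesis by (simp add: commutator_linear lin_simps)
qed

text \<open>
  Expand \<open>[[x, y], z]\<close> by the Jacobi identity: every bracket on the right is known, and the structure
  constants satisfy the Jacobi identity themselves. The weight of \<open>x\<close> and \<open>y\<close> must not vanish,
  because \<open>[x, y]\<close> has to determine the element of the sum of the two degrees.
\<close>

lemma obeys_sum:
  assumes ne: "weight q a j b k \<noteq> 0"
    and xy: "obeys a j b k" and yz: "obeys b k d l" and xz: "obeys a j d l"
    and x_yz: "obeys a j (b + d) (k + l)" and y_xz: "obeys b k (a + d) (j + l)"
  shows "obeys (a + b) (j + k) d l"
  unfolding obeys_iff
proof
  fix u assume u: "u \<in> ann"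
  let ?s = "lin u (E (a + b + d) (j + k + l))"
  have "weight q a j b k * lin u (commutator (E (a + b) (j + k)) (E d l)) =
      lin u (commutator (commutator (E a j) (E b k)) (E d l))"
    by (rule obeys_nested[OF xy u, symmetric])
  also have "\<dots> = lin u (commutator (commutator (E a j) (E d l)) (E b k))
      - lin u (commutator (commutator (E b k) (E d l)) (E a j))"
    unfolding Jacobi[of "E a j" "E b k", symmetric] lin_add by (rule add_diff_cancel_right'[symmetric])
  also have "\<dots> = weight q a j d l * lin u (commutator (E (a + d) (j + l)) (E b k))
      - weight q b k d l * lin u (commutator (E (b + d) (k + l)) (E a j))"
    by (simp only: obeys_nested[OF xz u] obeys_nested[OF yz u])
  also have "\<dots> = (weight q a j d l * weight q (a + d) (j + l) b k
        - weight q b k d l * weight q (b + d) (k + l) a j) * ?s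
      + (weight q a j d l * central_term q (a + d) (j + l) b k
        - weight q b k d l * central_term q (b + d) (k + l) a j) * lin u c"
    using obeysD[OF obeys_swap[OF x_yz] u] obeysD[OF obeys_swap[OF y_xz] u]
    by (simp add: algebra_simps)
  also have "weight q a j d l * weight q (a + d) (j + l) b k
        - weight q b k d l * weight q (b + d) (k + l) a j
      = weight q a j b k * weight q (a + b) (j + k) d l"
    by (simp add: weight_def algebra_simps powi_add)
  also have "weight q a j d l * central_term q (a + d) (j + l) b k
        - weight q b k d l * central_term q (b + d) (k + l) a j
      = weight q a j b k * central_term q (a + b) (j + k) d l"
  proof (cases "a + b + d = 0 \<and> j + k + l = 0")
    case True
    then have dl: "d = - a - b" "l = - j - k" by auto
    show ?thesis
      unfolding dl weight_def central_term_def
      by (simp add: algebra_simps powi_add powi_diff power_int_minus field_simps)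
  next
    case False
    then show ?thesis by (auto simp: central_term_def)
  qed
  finally have "weight q a j b k * lin u (commutator (E (a + b) (j + k)) (E d l)) =
      weight q a j b k * (weight q (a + b) (j + k) d l * ?s
        + central_term q (a + b) (j + k) d l * lin u c)"
    by (simp add: algebra_simps)
  then show "lin u (commutator (E (a + b) (j + k)) (E d l)) =
      weight q (a + b) (j + k) d l * ?s + central_term q (a + b) (j + k) d l * lin u c"
    using ne by simp
qed

text \<open>
  Elements of degree \<open>j + 1\<close> in \<open>D\<close> (or in its inverse, for \<open>s = - 1\<close>) can be produced by a bracket
  with a generator.
\<close>

lemma exists_splitting:
  fixes j :: int
  assumes "j \<ge> 1" "\<bar>s\<bar> = 1"
  obtains a b where "N = a + b" "weight q a s b (s * j) \<noteq> 0"
proof -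
  define a where "a = (if N = 0 then 1 else 0 :: int)"
  have "s * (N - a) \<noteq> s * j * a"
    using assms by (auto simp: a_def)
  then have "weight q a s (N - a) (s * j) \<noteq> 0"
    by (simp add: weight_def powi_inj)
  then show thesis by (intro that[of a "N - a"]) simp_all
qed

end

section \<open>The subalgebra generated by one current\<close>

text \<open>
  \<open>tower q e n N\<close> plays the role of \<open>Z\<^sup>N D\<^bsup>n+1\<^esup>\<close>. It is obtained from a bracket
  \<open>[e\<^sub>a, E\<^bsub>N-a,n+1\<^esub>]\<close> in which \<open>a\<close> is chosen such that the expected coefficient
  \<open>q\<^bsup>N-a\<^esup> - q\<^bsup>(n+1)a\<^esup>\<close> does not vanish: \<open>a = 0\<close> does, unless \<open>N = 0\<close>.
\<close>

primrec tower :: "complex \<Rightarrow> (int \<Rightarrow> 'x free_alg) \<Rightarrow> nat \<Rightarrow> int \<Rightarrow> 'x free_alg" where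
  "tower q e 0 = e"
| "tower q e (Suc n) = (\<lambda>N. let a = if N = 0 then 1 else 0 in
     scalar (inverse (q powi (N - a) - q powi (int (Suc n) * a)))
       * commutator (e a) (tower q e n (N - a)))"

lemma subst_tower: "subst \<sigma> (tower q e n N) = tower q (\<lambda>a. subst \<sigma> (e a)) n N"
  by (induction n arbitrary: N) (simp_all add: subst_simps Let_def)

text \<open>
  The coefficients of \<open>(z - w) (z - q w) (z - w/q) [e(z), e(w)]\<close>. Since the polynomial is
  antisymmetric, both quadratic relations of the toroidal algebra have this form up to sign.
\<close>

definition quad :: "complex \<Rightarrow> (int \<Rightarrow> 'x free_alg) \<Rightarrow> int \<Rightarrow> int \<Rightarrow> 'x free_alg" where
  "quad q e i j = commutator (e (i + 3)) (e j) - scalar (1 + q + inverse q) * commutator (e (i + 2)) (e (j + 1))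
     + scalar (1 + q + inverse q) * commutator (e (i + 1)) (e (j + 2)) - commutator (e i) (e (j + 3))"

lemma quad_eq:
  assumes "q \<noteq> 0"
  shows "times_zw q (\<lambda>k l. e k * e l) i j + times_wz q (\<lambda>k l. e l * e k) i j = quad q e i j"
    and "times_wz q (\<lambda>k l. e k * e l) i j + times_zw q (\<lambda>k l. e l * e k) i j = - quad q e i j"
proof -
  have qq: "q * (inverse q * t) = t" for t using assms by simp
  show "times_zw q (\<lambda>k l. e k * e l) i j + times_wz q (\<lambda>k l. e l * e k) i j = quad q e i j"
    "times_wz q (\<lambda>k l. e k * e l) i j + times_zw q (\<lambda>k l. e l * e k) i j = - quad q e i j"
    by (auto intro!: free_alg_eqI simp: qq quad_def times_zw_def times_wz_def times_linear_def
        commutator_def lin_simps algebra_simps)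
qed

locale current = not_root_of_unity q + free_ideal X I
  for q :: complex and X :: "'x set" and I :: "'x free_alg set" +
  fixes e :: "int \<Rightarrow> 'x free_alg"
  assumes e_in: "e a \<in> subalg X"
    and quad: "quad q e i j \<in> I"
    and serre: "sym3 (\<lambda>k1 k2 k3. commutator (e k1) (commutator (e (k2 + 1)) (e (k3 - 1)))) i1 i2 i3 \<in> I"
begin

lemma tower_in: "tower q e n a \<in> subalg X"
  by (induction n arbitrary: a) (simp_all add: e_in Let_def subalg_closed)

lemma commutator_tower:
  assumes "x \<in> subalg X" "\<And>a. commutator x (e a) \<in> I"
  shows "commutator x (tower q e n a) \<in> I"
proof (induction n arbitrary: a)
  case (Suc n)
  have "commutator x (commutator (e b) (tower q e n d)) =
      commutator (commutator x (e b)) (tower q e n d) + commutator (e b) (commutator x (tower q e n d))" for b d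
    by (simp add: commutator_def algebra_simps)
  then have "commutator x (commutator (e b) (tower q e n d)) \<in> I" for b d
    by (simp add: add commutator_left[OF assms(2) tower_in] commutator_right[OF Suc e_in])
  then show ?case by (simp add: Let_def commutator_linear smult)
qed (simp add: assms)

lemma tower_bracket_from_solution:
  assumes "\<And>u N. u \<in> ann \<Longrightarrow> \<exists>Y. \<forall>a. lin u (commutator (e a) (tower q e n (N - a)))
    = (q powi (N - a) - q powi (int (Suc n) * a)) * Y"
    and u: "u \<in> ann"
  shows "lin u (commutator (e a) (tower q e n b))
    = (q powi b - q powi (int (Suc n) * a)) * lin u (tower q e (Suc n) (a + b))"
proof -
  define N where "N = a + b"
  obtain Y where Y: "\<And>a. lin u (commutator (e a) (tower q e n (N - a)))
    = (q powi (N - a) - q powi (int (Suc n) * a)) * Y"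
    using assms(1)[OF u, of N] by blast
  define a0 where "a0 = (if N = 0 then 1 else 0 :: int)"
  have "N - a0 \<noteq> int (Suc n) * a0" by (simp add: a0_def)
  then have "q powi (N - a0) - q powi (int (Suc n) * a0) \<noteq> 0" by (simp only: powi_inj right_minus_eq not_False_eq_True)
  then have "lin u (tower q e (Suc n) N) = Y"
    by (simp add: a0_def[symmetric] lin_simps Y del: of_nat_Suc)
  then show ?thesis using Y[of a] by (simp add: N_def del: of_nat_Suc)
qed

text \<open>
  Commutation with a fixed element preserves a proportionality modulo the ideal.
\<close>

lemma lin_commutator_right_cong:
  assumes u: "u \<in> ann" and x: "x \<in> subalg X"
    and eq: "\<And>u. u \<in> ann \<Longrightarrow> lin u y = \<kappa> * lin u z"
  shows "lin u (commutator x y) = \<kappa> * lin u (commutator x z)"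
proof -
  have "y - scalar \<kappa> * z \<in> I"
    by (rule separation) (simp add: lin_simps eq)
  from annD[OF u commutator_right[OF this x]] show ?thesis
    by (simp add: commutator_linear lin_simps)
qed

text \<open>
  The core of the argument: the current \<open>e\<close> generates no more than one element in each bidegree. The
  three cases of the induction correspond to the three lemmas on recurrences.
\<close>

lemma tower_bracket:
  assumes "u \<in> ann"
  shows "lin u (commutator (e a) (tower q e n b))
    = (q powi b - q powi (int (Suc n) * a)) * lin u (tower q e (Suc n) (a + b))"
  using assms
proof (induction n arbitrary: u a b rule: less_induct)
  case (less n)
  have "\<exists>Y. \<forall>a. lin u (commutator (e a) (tower q e n (N - a)))
    = (q powi (N - a) - q powi (int (Suc n) * a)) * Y" if u: "u \<in> ann" for u N
  proof -
    define y where "y a = lin u (commutator (e a) (tower q e n (N - a)))" for a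
    have IH: "lin u (commutator (e d) (commutator (e a) (tower q e k b)))
        = (q powi b - q powi (int (Suc k) * a)) * lin u (commutator (e d) (tower q e (Suc k) (a + b)))"
      if "k < n" for d a b k
      by (rule lin_commutator_right_cong[OF u e_in]) (rule less.IH[OF that])
    consider "n = 0" | "n = 1" | "n \<ge> 2" by linarith
    then show ?thesis
    proof cases
      case 1
      have anti: "y (N - k) = - y k" for k
        unfolding y_def 1 by (subst commutator_swap) (simp add: lin_simps)
      have rec: "y (k + 3) - (1 + q + inverse q) * y (k + 2)
          + (1 + q + inverse q) * y (k + 1) - y k = 0" for k
        using annD[OF u quad[of k "N - k - 3"]]
        by (simp add: y_def 1 quad_def lin_simps algebra_simps)
      obtain Y where "\<And>k. y k = (q powi (N - k) - q powi k) * Y"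
        using quadratic_relation_solution[OF anti rec] by blast
      then show ?thesis unfolding y_def 1 by (intro exI[of _ Y]) simp
    next
      case 2
      have ee: "lin u (commutator (e a) (commutator (e b) (e c))) = (q powi c - q powi b) * y a"
        if "a + b + c = N" for a b c
      proof -
        have "N - a = b + c" using that by simp
        then show ?thesis using IH[of 0 a b c] 2 by (simp add: y_def)
      qed
      have jac: "(q powi c - q powi b) * y a + (q powi a - q powi c) * y b + (q powi b - q powi a) * y c = 0"
        if "a + b + c = N" for a b c
      proof -
        have "commutator (e a) (commutator (e b) (e c)) + commutator (e b) (commutator (e c) (e a))
            + commutator (e c) (commutator (e a) (e b)) = 0"
          by (simp add: commutator_def algebra_simps)
        from arg_cong[OF this, of "lin u"] show ?thesis
          using that ee[of a b c] ee[of b c a] ee[of c a b] by (simp add: lin_simps ac_simps)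
      qed
      have ser: "(q powi c + q powi b) * y a + (q powi a + q powi c) * y b + (q powi b + q powi a) * y c = 0"
        if N: "a + b + c = N" for a b c
      proof -
        have ee': "lin u (commutator (e a) (commutator (e (b + 1)) (e (c - 1)))) = (q powi c / q - q * q powi b) * y a"
          if "a + b + c = N" for a b c
          using that ee[of a "b + 1" "c - 1"] by (simp add: powi_add powi_diff mult.commute)
        have "(inverse q - q) * ((q powi c + q powi b) * y a + (q powi a + q powi c) * y b + (q powi b + q powi a) * y c) = 0"
        proof -
          have "b + a + c = N" "a + c + b = N" "b + c + a = N" "c + a + b = N" "c + b + a = N"
            using N by simp_all
          note perms = this[THEN ee'] ee'[OF N]
          show ?thesis
            using annD[OF u serre[of a b c]] unfolding sym3_def lin_add perms
            by (simp add: algebra_simps divide_inverse)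
        qed
        moreover have "inverse q - q \<noteq> 0"
          using q_ne by (auto simp: field_simps)
        ultimately show ?thesis by simp
      qed
      obtain Y where "\<And>a. y a = (q powi (N - a) - q powi (2 * a)) * Y"
        using cubic_relation_solution[OF jac ser] by blast
      then show ?thesis unfolding y_def 2 by (intro exI[of _ Y]) simp
    next
      case 3
      define \<Psi> where "\<Psi> d = lin u (commutator (tower q e 1 d) (tower q e (n - 1) (N - d)))" for d
      have m: "int (Suc n) \<ge> 3" using 3 by simp
      have n: "Suc (n - 1) = n" "n - 1 < n" "0 < n" using 3 by simp_all
      have jac: "(q powi (N - a - b) - q powi ((int (Suc n) - 1) * b)) * y a
          - (q powi (N - a - b) - q powi ((int (Suc n) - 1) * a)) * y b = (q powi b - q powi a) * \<Psi> (a + b)" for a b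
      proof -
        define x where "x = tower q e (n - 1) (N - a - b)"
        have x_in: "x \<in> subalg X" by (simp add: x_def tower_in)
        have A: "lin u (commutator (e a) (commutator (e b) x)) = (q powi (N - a - b) - q powi (int n * b)) * y a"
          "lin u (commutator (e b) (commutator (e a) x)) = (q powi (N - a - b) - q powi (int n * a)) * y b"
          using IH[OF n(2), of a b "N - a - b"] IH[OF n(2), of b a "N - a - b"]
          unfolding n(1) x_def y_def by (simp_all add: algebra_simps)
        have "lin u (commutator x (commutator (e a) (e b))) = (q powi b - q powi a) * lin u (commutator x (tower q e 1 (a + b)))"
          by (rule lin_commutator_right_cong[OF u x_in]) (use less.IH[OF n(3)] in simp)
        then have B: "lin u (commutator (commutator (e a) (e b)) x) = (q powi b - q powi a) * \<Psi> (a + b)"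
          unfolding \<Psi>_def by (subst (1 2) commutator_swap) (simp add: lin_simps x_def diff_diff_eq)
        have "commutator (commutator (e a) (e b)) x = commutator (e a) (commutator (e b) x) - commutator (e b) (commutator (e a) x)"
          by (simp add: commutator_def algebra_simps)
        from arg_cong[OF this, of "lin u"] show ?thesis
          by (simp add: lin_diff A B)
      qed
      have anti: "\<Psi> (N - d) = - \<Psi> d" if "int (Suc n) = 3" for d
      proof -
        have "n - 1 = 1" using that by simp
        then show ?thesis unfolding \<Psi>_def by (subst commutator_swap) (simp add: lin_simps)
      qed
      obtain Y where "\<And>a. y a = (q powi (N - a) - q powi (int (Suc n) * a)) * Y"
        using higher_degree_solution[OF m jac anti] by blast
      then show ?thesis unfolding y_def by blast
    qed
  qed
  from tower_bracket_from_solution[OF this less.prems] show ?case .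
qed

end

section \<open>The bracket rule in the toroidal algebra\<close>

text \<open>
  The candidates for the elements \<open>E\<^bsub>a,j\<^esub>\<close>. The anti-automorphism \<open>Z \<mapsto> Z, D \<mapsto> D\<^sup>-\<^sup>1\<close> of the torus,
  composed with the sign, identifies the negative half with the positive one. It sends \<open>Z\<^sup>a D\<^sup>j\<close> to
  \<open>- q\<^bsup>-ja\<^esup> Z\<^sup>a D\<^bsup>-j\<^esup>\<close>; this is the origin of the factor in the second case.
\<close>

definition toroidal_family ::
    "complex \<Rightarrow> (int \<Rightarrow> 'x free_alg) \<Rightarrow> (int \<Rightarrow> 'x free_alg) \<Rightarrow> (int \<Rightarrow> 'x free_alg) \<Rightarrow> int \<Rightarrow> int \<Rightarrow> 'x free_alg"
  where "toroidal_family q e f H a j =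
    (if j > 0 then tower q e (nat j - 1) a
     else if j < 0 then scalar (- (q powi (- (j * a)))) * tower q f (nat (- j) - 1) a
     else if a = 0 then 0
     else scalar (- inverse (1 - q powi (- a))) * H a)"

lemma subst_toroidal_family:
  "subst \<sigma> (toroidal_family q e f H a j) =
     toroidal_family q (\<lambda>i. subst \<sigma> (e i)) (\<lambda>i. subst \<sigma> (f i)) (\<lambda>i. subst \<sigma> (H i)) a j"
  by (simp add: toroidal_family_def subst_simps subst_tower)

locale toroidal = e: current q X I e + f: current q X I f
  for q :: complex and X :: "'x set" and I :: "'x free_alg set" and e f :: "int \<Rightarrow> 'x free_alg" +
  fixes H :: "int \<Rightarrow> 'x free_alg"
  assumes H_in: "H a \<in> subalg X"
    and HH: "commutator (H a) (H b) \<in> I"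
    and ef: "commutator (e a) (f b) - H (a + b) \<in> I"
    and He: "commutator (H a) (e b) + scalar ((1 - q powi a) * (1 - q powi (- a))) * e (a + b) \<in> I"
    and Hf: "commutator (H a) (f b) - scalar ((1 - q powi a) * (1 - q powi (- a))) * f (a + b) \<in> I"
begin

abbreviation "E \<equiv> toroidal_family q e f H"

lemma one_minus_powi: "a \<noteq> 0 \<Longrightarrow> 1 - q powi a \<noteq> 0"
  using e.powi_eq_1[of a] by auto

sublocale graded_family q X I E "- H 0"
proof
  fix a j
  show "E a j \<in> subalg X"
    by (simp add: toroidal_family_def e.tower_in f.tower_in H_in subalg_closed)
  have H0: "commutator (- H 0) (e b) \<in> I" "commutator (- H 0) (f b) \<in> I" "commutator (- H 0) (H b) \<in> I" for b
    using e.uminus[OF He[of 0 b]] e.uminus[OF Hf[of 0 b]] e.uminus[OF HH[of 0 b]]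
    by (simp_all add: commutator_linear)
  have "- H 0 \<in> subalg X" by (simp add: H_in subalg_closed)
  then show "commutator (- H 0) (E a j) \<in> I"
    using e.commutator_tower[OF _ H0(1)] f.commutator_tower[OF _ H0(2)] H0(3)
    by (simp add: toroidal_family_def commutator_linear(8,10) e.smult e.zero)
qed (simp_all add: toroidal_family_def H_in subalg_closed)

lemma E_simps: "E a 1 = e a" "E a (- 1) = scalar (- (q powi a)) * f a"
  by (simp_all add: toroidal_family_def)

lemma obeys_pos1:
  assumes "m \<ge> 1"
  shows "obeys a 1 b m"
proof -
  define n where "n = nat m - 1"
  have n: "m = int (Suc n)" using assms by (simp add: n_def)
  have "E b m = tower q e n b" "E (a + b) (1 + m) = tower q e (Suc n) (a + b)"
    by (simp_all add: toroidal_family_def n nat_add_distrib del: tower.simps)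
  then show ?thesis
    using n unfolding obeys_iff
    by (simp add: E_simps e.tower_bracket weight_def central_term_def del: tower.simps)
qed

lemma obeys_neg1:
  assumes "m \<ge> 1"
  shows "obeys a (- 1) b (- m)"
proof -
  define n where "n = nat m - 1"
  have n: "m = int (Suc n)" using assms by (simp add: n_def)
  have E: "E b (- m) = scalar (- (q powi (m * b))) * tower q f n b"
    "E (a + b) (- 1 + - m) = scalar (- (q powi ((m + 1) * (a + b)))) * tower q f (Suc n) (a + b)"
    by (simp_all add: toroidal_family_def n nat_add_distrib algebra_simps del: tower.simps)
  have "q powi a * q powi (m * b) * (q powi b - q powi (m * a))
      = - (weight q a (- 1) b (- m) * q powi ((m + 1) * (a + b)))"
    unfolding weight_def by (simp add: algebra_simps flip: e.powi_add)
  moreover have "lin u (commutator (E a (- 1)) (E b (- m))) =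
      (q powi a * q powi (m * b) * (q powi b - q powi (m * a))) * lin u (tower q f (Suc n) (a + b))"
    if "u \<in> e.ann" for u
    using f.tower_bracket[OF that, of a n b] unfolding E E_simps n[symmetric]
    by (simp add: commutator_linear lin_simps del: tower.simps)
  ultimately have "lin u (commutator (E a (- 1)) (E b (- m))) = weight q a (- 1) b (- m) * lin u (E (a + b) (- 1 + - m))"
    if "u \<in> e.ann" for u
    using that unfolding E by (simp add: lin_simps del: tower.simps)
  then show ?thesis
    using assms unfolding obeys_iff by (simp add: central_term_def)
qed

text \<open>
  Brackets within the positive or within the negative half, by induction on the degree of the first
  argument.
\<close>

lemma obeys_same_sign:
  assumes one: "\<And>a b m. m \<ge> 1 \<Longrightarrow> obeys a s b (s * m)" and s: "\<bar>s\<bar> = 1"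
    and j: "j \<ge> 1" and k: "k \<ge> 1"
  shows "obeys a (s * j) b (s * k)"
  using j k
proof (induction j arbitrary: a b k rule: int_ge_induct)
  case (step j)
  obtain a1 a2 where a: "a = a1 + a2" "weight q a1 s a2 (s * j) \<noteq> 0"
    using exists_splitting[OF step.hyps(1) s] by blast
  have "obeys (a1 + a2) (s + s * j) b (s * k)"
    using a(2)
  proof (rule obeys_sum)
    show "obeys a1 s a2 (s * j)" "obeys a1 s b (s * k)" "obeys a1 s (a2 + b) (s * j + s * k)"
      using one[of j] one[of k] one[of "j + k"] step by (simp_all add: algebra_simps)
    show "obeys a2 (s * j) b (s * k)" "obeys a2 (s * j) (a1 + b) (s + s * k)"
      using step.IH[of k] step.IH[of "k + 1"] step.prems by (simp_all add: algebra_simps)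
  qed
  then show ?case by (simp add: a algebra_simps)
qed (use one in simp)

lemma obeys_zero_e: "obeys a 0 b 1"
proof (cases "a = 0")
  case True
  then show ?thesis by (simp add: obeys_def E_0 weight_def central_term_def commutator_linear e.zero)
next
  case False
  then have "E a 0 = scalar (- inverse (1 - q powi (- a))) * H a"
    by (simp add: toroidal_family_def)
  moreover have "1 - q powi (- a) \<noteq> 0"
    using False one_minus_powi[of "- a"] by simp
  ultimately show ?thesis
    using e.annD[OF _ He[of a b]] unfolding obeys_iff
    by (simp add: E_simps commutator_linear lin_simps weight_def central_term_def field_simps
        add_eq_0_iff2)
qed

lemma obeys_zero_f: "obeys a 0 b (- 1)"
proof (cases "a = 0")
  case True
  then show ?thesis by (simp add: obeys_def E_0 weight_def central_term_def commutator_linear e.zero)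
next
  case False
  then have E: "E a 0 = scalar (- inverse (1 - q powi (- a))) * H a"
    by (simp add: toroidal_family_def)
  have nz: "1 - q powi (- a) \<noteq> 0"
    using False one_minus_powi[of "- a"] by simp
  show ?thesis
    unfolding obeys_iff
  proof
    fix u assume "u \<in> e.ann"
    then have "lin u (commutator (H a) (f b)) = (1 - q powi a) * (1 - q powi (- a)) * lin u (f (a + b))"
      using e.annD[OF _ Hf[of a b]] by (simp add: lin_simps)
    then have "lin u (commutator (E a 0) (E b (- 1))) = q powi b * (1 - q powi a) * lin u (f (a + b))"
      using nz unfolding E E_simps by (simp add: commutator_linear lin_simps)
    also have "\<dots> = weight q a 0 b (- 1) * lin u (E (a + b) (- 1))"
      unfolding E_simps by (simp add: lin_simps weight_def algebra_simps e.powi_add power_int_minus)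
    finally show "lin u (commutator (E a 0) (E b (- 1))) = weight q a 0 b (- 1) * lin u (E (a + b) (0 + - 1))
        + central_term q a 0 b (- 1) * lin u (- H 0)"
      by (simp add: central_term_def)
  qed
qed

lemma obeys_zero_sign:
  assumes one: "\<And>a b m. m \<ge> 1 \<Longrightarrow> obeys a s b (s * m)" and s: "\<bar>s\<bar> = 1"
    and zero: "\<And>a b. obeys a 0 b s" and j: "j \<ge> 1"
  shows "obeys a (s * j) b 0"
  using j
proof (induction j arbitrary: a b rule: int_ge_induct)
  case (step j)
  obtain a1 a2 where a: "a = a1 + a2" "weight q a1 s a2 (s * j) \<noteq> 0"
    using exists_splitting[OF step.hyps(1) s] by blast
  have "obeys (a1 + a2) (s + s * j) b 0"
    using a(2)
  proof (rule obeys_sum)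
    show "obeys a1 s a2 (s * j)" "obeys a1 s (a2 + b) (s * j + 0)"
      using one[of j] step by simp_all
    show "obeys a1 s b 0" by (rule obeys_swap[OF zero])
    show "obeys a2 (s * j) b 0" by (rule step.IH)
    show "obeys a2 (s * j) (a1 + b) (s + 0)"
      by (rule obeys_swap) (use one[of j] step.hyps in simp)
  qed
  then show ?case by (simp add: a algebra_simps)
qed (use obeys_swap[OF zero] in simp)

lemma obeys_zero_zero: "obeys a 0 b 0"
proof -
  have "commutator (E a 0) (E b 0) \<in> I"
    by (simp add: toroidal_family_def commutator_linear e.smult HH e.zero)
  then show ?thesis by (simp add: obeys_def weight_def central_term_def)
qed

lemma obeys_nonneg:
  assumes "j \<ge> 0" "k \<ge> 0"
  shows "obeys a j b k"
proof -
  have one: "\<And>a b m. m \<ge> 1 \<Longrightarrow> obeys a 1 b (1 * m)" using obeys_pos1 by simp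
  show ?thesis
    using obeys_same_sign[OF one, of j k a b] obeys_zero_sign[OF one _ obeys_zero_e, of j a b]
      obeys_swap[OF obeys_zero_sign[OF one _ obeys_zero_e, of k b a]] obeys_zero_zero[of a b] assms
    by (cases "j = 0"; cases "k = 0") simp_all
qed

lemma obeys_nonpos:
  assumes "j \<le> 0" "k \<le> 0"
  shows "obeys a j b k"
proof -
  have one: "\<And>a b m. m \<ge> 1 \<Longrightarrow> obeys a (- 1) b (- 1 * m)" using obeys_neg1 by simp
  show ?thesis
    using obeys_same_sign[OF one, of "- j" "- k" a b] obeys_zero_sign[OF one _ obeys_zero_f, of "- j" a b]
      obeys_swap[OF obeys_zero_sign[OF one _ obeys_zero_f, of "- k" b a]] obeys_zero_zero[of a b] assms
    by (cases "j = 0"; cases "k = 0") simp_all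
qed

lemma obeys_e_f: "obeys a 1 b (- 1)"
proof -
  \<comment> \<open>\<open>H\<^sub>i = - (1 - q\<^bsup>-i\<^esup>) E\<^bsub>i,0\<^esub>\<close> for \<open>i \<noteq> 0\<close>, while \<open>H\<^sub>0 = - c\<close>.\<close>
  have H: "q powi b * lin u (H (a + b)) = - ((q powi b - q powi (- a)) * lin u (E (a + b) 0))
      + (if a + b = 0 then q powi (- a) else 0) * lin u (H 0)" for u
  proof (cases "a + b = 0")
    case True
    then have "b = - a" by simp
    then show ?thesis by (simp add: E_0)
  next
    case False
    then have "E (a + b) 0 = scalar (- inverse (1 - q powi (- (a + b)))) * H (a + b)"
      by (simp add: toroidal_family_def)
    moreover have "1 - q powi (- (a + b)) \<noteq> 0"
      using False one_minus_powi[of "- (a + b)"] by simp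
    moreover have "q powi b - q powi (- a) = q powi b * (1 - q powi (- (a + b)))"
      by (simp add: e.powi_add[symmetric] right_diff_distrib)
    ultimately show ?thesis
      using False by (simp add: lin_simps)
  qed
  show ?thesis
    unfolding obeys_iff
  proof
    fix u assume "u \<in> e.ann"
    then have "lin u (commutator (e a) (f b)) = lin u (H (a + b))"
      using e.annD[OF _ ef[of a b]] by (simp add: lin_simps)
    then have "lin u (commutator (E a 1) (E b (- 1))) = - (q powi b * lin u (H (a + b)))"
      unfolding E_simps by (simp add: commutator_linear lin_simps)
    then show "lin u (commutator (E a 1) (E b (- 1))) = weight q a 1 b (- 1) * lin u (E (a + b) (1 + - 1))
        + central_term q a 1 b (- 1) * lin u (- H 0)"
      unfolding H by (simp add: weight_def central_term_def lin_simps)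
  qed
qed

text \<open>
  An element of positive degree in \<open>D\<close> is a bracket of lower ones, and commuting with \<open>f\<^sub>b\<close> lowers the
  degree by one, so that only brackets of nonnegative degrees remain.
\<close>

lemma obeys_pos_f:
  assumes "j \<ge> 1"
  shows "obeys a j b (- 1)"
  using assms
proof (induction j arbitrary: a b rule: int_ge_induct)
  case (step j)
  obtain a1 a2 where a: "a = a1 + a2" "weight q a1 1 a2 (1 * j) \<noteq> 0"
    using exists_splitting[OF step.hyps(1), of 1] by auto
  have "obeys (a1 + a2) (1 + 1 * j) b (- 1)"
    using a(2)
    by (rule obeys_sum) (use step in \<open>simp_all add: obeys_nonneg obeys_e_f\<close>)
  then show ?case by (simp add: a add.commute)
qed (rule obeys_e_f)

lemma obeys_neg_pos:
  assumes "k \<ge> 1" "j \<ge> 1"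
  shows "obeys a (- k) b j"
  using assms
proof (induction k arbitrary: a b j rule: int_ge_induct)
  case base
  then show ?case by (rule obeys_swap[OF obeys_pos_f])
next
  case (step k)
  obtain a1 a2 where a: "a = a1 + a2" "weight q a1 (- 1) a2 (- 1 * k) \<noteq> 0"
    using exists_splitting[OF step.hyps(1), of "- 1"] by auto
  have f: "obeys a (- 1) b l" for a b l
    using obeys_swap[OF obeys_pos_f[of l b a]] obeys_nonpos[of "- 1" l] by (cases "l \<ge> 1") simp_all
  have "obeys (a1 + a2) (- 1 + - 1 * k) b j"
    using a(2)
  proof (rule obeys_sum)
    show "obeys a2 (- 1 * k) b j" using step by simp
    show "obeys a2 (- 1 * k) (a1 + b) (- 1 + j)"
      using step.IH[of "j - 1"] obeys_nonpos[of "- k" 0] step.hyps step.prems by (cases "j = 1") simp_all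
  qed (rule f)+
  moreover have "- 1 + - 1 * k = - (k + 1)" by simp
  ultimately show ?case by (simp only: a)
qed

theorem bracket_rule: "obeys a j b k"
  using obeys_nonneg[of j k a b] obeys_nonpos[of j k a b] obeys_neg_pos[of "- j" k a b]
    obeys_swap[OF obeys_neg_pos[of "- k" j b a]]
  by (cases "j \<ge> 1"; cases "k \<ge> 1") (simp_all add: not_le, (cases "j \<ge> 0"; cases "k \<ge> 0"; simp)+)

end

section \<open>The toroidal relations as consequences of the bracket rule\<close>

context free_ideal
begin

lemma lin_cong: "x - y \<in> I \<Longrightarrow> u \<in> ann \<Longrightarrow> lin u x = lin u y"
  using annD[of u "x - y"] by (simp add: lin_simps)

lemma commutator_cong:
  assumes "x - x' \<in> I" "y - y' \<in> I" "x \<in> subalg X" "y' \<in> subalg X"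
  shows "commutator x y - commutator x' y' \<in> I"
proof -
  have "commutator x y - commutator x' y' = commutator x (y - y') + commutator (x - x') y'"
    by (simp add: commutator_linear)
  then show ?thesis
    using add[OF commutator_right[OF assms(2,3)] commutator_left[OF assms(1,4)]] by simp
qed

lemma lin_commutator_cong:
  assumes "u \<in> ann" "x - x' \<in> I" "y - y' \<in> I" "x \<in> subalg X" "y' \<in> subalg X"
  shows "lin u (commutator x y) = lin u (commutator x' y')"
  using lin_cong[OF commutator_cong[OF assms(2-)] assms(1)] .

end

text \<open>
  Elements \<open>G n a\<close> in the role of \<open>Z\<^sup>a D\<^bsup>n+1\<^esup>\<close> for a current \<open>g\<close>. The bracket rule provides two such
  families, for \<open>e\<close> and for \<open>f\<close>, and the quadratic and cubic relations of both currents are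
  consequences of the same brackets.
\<close>

locale tower_family = not_root_of_unity q + free_ideal X I
  for q :: complex and X :: "'x set" and I :: "'x free_alg set" +
  fixes g :: "int \<Rightarrow> 'x free_alg" and G :: "nat \<Rightarrow> int \<Rightarrow> 'x free_alg"
  assumes g_in: "g a \<in> subalg X"
    and G_in: "G n a \<in> subalg X"
    and g_G: "g a - G 0 a \<in> I"
    and G_bracket: "u \<in> ann \<Longrightarrow> lin u (commutator (G 0 a) (G n b))
      = (q powi b - q powi (int (Suc n) * a)) * lin u (G (Suc n) (a + b))"
begin

lemma g_bracket:
  assumes "u \<in> ann" "x - G n b \<in> I"
  shows "lin u (commutator (g a) x) = (q powi b - q powi (int (Suc n) * a)) * lin u (G (Suc n) (a + b))"
  using lin_commutator_cong[OF assms(1) g_G assms(2) g_in G_in] G_bracket[OF assms(1)] by simp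

lemma gg_bracket:
  "u \<in> ann \<Longrightarrow> lin u (commutator (g a) (g b)) = (q powi b - q powi a) * lin u (G 1 (a + b))"
  using g_bracket[OF _ g_G] by simp

lemma tower_eq: "tower q g n b - G n b \<in> I"
proof (induction n arbitrary: b)
  case (Suc n)
  define a where "a = (if b = 0 then 1 else 0 :: int)"
  have "b - a \<noteq> int (Suc n) * a" by (simp add: a_def)
  then have "q powi (b - a) - q powi (int (Suc n) * a) \<noteq> 0"
    by (simp only: powi_inj right_minus_eq not_False_eq_True)
  then have "lin u (tower q g (Suc n) b) = lin u (G (Suc n) b)" if "u \<in> ann" for u
    using g_bracket[OF that Suc, of a "b - a"]
    by (simp add: a_def[symmetric] lin_simps del: of_nat_Suc)
  then show ?case by (simp add: mem_iff lin_simps del: tower.simps)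
qed (simp add: g_G)

lemma quad_relation: "quad q g i j \<in> I"
proof (rule separation)
  fix u assume u: "u \<in> ann"
  have qq: "q * (inverse q * t) = t" for t by simp
  show "lin u (quad q g i j) = 0"
    by (simp add: qq quad_def lin_simps gg_bracket[OF u] powi_add algebra_simps power_numeral_reduce
        del: mult_cancel_left mult_cancel_right)
qed

lemma serre_relation:
  "sym3 (\<lambda>k1 k2 k3. commutator (g k1) (commutator (g (k2 + 1)) (g (k3 - 1)))) i1 i2 i3 \<in> I"
proof (rule separation)
  fix u assume u: "u \<in> ann"
  have nested: "lin u (commutator (g a) (commutator (g (b + 1)) (g (c - 1)))) =
      (q powi c / q - q * q powi b) * (q powi b * q powi c - q powi a * q powi a) * lin u (G 2 (a + b + c))" for a b c
  proof -
    have "commutator (g (b + 1)) (g (c - 1)) - scalar (q powi (c - 1) - q powi (b + 1)) * G 1 (b + c) \<in> I"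
      by (rule separation) (simp add: lin_simps gg_bracket)
    then have "lin u (commutator (g a) (commutator (g (b + 1)) (g (c - 1)))) =
        lin u (commutator (g a) (scalar (q powi (c - 1) - q powi (b + 1)) * G 1 (b + c)))"
      by (intro lin_commutator_cong u g_in G_in subalg_closed) (simp_all add: zero)
    also have "\<dots> = (q powi (c - 1) - q powi (b + 1)) * (q powi (b + c) - q powi (2 * a)) * lin u (G 2 (a + b + c))"
      using g_bracket[OF u, of "G 1 (b + c)" 1 "b + c" a]
      by (simp add: commutator_linear lin_simps zero numeral_2_eq_2 add.assoc)
    finally show ?thesis
      by (simp only: powi_add powi_diff mult_2) (simp add: mult.commute)
  qed
  show "lin u (sym3 (\<lambda>k1 k2 k3. commutator (g k1) (commutator (g (k2 + 1)) (g (k3 - 1)))) i1 i2 i3) = 0"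
    unfolding sym3_def lin_add nested by (simp add: algebra_simps divide_inverse)
qed

end

text \<open>
  The converse situation: a family that obeys the bracket rule, and elements \<open>\<sigma>\<close> for the toroidal
  generators that are congruent to the expected members of the family.
\<close>

locale bracket_family = graded_family q X I E c
  for q :: complex and X :: "'x set" and I :: "'x free_alg set"
    and E :: "int \<Rightarrow> int \<Rightarrow> 'x free_alg" and c :: "'x free_alg" +
  fixes \<sigma> :: "toroidal_letter \<Rightarrow> 'x free_alg"
  assumes bracket: "obeys a j b k"
    and \<sigma>_in: "\<sigma> x \<in> subalg X"
    and \<sigma>_e: "\<sigma> (Le i) - E i 1 \<in> I"
    and \<sigma>_f: "\<sigma> (Lf i) + scalar (q powi (- i)) * E i (- 1) \<in> I"
    and \<sigma>_H: "\<sigma> (LH i) + scalar (1 - q powi (- i)) * E i 0 + scalar (if i = 0 then 1 else 0) * c \<in> I"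
begin

lemma lin_bracket: "u \<in> ann \<Longrightarrow> lin u (commutator (E a j) (E b k))
    = weight q a j b k * lin u (E (a + b) (j + k)) + central_term q a j b k * lin u c"
  using bracket obeysD by blast

sublocale e: tower_family q X I "\<lambda>i. \<sigma> (Le i)" "\<lambda>n b. E b (int n + 1)"
proof
  show "lin u (commutator (E a (int 0 + 1)) (E b (int n + 1))) =
      (q powi b - q powi (int (Suc n) * a)) * lin u (E (a + b) (int (Suc n) + 1))" if "u \<in> ann" for u a n b
    using lin_bracket[OF that, of a 1 b "int n + 1"]
    by (simp add: weight_def central_term_def algebra_simps)
qed (use \<sigma>_e in \<open>simp_all add: \<sigma>_in E_in\<close>)

sublocale f: tower_family q X I "\<lambda>i. \<sigma> (Lf i)"
  "\<lambda>n b. scalar (- (q powi (- (int (Suc n) * b)))) * E b (- int (Suc n))"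
proof
  fix u a n b assume u: "u \<in> ann"
  have k: "- 1 + - int (Suc n) = - int (Suc (Suc n))" "- int (Suc 0) = - 1" "int (Suc 0) * a = a"
    by simp_all
  have comm: "lin u (commutator (scalar (- x) * E a (- 1)) (scalar (- y) * E b (- int (Suc n)))) =
      x * y * weight q a (- 1) b (- int (Suc n)) * lin u (E (a + b) (- 1 + - int (Suc n)))" for x y
    using lin_bracket[OF u, of a "- 1" b "- int (Suc n)"]
    by (simp add: commutator_linear lin_simps central_term_def del: of_nat_Suc)
  have coeff: "q powi (- a) * q powi (- (int (Suc n) * b)) * weight q a (- 1) b (- int (Suc n))
      = - ((q powi b - q powi (int (Suc n) * a)) * q powi (- (int (Suc (Suc n)) * (a + b))))"
  proof -
    have "- a + - (int (Suc n) * b) + - 1 * b = int (Suc n) * a + - (int (Suc (Suc n)) * (a + b))"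
      "- a + - (int (Suc n) * b) + - int (Suc n) * a = b + - (int (Suc (Suc n)) * (a + b))"
      by (simp_all add: algebra_simps)
    then show ?thesis
      unfolding weight_def right_diff_distrib left_diff_distrib powi_add[symmetric] by (simp only: minus_diff_eq)
  qed
  show "lin u (commutator (scalar (- (q powi (- (int (Suc 0) * a)))) * E a (- int (Suc 0)))
      (scalar (- (q powi (- (int (Suc n) * b)))) * E b (- int (Suc n)))) =
    (q powi b - q powi (int (Suc n) * a)) *
      lin u (scalar (- (q powi (- (int (Suc (Suc n)) * (a + b))))) * E (a + b) (- int (Suc (Suc n))))"
    unfolding k comm coeff lin_scalar_mult by simp
qed (use \<sigma>_f in \<open>simp_all add: \<sigma>_in E_in subalg_closed scalar_uminus\<close>)

lemma H_bracket:
  assumes "u \<in> ann"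
  shows "lin u (commutator (\<sigma> (LH i)) (E b k)) =
    - ((1 - q powi (- i)) * (1 - q powi (k * i)) * lin u (E (i + b) k))"
proof -
  have "lin u (commutator (\<sigma> (LH i)) (E b k)) = lin u (commutator
      (- (scalar (1 - q powi (- i)) * E i 0) - scalar (if i = 0 then 1 else 0) * c) (E b k))"
    by (rule lin_commutator_cong[OF assms])
      (use \<sigma>_H[of i] in \<open>simp_all add: \<sigma>_in E_in zero algebra_simps\<close>)
  then show ?thesis
    using lin_bracket[OF assms, of i 0 b k] annD[OF assms c_central]
    by (simp add: commutator_linear lin_simps weight_def central_term_def)
qed

text \<open>
  The family that is built from the generators by iterated brackets is the given one; this makes
  the two homomorphisms inverse to each other.
\<close>

lemma toroidal_family_eq:
  "toroidal_family q (\<lambda>i. \<sigma> (Le i)) (\<lambda>i. \<sigma> (Lf i)) (\<lambda>i. \<sigma> (LH i)) a j - E a j \<in> I"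
proof (rule separation)
  fix u assume u: "u \<in> ann"
  let ?F = "toroidal_family q (\<lambda>i. \<sigma> (Le i)) (\<lambda>i. \<sigma> (Lf i)) (\<lambda>i. \<sigma> (LH i))"
  consider "j > 0" | "j < 0" | "j = 0" "a = 0" | "j = 0" "a \<noteq> 0" by linarith
  then have "lin u (?F a j) = lin u (E a j)"
  proof cases
    case 1
    then have "int (nat j - 1) + 1 = j" by simp
    then show ?thesis
      using lin_cong[OF e.tower_eq[of "nat j - 1" a] u] 1 by (simp add: toroidal_family_def)
  next
    case 2
    then have "int (Suc (nat (- j) - 1)) = - j" by simp
    then show ?thesis
      using lin_cong[OF f.tower_eq[of "nat (- j) - 1" a] u] 2
      by (simp add: toroidal_family_def lin_simps power_int_minus del: of_nat_Suc)
  next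
    case 3
    then show ?thesis by (simp add: toroidal_family_def E_0)
  next
    case 4
    then have "1 - q powi (- a) \<noteq> 0" using powi_eq_1[of "- a"] by auto
    then show ?thesis
      using annD[OF u \<sigma>_H[of a]] 4
      by (simp add: toroidal_family_def lin_simps field_simps eq_neg_iff_add_eq_0)
  qed
  then show "lin u (?F a j - E a j) = 0" by (simp add: lin_simps)
qed

lemma subst_toroidal_relations:
  assumes "r \<in> toroidal_relations q"
  shows "subst \<sigma> r \<in> I"
proof -
  have lin_e: "lin u (\<sigma> (Le i)) = lin u (E i 1)"
    and lin_f: "lin u (\<sigma> (Lf i)) = - (q powi (- i) * lin u (E i (- 1)))"
    and lin_H: "lin u (\<sigma> (LH i)) = - ((1 - q powi (- i)) * lin u (E i 0)) - (if i = 0 then lin u c else 0)"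
    if "u \<in> ann" for u i
  proof -
    show "lin u (\<sigma> (Le i)) = lin u (E i 1)"
      using annD[OF that \<sigma>_e[of i]] by (simp add: lin_simps)
    show "lin u (\<sigma> (Lf i)) = - (q powi (- i) * lin u (E i (- 1)))"
      using annD[OF that \<sigma>_f[of i]] by (simp add: lin_simps eq_neg_iff_add_eq_0)
    show "lin u (\<sigma> (LH i)) = - ((1 - q powi (- i)) * lin u (E i 0)) - (if i = 0 then lin u c else 0)"
      using annD[OF that \<sigma>_H[of i]]
      by (cases "i = 0") (simp_all add: lin_simps eq_neg_iff_add_eq_0)
  qed
  have f_cong: "\<sigma> (Lf i) - scalar (- (q powi (- i))) * E i (- 1) \<in> I" for i
    using \<sigma>_f[of i] by (simp add: scalar_uminus)
  have H_cong: "\<sigma> (LH i) - (scalar (- (1 - q powi (- i))) * E i 0 - scalar (if i = 0 then 1 else 0) * c) \<in> I" for i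
    using \<sigma>_H[of i] by (simp only: scalar_uminus) (simp add: algebra_simps)
  have H_c: "commutator (\<sigma> (LH i)) c \<in> I" for i
  proof (rule separation)
    fix u assume u: "u \<in> ann"
    have "lin u (commutator c (\<sigma> (LH i))) = lin u (commutator c
        (scalar (- (1 - q powi (- i))) * E i 0 - scalar (if i = 0 then 1 else 0) * c))"
      by (rule lin_commutator_cong[OF u]) (simp_all only: H_cong, simp_all add: zero c_in E_in subalg_closed)
    also have "\<dots> = 0"
      using annD[OF u c_central] by (simp add: commutator_linear lin_simps) (simp add: commutator_def)
    finally show "lin u (commutator (\<sigma> (LH i)) c) = 0"
      by (subst commutator_swap) (simp add: lin_simps)
  qed
  have HH: "commutator (\<sigma> (LH i)) (\<sigma> (LH j)) \<in> I" for i j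
  proof (rule separation)
    fix u assume u: "u \<in> ann"
    have "lin u (commutator (\<sigma> (LH i)) (\<sigma> (LH j))) = lin u (commutator (\<sigma> (LH i))
        (scalar (- (1 - q powi (- j))) * E j 0 - scalar (if j = 0 then 1 else 0) * c))"
      by (rule lin_commutator_cong[OF u]) (simp_all only: H_cong, simp_all add: zero c_in E_in \<sigma>_in subalg_closed)
    then show "lin u (commutator (\<sigma> (LH i)) (\<sigma> (LH j))) = 0"
      using annD[OF u H_c] H_bracket[OF u, of i j 0] by (simp add: commutator_linear lin_simps)
  qed
  have ef: "commutator (\<sigma> (Le i)) (\<sigma> (Lf j)) - \<sigma> (LH (i + j)) \<in> I" for i j
  proof (rule separation)
    fix u assume u: "u \<in> ann"
    have "lin u (commutator (\<sigma> (Le i)) (\<sigma> (Lf j))) =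
        lin u (commutator (E i 1) (scalar (- (q powi (- j))) * E j (- 1)))"
      by (rule lin_commutator_cong[OF u \<sigma>_e f_cong]) (simp_all add: \<sigma>_in E_in subalg_closed)
    also have "\<dots> = - (q powi (- j) * (q powi j - q powi (- i)) * lin u (E (i + j) 0)
        + q powi (- j) * central_term q i 1 j (- 1) * lin u c)"
      unfolding commutator_linear lin_simps lin_bracket[OF u] by (simp add: weight_def algebra_simps)
    also have "q powi (- j) * (q powi j - q powi (- i)) = 1 - q powi (- (i + j))"
      unfolding right_diff_distrib powi_add[symmetric] by (simp add: add.commute)
    also have "q powi (- j) * central_term q i 1 j (- 1) = (if i + j = 0 then 1 else 0)"
    proof (cases "i + j = 0")
      case True
      then have "j = - i" by simp
      then show ?thesis by (simp add: central_term_def flip: powi_add)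
    qed (simp add: central_term_def)
    finally show "lin u (commutator (\<sigma> (Le i)) (\<sigma> (Lf j)) - \<sigma> (LH (i + j))) = 0"
      using lin_H[OF u, of "i + j"] by (cases "i + j = 0") (simp_all add: lin_simps)
  qed
  have He: "commutator (\<sigma> (LH i)) (\<sigma> (Le j))
      + scalar ((1 - q powi i) * (1 - q powi (- i))) * \<sigma> (Le (i + j)) \<in> I" for i j
  proof (rule separation)
    fix u assume u: "u \<in> ann"
    have "lin u (commutator (\<sigma> (LH i)) (\<sigma> (Le j))) = lin u (commutator (\<sigma> (LH i)) (E j 1))"
      by (rule lin_commutator_cong[OF u _ \<sigma>_e]) (simp_all add: \<sigma>_in E_in zero)
    then show "lin u (commutator (\<sigma> (LH i)) (\<sigma> (Le j))
      + scalar ((1 - q powi i) * (1 - q powi (- i))) * \<sigma> (Le (i + j))) = 0"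
      by (simp add: lin_simps H_bracket[OF u] lin_e[OF u])
  qed
  have Hf: "commutator (\<sigma> (LH i)) (\<sigma> (Lf j))
      - scalar ((1 - q powi i) * (1 - q powi (- i))) * \<sigma> (Lf (i + j)) \<in> I" for i j
  proof (rule separation)
    fix u assume u: "u \<in> ann"
    have "lin u (commutator (\<sigma> (LH i)) (\<sigma> (Lf j))) =
        lin u (commutator (\<sigma> (LH i)) (scalar (- (q powi (- j))) * E j (- 1)))"
      by (rule lin_commutator_cong[OF u _ f_cong]) (simp_all add: \<sigma>_in E_in zero subalg_closed)
    also have "\<dots> = q powi (- j) * ((1 - q powi (- i)) * (1 - q powi (- i)) * lin u (E (i + j) (- 1)))"
      using H_bracket[OF u, of i j "- 1"] by (simp add: commutator_linear lin_simps)
    finally show "lin u (commutator (\<sigma> (LH i)) (\<sigma> (Lf j))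
      - scalar ((1 - q powi i) * (1 - q powi (- i))) * \<sigma> (Lf (i + j))) = 0"
      by (simp add: lin_simps lin_f[OF u] powi_diff powi_add power_int_minus field_simps)
  qed
  have "subst \<sigma> (quad q F i j) = quad q (\<lambda>k. subst \<sigma> (F k)) i j" for F i j
    by (simp add: quad_def subst_simps)
  then show ?thesis
    using assms unfolding toroidal_relations_def Let_def
    by (auto simp: subst_simps quad_eq sym3_def HH ef He Hf e.quad_relation f.quad_relation uminus
        intro: e.serre_relation[unfolded sym3_def] f.serre_relation[unfolded sym3_def])
qed

end

section \<open>Isomorphisms of presented algebras\<close>

abbreviation relation_ideal :: "'x set \<Rightarrow> 'x free_alg set \<Rightarrow> 'x free_alg set" where
  "relation_ideal X R \<equiv> Idl\<^bsub>free_algebra X\<^esub> R"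

lemma free_ideal_relation_ideal:
  assumes "R \<subseteq> subalg X"
  shows "free_ideal X (relation_ideal X R)"
  unfolding free_ideal_def
  by (rule ring.genideal_ideal[OF ring_free_algebra]) (use assms in \<open>simp only: subalg_def\<close>)

lemma relation_in_ideal: "R \<subseteq> subalg X \<Longrightarrow> r \<in> R \<Longrightarrow> r \<in> relation_ideal X R"
  using ring.genideal_self[OF ring_free_algebra, of R X] unfolding subalg_def by blast

context free_ideal
begin

abbreviation coset :: "'x free_alg \<Rightarrow> 'x free_alg set" where
  "coset p \<equiv> I +>\<^bsub>free_algebra X\<^esub> p"

lemma mem_coset: "p \<in> coset r \<longleftrightarrow> p - r \<in> I"
  by (force simp: a_r_coset_def' algebra_simps)

lemma coset_eq_iff: "coset p = coset r \<longleftrightarrow> p - r \<in> I"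
proof
  assume "coset p = coset r"
  moreover have "p \<in> coset p" by (simp add: mem_coset zero)
  ultimately show "p - r \<in> I" by (simp add: mem_coset)
next
  assume pr: "p - r \<in> I"
  have "x - p \<in> I \<longleftrightarrow> x - r \<in> I" for x
    using add[OF _ pr, of "x - p"] diff[OF _ pr, of "x - r"] by auto
  then show "coset p = coset r" by (auto simp: mem_coset)
qed

lemma carrier_quotient: "carrier (quotient_algebra (free_algebra X) I) = coset ` subalg X"
  unfolding quotient_algebra_sel by (auto simp: FactRing_def A_RCOSETS_def' subalg_def)

lemma smult_coset:
  "c \<odot>\<^bsub>quotient_algebra (free_algebra X) I\<^esub> coset p = coset (scalar c * p)"
proof -
  have "coset (scalar c * x) = coset (scalar c * p)" if "x \<in> coset p" for x
    using smult[of "x - p" c] that by (simp add: coset_eq_iff mem_coset algebra_simps)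
  moreover have "p \<in> coset p" by (simp add: mem_coset zero)
  ultimately have "(\<Union>x\<in>coset p. coset (scalar c * x)) = coset (scalar c * p)" by blast
  then show ?thesis by (simp only: quotient_algebra_sel free_algebra_simps)
qed

lemma subst_relation_ideal:
  assumes R: "R \<subseteq> subalg Y" and \<sigma>: "\<And>y. y \<in> Y \<Longrightarrow> \<sigma> y \<in> subalg X"
    and rel: "\<And>r. r \<in> R \<Longrightarrow> subst \<sigma> r \<in> I" and p: "p \<in> relation_ideal Y R"
  shows "subst \<sigma> p \<in> I"
proof -
  let ?K = "{p \<in> subalg Y. subst \<sigma> p \<in> I}"
  have "ideal ?K (free_algebra Y)"
  proof (rule idealI[OF ring_free_algebra])
    interpret ring "free_algebra Y" by (rule ring_free_algebra)
    have inv: "\<ominus>\<^bsub>free_algebra Y\<^esub> x = - x" if "x \<in> subalg Y" for x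
      by (rule minus_equality) (use that subalg_closed(7)[of x Y] in \<open>auto simp: subalg_def\<close>)
    show "subgroup ?K (add_monoid (free_algebra Y))"
    proof
      fix x assume x: "x \<in> ?K"
      then show "inv\<^bsub>add_monoid (free_algebra Y)\<^esub> x \<in> ?K"
        using inv[of x] by (simp add: a_inv_def subst_uminus uminus subalg_closed)
    qed (simp_all add: subst_add subst_0 add zero subalg_closed, auto simp: subalg_def)
  next
    fix x a assume "x \<in> ?K" "a \<in> carrier (free_algebra Y)"
    then have "x \<in> subalg Y" "subst \<sigma> x \<in> I" "a \<in> subalg Y" "subst \<sigma> a \<in> subalg X"
      using subst_subalg[of a Y \<sigma> X] \<sigma> by (simp_all add: subalg_def del: free_algebra_simps(1))
    then show "a \<otimes>\<^bsub>free_algebra Y\<^esub> x \<in> ?K" "x \<otimes>\<^bsub>free_algebra Y\<^esub> a \<in> ?K"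
      by (simp_all add: subst_mult mult_left mult_right subalg_closed)
  qed
  moreover have "R \<subseteq> ?K" using R rel by blast
  ultimately have "relation_ideal Y R \<subseteq> ?K"
    by (rule ring.genideal_minimal[OF ring_free_algebra])
  then show ?thesis using p by blast
qed

lemma subst_subst_cong:
  assumes \<sigma>: "\<And>x. x \<in> X \<Longrightarrow> \<sigma> x \<in> subalg Y" and \<tau>: "\<And>y. y \<in> Y \<Longrightarrow> \<tau> y \<in> subalg X"
    and id: "\<And>x. x \<in> X \<Longrightarrow> subst \<tau> (\<sigma> x) - letter x \<in> I" and p: "p \<in> subalg X"
  shows "subst \<tau> (subst \<sigma> p) - p \<in> I"
  using p
proof (induction rule: subalg_induct)
  case (add p r)
  have "subst \<tau> (subst \<sigma> (p + r)) - (p + r) = (subst \<tau> (subst \<sigma> p) - p) + (subst \<tau> (subst \<sigma> r) - r)"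
    by (simp add: subst_simps)
  with add show ?case by (simp only: free_ideal.add[OF free_ideal_axioms])
next
  case (mult p r)
  have "subst \<tau> (subst \<sigma> (p * r)) - p * r =
      (subst \<tau> (subst \<sigma> p) - p) * subst \<tau> (subst \<sigma> r) + p * (subst \<tau> (subst \<sigma> r) - r)"
    by (simp add: subst_simps algebra_simps)
  moreover have "subst \<tau> (subst \<sigma> r) \<in> subalg X"
    by (rule subst_subalg[OF subst_subalg[OF mult(2) \<sigma>] \<tau>])
  ultimately show ?case
    using mult by (simp only: free_ideal.add[OF free_ideal_axioms] mult_left mult_right)
qed (simp_all add: subst_simps id zero)

end

text \<open>
  Two substitutions that respect the relations and are inverse to each other on the generators induce
  inverse isomorphisms of the presented algebras.
\<close>

theorem presented_algebra_isoI:
  assumes R: "R \<subseteq> subalg X" and S: "S \<subseteq> subalg Y"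
    and \<sigma>: "\<And>x. x \<in> X \<Longrightarrow> \<sigma> x \<in> subalg Y" and \<tau>: "\<And>y. y \<in> Y \<Longrightarrow> \<tau> y \<in> subalg X"
    and \<sigma>_rel: "\<And>r. r \<in> R \<Longrightarrow> subst \<sigma> r \<in> relation_ideal Y S"
    and \<tau>_rel: "\<And>s. s \<in> S \<Longrightarrow> subst \<tau> s \<in> relation_ideal X R"
    and \<tau>\<sigma>: "\<And>x. x \<in> X \<Longrightarrow> subst \<tau> (\<sigma> x) - letter x \<in> relation_ideal X R"
    and \<sigma>\<tau>: "\<And>y. y \<in> Y \<Longrightarrow> subst \<sigma> (\<tau> y) - letter y \<in> relation_ideal Y S"
  shows "\<exists>\<theta> \<in> algebra_iso (presented_algebra X R) (presented_algebra Y S).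
    \<forall>x \<in> X. \<theta> (presented_gen X R x) = relation_ideal Y S +>\<^bsub>free_algebra Y\<^esub> \<sigma> x"
proof -
  interpret I: free_ideal X "relation_ideal X R" by (rule free_ideal_relation_ideal[OF R])
  interpret J: free_ideal Y "relation_ideal Y S" by (rule free_ideal_relation_ideal[OF S])
  define h where "h p = J.coset (subst \<sigma> p)" for p
  have \<sigma>_in: "subst \<sigma> p \<in> subalg Y" if "p \<in> subalg X" for p
    using subst_subalg[OF that \<sigma>] .
  have "subst \<sigma> \<in> ring_hom (free_algebra X) (free_algebra Y)"
    by (rule ring_hom_memI) (use \<sigma>_in in \<open>simp_all add: subst_simps subalg_def del: free_algebra_simps(1)\<close>)
  then have h_hom: "h \<in> ring_hom (free_algebra X) (free_algebra Y Quot relation_ideal Y S)"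
    using ring_hom_trans[OF _ ideal.rcos_ring_hom[OF J.ideal]] by (simp add: h_def[abs_def] comp_def)
  interpret h: ring_hom_ring "free_algebra X" "free_algebra Y Quot relation_ideal Y S" h
    by (rule ring_hom_ringI2[OF ring_free_algebra ideal.quotient_is_ring[OF J.ideal] h_hom])
  have kernel: "a_kernel (free_algebra X) (free_algebra Y Quot relation_ideal Y S) h = relation_ideal X R"
  proof -
    have zero: "\<zero>\<^bsub>free_algebra Y Quot relation_ideal Y S\<^esub> = J.coset 0"
      by (auto simp: FactRing_def J.mem_coset)
    have "p \<in> relation_ideal X R" if "p \<in> subalg X" "subst \<sigma> p \<in> relation_ideal Y S" for p
      using I.diff[OF I.subst_relation_ideal[OF S \<tau> \<tau>_rel that(2)]
          I.subst_subst_cong[OF \<sigma> \<tau> \<tau>\<sigma> that(1)]] by simp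
    moreover have "subst \<sigma> p \<in> relation_ideal Y S" if "p \<in> relation_ideal X R" for p
      using J.subst_relation_ideal[OF R \<sigma> \<sigma>_rel that] .
    ultimately show ?thesis
      using I.subset unfolding a_kernel_def' zero h_def J.coset_eq_iff subalg_def[symmetric] by auto
  qed
  have surj: "h ` carrier (free_algebra X) = carrier (free_algebra Y Quot relation_ideal Y S)"
  proof -
    have "J.coset p \<in> h ` subalg X" if "p \<in> subalg Y" for p
    proof (rule image_eqI)
      show "J.coset p = h (subst \<tau> p)"
        using J.uminus[OF J.subst_subst_cong[OF \<tau> \<sigma> \<sigma>\<tau> that]] by (simp add: h_def J.coset_eq_iff)
      show "subst \<tau> p \<in> subalg X" using subst_subalg[OF that \<tau>] .
    qed
    then show ?thesis
      using J.carrier_quotient \<sigma>_in unfolding quotient_algebra_sel h_def subalg_def[symmetric] by auto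
  qed
  define \<theta> where "\<theta> = (\<lambda>P. the_elem (h ` P))"
  have iso: "\<theta> \<in> ring_iso (free_algebra X Quot relation_ideal X R) (free_algebra Y Quot relation_ideal Y S)"
    using h.FactRing_iso_set[OF surj] unfolding kernel \<theta>_def .
  have \<theta>: "\<theta> (I.coset p) = J.coset (subst \<sigma> p)" for p
  proof -
    have "h r = h p" if "r \<in> I.coset p" for r
      using J.subst_relation_ideal[OF R \<sigma> \<sigma>_rel, of "r - p"] that
      by (simp add: h_def J.coset_eq_iff I.mem_coset subst_diff)
    moreover have "p \<in> I.coset p" by (simp add: I.mem_coset I.zero)
    ultimately have "h ` I.coset p = {h p}" by blast
    then show ?thesis by (simp add: \<theta>_def h_def)
  qed
  have "\<theta> \<in> algebra_iso (presented_algebra X R) (presented_algebra Y S)"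
    unfolding algebra_iso_def
  proof (intro CollectI conjI allI ballI)
    show "\<theta> \<in> ring_iso (presented_algebra X R) (presented_algebra Y S)"
      using iso unfolding ring_iso_def ring_hom_def presented_algebra_def quotient_algebra_sel .
    fix c P assume "P \<in> carrier (presented_algebra X R)"
    then obtain p where "P = I.coset p"
      unfolding presented_algebra_def I.carrier_quotient by blast
    then show "\<theta> (c \<odot>\<^bsub>presented_algebra X R\<^esub> P) = c \<odot>\<^bsub>presented_algebra Y S\<^esub> \<theta> P"
      unfolding presented_algebra_def by (simp add: I.smult_coset J.smult_coset \<theta> subst_simps)
  qed
  moreover have "\<theta> (presented_gen X R x) = J.coset (\<sigma> x)" for x
    by (simp add: presented_gen_def \<theta> subst_letter)
  ultimately show ?thesis by blast
qed

section \<open>Monomials of the quantum torus\<close>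


context free_ideal
begin

definition congr :: "'x free_alg \<Rightarrow> 'x free_alg \<Rightarrow> bool" (infix "\<approx>" 50) where
  "p \<approx> r \<longleftrightarrow> p - r \<in> I"

lemma congr_refl [simp]: "p \<approx> p"
  by (simp add: congr_def zero)

lemma congr_sym: "p \<approx> r \<Longrightarrow> r \<approx> p"
  using uminus[of "p - r"] by (simp add: congr_def)

lemma congr_trans [trans]: "p \<approx> r \<Longrightarrow> r \<approx> s \<Longrightarrow> p \<approx> s"
  using add[of "p - r" "r - s"] by (simp add: congr_def)

lemma congr_mult_left: "p \<approx> r \<Longrightarrow> a \<in> subalg X \<Longrightarrow> a * p \<approx> a * r"
  using mult_left[of "p - r" a] by (simp add: congr_def algebra_simps)

lemma congr_mult_right: "p \<approx> r \<Longrightarrow> a \<in> subalg X \<Longrightarrow> p * a \<approx> r * a"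
  using mult_right[of "p - r" a] by (simp add: congr_def algebra_simps)

lemma congr_scalar: "p \<approx> r \<Longrightarrow> scalar \<kappa> * p \<approx> scalar \<kappa> * r"
  by (rule congr_mult_left) (auto intro: subalg_closed)

end

text \<open>
  The cocycle is a finite geometric sum with ratio \<open>q\<^bsup>a+b\<^esup>\<close>. For \<open>a + b \<noteq> 0\<close> its value
  \<open>(q\<^bsup>jb\<^esup> - q\<^bsup>ka\<^esup>) / (q\<^bsup>a+b\<^esup> - 1)\<close> is a coboundary, removed by the change of basis
  \<open>Z\<^sup>i \<mapsto> Z\<^sup>i + c/(q\<^sup>i - 1)\<close>; for \<open>a + b = 0\<close> all summands are equal. In the second case
  the last factor is zero, being the inverse of zero.
\<close>

lemma torus_cocycle_value_eq:
  assumes "not_root_of_unity q"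
  shows "torus_cocycle_value q a j b (- k) = central_term q a j b k
    + weight q a j b k * (if j + k = 0 then inverse (q powi (a + b) - 1) else 0)"
proof -
  interpret not_root_of_unity q by (rule assms)
  define s where "s = a + b"
  have geom: "(q powi s - 1) * (\<Sum>i = - int n..- 1. q powi (s * i)) = 1 - q powi (- (s * int n))"
    and const: "s = 0 \<Longrightarrow> (\<Sum>i = - int n..- 1. q powi (s * i)) = of_nat n" for n
  proof -
    show "s = 0 \<Longrightarrow> (\<Sum>i = - int n..- 1. q powi (s * i)) = of_nat n" by simp
    show "(q powi s - 1) * (\<Sum>i = - int n..- 1. q powi (s * i)) = 1 - q powi (- (s * int n))"
    proof (induction n)
      case (Suc n)
      have "{- int (Suc n)..- 1} = insert (- int (Suc n)) {- int n..- 1}" by auto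
      then have "(\<Sum>i = - int (Suc n)..- 1. q powi (s * i)) =
          q powi (- (s * int (Suc n))) + (\<Sum>i = - int n..- 1. q powi (s * i))"
        by (simp del: of_nat_Suc)
      moreover have "q powi s * q powi (- (s * int (Suc n))) = q powi (- (s * int n))"
        by (simp add: algebra_simps flip: powi_add)
      ultimately show ?case
        using Suc by (simp add: algebra_simps del: of_nat_Suc)
    qed simp
  qed
  have sum: "q powi t * (\<Sum>i = - int n..- 1. q powi (s * i)) =
      (if s = 0 then of_nat n * q powi t else (q powi t - q powi (t - s * int n)) * inverse (q powi s - 1))" for n t
  proof (cases "s = 0")
    case False
    then have "q powi s - 1 \<noteq> 0" using powi_eq_1[of s] by auto
    then have "(\<Sum>i = - int n..- 1. q powi (s * i)) = (1 - q powi (- (s * int n))) * inverse (q powi s - 1)"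
      using geom[of n] by (simp add: field_simps)
    moreover have "q powi t * q powi (- (s * int n)) = q powi (t - s * int n)"
      by (simp flip: powi_add)
    ultimately show ?thesis using False by (simp add: mult.assoc[symmetric] right_diff_distrib)
  qed (simp add: const)
  consider "j + k \<noteq> 0" | "j = 0" "k = 0" | "j > 0" "k = - j" | "j < 0" "k = - j" by linarith
  then show ?thesis
  proof cases
    case 3
    define n where "n = nat j"
    have j: "j = int n" using 3 by (simp add: n_def)
    have "(\<Sum>i = - j..- 1. q powi (a * i + b * (i + j))) = q powi (j * b) * (\<Sum>i = - j..- 1. q powi (s * i))"
      unfolding sum_distrib_left powi_add[symmetric] s_def by (rule sum.cong) (simp_all add: algebra_simps)
    also have "\<dots> = (if s = 0 then of_nat n * q powi (j * b) else (q powi (j * b) - q powi (k * a)) * inverse (q powi s - 1))"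
      unfolding j sum using 3 by (simp add: s_def j algebra_simps)
    finally show ?thesis
      using 3 by (auto simp: torus_cocycle_value_def central_term_def weight_def s_def j add_eq_0_iff2 mult.commute)
  next
    case 4
    define n where "n = nat (- j)"
    have j: "j = - int n" using 4 by (simp add: n_def)
    have "(\<Sum>i = j..- 1. q powi (b * i + a * (i - j))) = q powi (k * a) * (\<Sum>i = - int n..- 1. q powi (s * i))"
      unfolding sum_distrib_left powi_add[symmetric] s_def j using 4 j by (intro sum.cong) (simp_all add: algebra_simps)
    also have "\<dots> = (if s = 0 then of_nat n * q powi (k * a) else (q powi (k * a) - q powi (j * b)) * inverse (q powi s - 1))"
      unfolding sum using 4 by (simp add: s_def j algebra_simps)
    finally show ?thesis
      using 4 by (auto simp: torus_cocycle_value_def central_term_def weight_def s_def j add_eq_0_iff2 algebra_simps)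
  qed (auto simp: torus_cocycle_value_def central_term_def weight_def)
qed


text \<open>
  The linear map that sends \<open>Z\<^sup>a D\<^sup>j\<close> to \<open>F a j\<close>, defined on representatives by reading off the
  coefficient and the bidegree of each word.
\<close>

definition torus_eval :: "complex \<Rightarrow> (int \<Rightarrow> int \<Rightarrow> 'x free_alg) \<Rightarrow> torus_letter free_alg \<Rightarrow> 'x free_alg" where
  "torus_eval q F p = (\<Sum>w \<in> Poly_Mapping.keys p.
     scalar (Poly_Mapping.lookup p w * word_coeff q (letters w)) * F (zdeg (letters w)) (ddeg (letters w)))"

lemma lin_torus_eval: "lin u (torus_eval q F p) = lin (torus_functional q (\<lambda>a j. lin u (F a j))) p"
  by (simp add: torus_eval_def lin_sum lin_scalar_mult lin_def[of _ p] torus_functional_def mult.assoc)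

lemma torus_eval_linear:
  "torus_eval q F (p + r) = torus_eval q F p + torus_eval q F r"
  "torus_eval q F (p - r) = torus_eval q F p - torus_eval q F r"
  "torus_eval q F (scalar \<kappa> * p) = scalar \<kappa> * torus_eval q F p"
  "torus_eval q F 0 = 0"
  by (rule free_alg_eqI, simp add: lin_torus_eval lin_simps)+

lemma torus_eval_ideal: "q \<noteq> 0 \<Longrightarrow> p \<in> torus_ideal q \<Longrightarrow> torus_eval q F p = 0"
  by (rule free_alg_eqI) (simp add: lin_torus_eval torus_functional_ideal)

definition monomial_word :: "int \<Rightarrow> int \<Rightarrow> torus_letter list" where
  "monomial_word a j = replicate (nat \<bar>a\<bar>) (if a < 0 then LZinv else LZ)
     @ replicate (nat \<bar>j\<bar>) (if j < 0 then LDinv else LD)"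

abbreviation monomial :: "int \<Rightarrow> int \<Rightarrow> torus_letter free_alg" where
  "monomial a j \<equiv> Poly_Mapping.single (Word (monomial_word a j)) 1"

lemma torus_monomial_class: "torus_monomial q a j = torus_class q (monomial a j)"
  by (simp add: torus_monomial_eq monomial_word_def)

lemma monomial_word_simps:
  assumes "q \<noteq> 0"
  shows "zdeg (monomial_word a j) = a" "ddeg (monomial_word a j) = j"
    "word_coeff q (monomial_word a j) = 1"
proof -
  have deg: "zdeg (replicate n x) = int n * zdeg1 x" "ddeg (replicate n x) = int n * ddeg1 x"
    for n x by (induction n) (auto simp: algebra_simps)
  have coeff: "word_coeff q (replicate n x) = 1" if "zdeg1 x = 0 \<or> ddeg1 x = 0" for n x
    using that by (induction n) (auto simp: deg)
  show "zdeg (monomial_word a j) = a" "ddeg (monomial_word a j) = j"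
    "word_coeff q (monomial_word a j) = 1"
    by (simp_all add: monomial_word_def deg coeff word_coeff_append[OF assms])
qed

lemma torus_eval_monomial: "q \<noteq> 0 \<Longrightarrow> torus_eval q F (monomial a j) = F a j"
  by (rule free_alg_eqI) (simp add: lin_torus_eval torus_functional_def monomial_word_simps)

text \<open>
  Powers of a letter \<open>x\<close> with integer exponents, for an inverse letter \<open>y\<close>.
\<close>

definition letter_powi :: "'x \<Rightarrow> 'x \<Rightarrow> int \<Rightarrow> 'x free_alg" where
  "letter_powi x y a = letter (if a < 0 then y else x) ^ nat \<bar>a\<bar>"

lemma monomial_eq: "monomial a j = letter_powi LZ LZinv a * letter_powi LD LDinv j"
  by (simp add: letter_powi_def monomial_word_def letter_power mult_single plus_word_def)

locale quantum_torus = free_ideal "UNIV :: torus_letter set" "torus_ideal q" for q :: complex +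
  assumes q_nonzero [simp]: "q \<noteq> 0"
begin

notation congr (infix "\<approx>" 50)

lemma relations:
  "letter LZ * letter LZinv \<approx> 1" "letter LZinv * letter LZ \<approx> 1"
  "letter LD * letter LDinv \<approx> 1" "letter LDinv * letter LD \<approx> 1"
  "letter LD * letter LZ \<approx> scalar q * (letter LZ * letter LD)"
proof -
  have "torus_relations q \<subseteq> torus_ideal q"
    by (rule ring.genideal_self[OF ring_free_algebra]) simp
  then have "r \<in> torus_ideal q" if "r \<in> torus_relations q" for r using that by blast
  then show "letter LZ * letter LZinv \<approx> 1" "letter LZinv * letter LZ \<approx> 1"
    "letter LD * letter LDinv \<approx> 1" "letter LDinv * letter LD \<approx> 1"
    "letter LD * letter LZ \<approx> scalar q * (letter LZ * letter LD)"
    unfolding congr_def by (this, simp add: torus_relations_def)+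
qed

lemma letter_powi_step:
  assumes "letter x * letter y \<approx> 1" "letter y * letter x \<approx> 1"
  shows "letter x * letter_powi x y a \<approx> letter_powi x y (a + 1)"
    and "letter y * letter_powi x y a \<approx> letter_powi x y (a - 1)"
proof -
  have cancel: "u * (v * p) \<approx> p" if "u * v \<approx> 1" for u v p
    using congr_mult_right[OF that, of p] by (simp add: mult.assoc)
  show "letter x * letter_powi x y a \<approx> letter_powi x y (a + 1)"
  proof (cases "a \<ge> 0")
    case True
    then show ?thesis by (simp add: letter_powi_def nat_add_distrib)
  next
    case False
    then have "nat \<bar>a\<bar> = Suc (nat \<bar>a + 1\<bar>)" by simp
    then have "letter_powi x y a = letter y * letter_powi x y (a + 1)"
      using False by (auto simp: letter_powi_def)
    then show ?thesis using cancel[OF assms(1)] by simp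
  qed
  show "letter y * letter_powi x y a \<approx> letter_powi x y (a - 1)"
  proof (cases "a \<le> 0")
    case True
    then have "nat \<bar>a - 1\<bar> = Suc (nat \<bar>a\<bar>)" by simp
    then show ?thesis using True by (auto simp: letter_powi_def)
  next
    case False
    then have "nat \<bar>a\<bar> = Suc (nat \<bar>a - 1\<bar>)" by simp
    then have "letter_powi x y a = letter x * letter_powi x y (a - 1)"
      using False by (auto simp: letter_powi_def)
    then show ?thesis using cancel[OF assms(2)] by simp
  qed
qed

lemma q_commute_inverse:
  assumes "d * x \<approx> scalar \<kappa> * (x * d)" "x * y \<approx> 1" "y * x \<approx> 1" "\<kappa> \<noteq> 0"
  shows "d * y \<approx> scalar (inverse \<kappa>) * (y * d)"
proof -
  have "d * y \<approx> (y * x) * (d * y)"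
    using congr_sym[OF congr_mult_right[OF assms(3), of "d * y"]] by simp
  also have "(y * x) * (d * y) = scalar (inverse \<kappa>) * (y * (scalar \<kappa> * (x * d)) * y)"
  proof -
    have "scalar (inverse \<kappa>) * (scalar \<kappa> * t) = t" for t :: "torus_letter free_alg"
      using assms(4) by (simp add: scalar_scalar flip: mult.assoc)
    moreover have "y * (scalar \<kappa> * (x * d)) * y = scalar \<kappa> * ((y * x) * (d * y))"
      by (simp only: scalar_left_commute mult.assoc)
    ultimately show ?thesis by metis
  qed
  also have "\<dots> \<approx> scalar (inverse \<kappa>) * (y * (d * x) * y)"
    by (intro congr_scalar congr_mult_right congr_mult_left congr_sym[OF assms(1)] subalg_UNIV)
  also have "\<dots> = scalar (inverse \<kappa>) * (y * d * (x * y))"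
    by (simp add: mult.assoc)
  also have "\<dots> \<approx> scalar (inverse \<kappa>) * (y * d * 1)"
    by (intro congr_scalar congr_mult_left assms(2) subalg_UNIV)
  finally show ?thesis by simp
qed

lemma q_commute_power:
  assumes "d * x \<approx> scalar \<kappa> * (x * d)"
  shows "d * x ^ n \<approx> scalar (\<kappa> ^ n) * (x ^ n * d)"
proof (induction n)
  case (Suc n)
  have "d * x ^ Suc n = d * x * x ^ n" by (simp add: mult.assoc)
  also have "\<dots> \<approx> scalar \<kappa> * (x * d) * x ^ n"
    by (rule congr_mult_right[OF assms]) simp
  also have "\<dots> = scalar \<kappa> * (x * (d * x ^ n))" by (simp add: mult.assoc)
  also have "\<dots> \<approx> scalar \<kappa> * (x * (scalar (\<kappa> ^ n) * (x ^ n * d)))"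
    by (intro congr_scalar congr_mult_left Suc subalg_UNIV)
  also have "\<dots> = scalar (\<kappa> ^ Suc n) * (x ^ Suc n * d)"
    by (simp only: scalar_left_commute[of x] power_Suc scalar_scalar[symmetric] mult.assoc)
  finally show ?case .
qed simp

lemma q_commute_letter_powi:
  assumes "d * letter x \<approx> scalar \<kappa> * (letter x * d)"
    and xy: "letter x * letter y \<approx> 1" "letter y * letter x \<approx> 1" and "\<kappa> \<noteq> 0"
  shows "d * letter_powi x y a \<approx> scalar (\<kappa> powi a) * (letter_powi x y a * d)"
proof (cases "a < 0")
  case True
  then have "inverse \<kappa> ^ nat \<bar>a\<bar> = \<kappa> powi a"
    by (simp add: power_int_def)
  then show ?thesis
    using q_commute_power[OF q_commute_inverse[OF assms], of "nat \<bar>a\<bar>"] True by (simp add: letter_powi_def)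
next
  case False
  then show ?thesis
    using q_commute_power[OF assms(1), of "nat \<bar>a\<bar>"] by (simp add: letter_powi_def power_int_def)
qed

lemma letter_mult_monomial:
  "letter x * monomial a j \<approx> scalar (q powi (ddeg1 x * a)) * monomial (a + zdeg1 x) (j + ddeg1 x)"
proof -
  have D: "letter LD * letter_powi LZ LZinv a \<approx> scalar (q powi a) * (letter_powi LZ LZinv a * letter LD)"
    by (rule q_commute_letter_powi[OF relations(5,1,2)]) simp
  have cancel: "scalar (inverse q) * (scalar q * t) = t" for t :: "torus_letter free_alg"
    by (simp add: scalar_scalar flip: mult.assoc)
  have "letter LZ * letter LD \<approx> scalar (inverse q) * (letter LD * letter LZ)"
    using congr_scalar[OF congr_sym[OF relations(5)], of "inverse q"] unfolding cancel .
  from q_commute_inverse[OF this relations(3,4)]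
  have "letter LZ * letter LDinv \<approx> scalar q * (letter LDinv * letter LZ)"
    by simp
  from congr_scalar[OF congr_sym[OF this], of "inverse q"]
  have "letter LDinv * letter LZ \<approx> scalar (inverse q) * (letter LZ * letter LDinv)"
    unfolding cancel .
  then have "letter LDinv * letter_powi LZ LZinv a \<approx>
      scalar (inverse q powi a) * (letter_powi LZ LZinv a * letter LDinv)"
    by (rule q_commute_letter_powi[OF _ relations(1,2)]) simp
  then have Dinv: "letter LDinv * letter_powi LZ LZinv a \<approx>
      scalar (q powi (- a)) * (letter_powi LZ LZinv a * letter LDinv)"
    by (simp add: power_int_inverse power_int_minus)
  have D_step: "d * (letter_powi LZ LZinv a * p) \<approx> scalar \<kappa> * (letter_powi LZ LZinv a * r)"
    if d: "d * letter_powi LZ LZinv a \<approx> scalar \<kappa> * (letter_powi LZ LZinv a * d)" and pr: "d * p \<approx> r" for d \<kappa> p r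
  proof -
    have "d * (letter_powi LZ LZinv a * p) \<approx> scalar \<kappa> * (letter_powi LZ LZinv a * (d * p))"
      using congr_mult_right[OF d, of p] by (simp add: mult.assoc)
    also have "\<dots> \<approx> scalar \<kappa> * (letter_powi LZ LZinv a * r)"
      by (intro congr_scalar congr_mult_left pr subalg_UNIV)
    finally show ?thesis .
  qed
  show ?thesis
  proof (cases x)
    case LZ
    then show ?thesis
      using congr_mult_right[OF letter_powi_step(1)[OF relations(1,2), of a], of "letter_powi LD LDinv j"]
      unfolding monomial_eq mult.assoc by simp
  next
    case LZinv
    then show ?thesis
      using congr_mult_right[OF letter_powi_step(2)[OF relations(1,2), of a], of "letter_powi LD LDinv j"]
      unfolding monomial_eq mult.assoc by simp
  next
    case LD
    then show ?thesis
      using D_step[OF D letter_powi_step(1)[OF relations(3,4), of j]] unfolding monomial_eq by simp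
  next
    case LDinv
    then show ?thesis
      using D_step[OF Dinv letter_powi_step(2)[OF relations(3,4), of j]] unfolding monomial_eq by simp
  qed
qed

text \<open>
  The functionals on the torus show that the monomials are independent; conversely the commutation
  rules bring every word into normal order.
\<close>

lemma word_normal_form:
  "Poly_Mapping.single (Word xs) 1 \<approx> scalar (word_coeff q xs) * monomial (zdeg xs) (ddeg xs)"
proof (induction xs)
  case Nil
  have "monomial_word 0 0 = []" by (simp add: monomial_word_def)
  then show ?case by simp
next
  case (Cons x xs)
  have "Poly_Mapping.single (Word (x # xs)) 1 = letter x * Poly_Mapping.single (Word xs) 1"
    by (simp add: letter_def mult_single plus_word_def)
  also have "\<dots> \<approx> letter x * (scalar (word_coeff q xs) * monomial (zdeg xs) (ddeg xs))"
    by (intro congr_mult_left Cons subalg_UNIV)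
  also have "\<dots> = scalar (word_coeff q xs) * (letter x * monomial (zdeg xs) (ddeg xs))"
    by (rule scalar_left_commute)
  also have "\<dots> \<approx> scalar (word_coeff q xs) *
      (scalar (q powi (ddeg1 x * zdeg xs)) * monomial (zdeg xs + zdeg1 x) (ddeg xs + ddeg1 x))"
    by (intro congr_scalar letter_mult_monomial)
  also have "\<dots> = scalar (word_coeff q (x # xs)) * monomial (zdeg (x # xs)) (ddeg (x # xs))"
  proof -
    have "word_coeff q xs * q powi (ddeg1 x * zdeg xs) = word_coeff q (x # xs)"
      "zdeg xs + zdeg1 x = zdeg (x # xs)" "ddeg xs + ddeg1 x = ddeg (x # xs)"
      by simp_all
    then show ?thesis by (simp only: mult.assoc[symmetric] scalar_scalar)
  qed
  finally show ?case .
qed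

lemma monomial_mult: "monomial a j * monomial b k \<approx> scalar (q powi (j * b)) * monomial (a + b) (j + k)"
  using word_normal_form[of "monomial_word a j @ monomial_word b k"]
  by (simp add: mult_single plus_word_def word_coeff_append monomial_word_simps[OF q_nonzero])

lemma monomial_commutator:
  "commutator (monomial a j) (monomial b k) \<approx> scalar (weight q a j b k) * monomial (a + b) (j + k)"
proof -
  have "commutator (monomial a j) (monomial b k) - scalar (weight q a j b k) * monomial (a + b) (j + k) =
      (monomial a j * monomial b k - scalar (q powi (j * b)) * monomial (a + b) (j + k))
      - (monomial b k * monomial a j - scalar (q powi (k * a)) * monomial (b + a) (k + j))"
    by (simp add: commutator_def weight_def scalar_diff algebra_simps)
  then show ?thesis
    using diff[OF monomial_mult[unfolded congr_def] monomial_mult[unfolded congr_def]] by (simp add: congr_def)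
qed

end

section \<open>The Lie algebra and its enveloping algebra\<close>

locale torus_lie = not_root_of_unity q for q :: complex
begin

sublocale T: quantum_torus q
  by (intro quantum_torus.intro free_ideal.intro quantum_torus_axioms.intro ideal_torus_ideal q_nonzero)

abbreviation L where "L \<equiv> torus_ext0 q"

text \<open>
  Elements of the extension are handled through representatives in the free algebra.
\<close>

definition el :: "torus_letter free_alg \<Rightarrow> complex \<Rightarrow> torus_letter free_alg set \<times> complex" where
  "el p s = (torus_class q p, s)"

definition form :: "torus_letter free_alg \<Rightarrow> torus_letter free_alg \<Rightarrow> complex" where
  "form p r = torus_cocycle q (torus_class q p) (torus_class q r)"

lemma el_cong: "p - r \<in> torus_ideal q \<Longrightarrow> el p s = el r s"
  unfolding el_def using T.coset_eq_iff by blast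

lemma torus_zero: "\<zero>\<^bsub>torus q\<^esub> = torus_class q 0"
  by (auto simp: torus_eq quotient_algebra_sel FactRing_def T.mem_coset)

lemma torus_uminus: "\<ominus>\<^bsub>torus q\<^esub> torus_class q p = torus_class q (- p)"
proof -
  have r: "abelian_group (torus q)"
  proof (rule abelian_groupI)
    fix x assume "x \<in> carrier (torus q)"
    then obtain p where "x = torus_class q p" by (auto simp: torus_carrier)
    then have "torus_class q (- p) \<oplus>\<^bsub>torus q\<^esub> x = \<zero>\<^bsub>torus q\<^esub>"
      by (simp add: torus_class_add torus_zero)
    then show "\<exists>y \<in> carrier (torus q). y \<oplus>\<^bsub>torus q\<^esub> x = \<zero>\<^bsub>torus q\<^esub>"
      by (auto simp: torus_carrier)
  qed (auto simp: torus_carrier torus_class_add torus_zero algebra_simps)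
  show ?thesis
    by (rule abelian_group.minus_equality[OF r])
      (simp_all add: torus_class_add torus_zero torus_carrier)
qed

lemma lie_ops:
  "lie_add L (el p s) (el r t) = el (p + r) (s + t)"
  "lie_smult L \<kappa> (el p s) = el (scalar \<kappa> * p) (\<kappa> * s)"
  "lie_zero L = el 0 0"
  "lie_bracket L (el p s) (el r t) = el (commutator p r) (form p r)"
  "torus_ext_central q = el 0 1"
  "torus_ext_incl q (torus_monomial q a j) = el (monomial a j) 0"
  by (simp_all add: torus_ext0_def torus_ext_def central_extension_def commutator_lie_algebra_def el_def
      torus_class_add torus_class_smult torus_zero torus_class_mult a_minus_def torus_uminus form_def
      commutator_def torus_ext_central_def torus_ext_incl_def torus_monomial_class)

lemma form_linear:
  "form (p + p') r = form p r + form p' r" "form r (p + p') = form r p + form r p'"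
  "form (scalar \<kappa> * p) r = \<kappa> * form p r" "form r (scalar \<kappa> * p) = \<kappa> * form r p"
  "form 0 r = 0" "form r 0 = 0"
proof -
  have b: "bilinear_form_on (torus q) (torus_cocycle q)"
    using torus_cocycle[of q] by (simp add: is_torus_cocycle_def)
  show "form (p + p') r = form p r + form p' r" "form r (p + p') = form r p + form r p'"
    and s: "form (scalar \<kappa> * p) r = \<kappa> * form p r" "form r (scalar \<kappa> * p) = \<kappa> * form r p" for \<kappa> p p' r
    using b unfolding bilinear_form_on_def form_def
    by (simp_all add: torus_carrier flip: torus_class_add torus_class_smult)
  show "form 0 r = 0" "form r 0 = 0"
    using s(1)[of 0 0 r] s(2)[of r 0 0] by simp_all
qed

lemma form_monomial: "form (monomial a j) (monomial b k) = central_term q a j b k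
    + weight q a j b k * (if j + k = 0 then inverse (q powi (a + b) - 1) else 0)"
proof -
  have "is_torus_cocycle q (torus_cocycle q)" by (rule torus_cocycle) simp
  then have "torus_cocycle q (torus_monomial q a j) (torus_monomial q b (- (- k))) = torus_cocycle_value q a j b (- k)"
    unfolding is_torus_cocycle_def by blast
  then show ?thesis
    by (simp add: form_def torus_cocycle_value_eq[OF not_root_of_unity_axioms] flip: torus_monomial_class)
qed

definition basis :: "(torus_letter free_alg set \<times> complex) set" where
  "basis = insert (el 0 1) {el (monomial a j) 0 | a j. (a, j) \<noteq> (0, 0)}"

lemma carrier_L: "carrier L = lie_span L basis"
proof -
  have ops: "lie_zero L = lie_zero (torus_ext q)" "lie_add L = lie_add (torus_ext q)"
    "lie_smult L = lie_smult (torus_ext q)"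
    by (simp_all add: torus_ext0_def)
  have "lie_span L S = lie_span (torus_ext q) S" for S
  proof (rule antisym; rule subsetI)
    show "x \<in> lie_span (torus_ext q) S" if "x \<in> lie_span L S" for x
      using that by induction (auto simp: ops intro: lie_span.intros)
    show "x \<in> lie_span L S" if "x \<in> lie_span (torus_ext q) S" for x
      using that by induction (auto simp flip: ops intro: lie_span.intros)
  qed
  moreover have "{torus_ext_central q} \<union> {torus_ext_incl q (torus_monomial q i j) | i j. (i, j) \<noteq> (0, 0)} = basis"
    by (auto simp: basis_def lie_ops)
  ultimately show ?thesis by (simp add: torus_ext0_def)
qed

lemma L_closed:
  "el 0 0 \<in> carrier L" "x \<in> carrier L \<Longrightarrow> y \<in> carrier L \<Longrightarrow> lie_add L x y \<in> carrier L"
  "x \<in> carrier L \<Longrightarrow> lie_smult L \<kappa> x \<in> carrier L"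
  "el 0 1 \<in> carrier L" "(a, j) \<noteq> (0, 0) \<Longrightarrow> el (monomial a j) 0 \<in> carrier L"
proof -
  have basis: "el 0 1 \<in> basis" "(a, j) \<noteq> (0, 0) \<Longrightarrow> el (monomial a j) 0 \<in> basis"
    unfolding basis_def by blast+
  show "el 0 0 \<in> carrier L"
    unfolding carrier_L lie_ops(3)[symmetric] by (rule lie_span.zero)
  show "x \<in> carrier L \<Longrightarrow> y \<in> carrier L \<Longrightarrow> lie_add L x y \<in> carrier L"
    "x \<in> carrier L \<Longrightarrow> lie_smult L \<kappa> x \<in> carrier L"
    unfolding carrier_L by (rule lie_span.add lie_span.smult; assumption)+
  show "el 0 1 \<in> carrier L" "(a, j) \<noteq> (0, 0) \<Longrightarrow> el (monomial a j) 0 \<in> carrier L"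
    unfolding carrier_L by (rule lie_span.base, rule basis, assumption?)+
qed

lemma L_el: "x \<in> carrier L \<Longrightarrow> \<exists>p s. x = el p s"
proof -
  assume "x \<in> carrier L"
  then have "x \<in> lie_span L basis" by (simp add: carrier_L)
  then show ?thesis by induction (fastforce simp: basis_def lie_ops)+
qed

lemma L_induct [consumes 1, case_names zero central monomial add smult]:
  assumes x: "x \<in> carrier L"
    and "P (el 0 0)" "P (el 0 1)" "\<And>a j. (a, j) \<noteq> (0, 0) \<Longrightarrow> P (el (monomial a j) 0)"
    and add: "\<And>p s r t. el p s \<in> carrier L \<Longrightarrow> el r t \<in> carrier L \<Longrightarrow> P (el p s) \<Longrightarrow> P (el r t)
      \<Longrightarrow> P (el (p + r) (s + t))"
    and smult: "\<And>\<kappa> p s. el p s \<in> carrier L \<Longrightarrow> P (el p s) \<Longrightarrow> P (el (scalar \<kappa> * p) (\<kappa> * s))"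
  shows "P x"
proof -
  have "x \<in> lie_span L basis" using x by (simp add: carrier_L)
  then show ?thesis
  proof induction
    case (add x y)
    moreover obtain p s r t where "x = el p s" "y = el r t"
      using L_el add.hyps unfolding carrier_L by metis
    ultimately show ?case using assms(5)[of p s r t] by (simp add: lie_ops carrier_L)
  next
    case (smult x \<kappa>)
    moreover obtain p s where "x = el p s"
      using L_el smult.hyps unfolding carrier_L by metis
    ultimately show ?case using assms(6)[of p s \<kappa>] by (simp add: lie_ops carrier_L)
  qed (use assms(2-4) in \<open>auto simp: lie_ops basis_def\<close>)
qed

lemma monomial_bracket:
  "lie_bracket L (el (monomial a j) 0) (el (monomial b k) 0) =
    el (scalar (weight q a j b k) * monomial (a + b) (j + k)) (form (monomial a j) (monomial b k))"
  unfolding lie_ops by (rule el_cong) (rule T.monomial_commutator[unfolded T.congr_def])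

lemma weight_0: "a + b = 0 \<Longrightarrow> j + k = 0 \<Longrightarrow> weight q a j b k = 0"
  by (simp add: weight_def eq_neg_iff_add_eq_0[symmetric] mult.commute)

lemma el_split:
  assumes "\<kappa> = 0 \<or> (a, j) \<noteq> (0, 0)"
  shows "el (scalar \<kappa> * monomial a j) s \<in> carrier L"
proof -
  have "el (scalar \<kappa> * monomial a j) 0 \<in> carrier L"
    using assms L_closed(1) L_closed(3)[OF L_closed(5), of a j \<kappa>] by (cases "\<kappa> = 0") (simp_all add: lie_ops)
  moreover have "el 0 s \<in> carrier L"
    using L_closed(3)[OF L_closed(4), of s] by (simp add: lie_ops)
  ultimately show ?thesis
    using L_closed(2)[of "el (scalar \<kappa> * monomial a j) 0" "el 0 s"] by (simp add: lie_ops)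
qed

text \<open>
  A bilinear statement about the Lie algebra only has to be checked on the spanning set.
\<close>

lemma bilinear_L_induct [consumes 2]:
  assumes x: "x \<in> carrier L" and y: "y \<in> carrier L"
    and central: "\<And>y. y \<in> carrier L \<Longrightarrow> P (el 0 1) y" "\<And>x. x \<in> carrier L \<Longrightarrow> P x (el 0 1)"
    and zero: "\<And>y. y \<in> carrier L \<Longrightarrow> P (el 0 0) y" "\<And>x. x \<in> carrier L \<Longrightarrow> P x (el 0 0)"
    and monomial: "\<And>a j b k. (a, j) \<noteq> (0, 0) \<Longrightarrow> (b, k) \<noteq> (0, 0) \<Longrightarrow> P (el (monomial a j) 0) (el (monomial b k) 0)"
    and add: "\<And>p s r t y. y \<in> carrier L \<Longrightarrow> P (el p s) y \<Longrightarrow> P (el r t) y \<Longrightarrow> P (el (p + r) (s + t)) y"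
      "\<And>p s r t x. x \<in> carrier L \<Longrightarrow> P x (el p s) \<Longrightarrow> P x (el r t) \<Longrightarrow> P x (el (p + r) (s + t))"
    and smult: "\<And>\<kappa> p s y. y \<in> carrier L \<Longrightarrow> P (el p s) y \<Longrightarrow> P (el (scalar \<kappa> * p) (\<kappa> * s)) y"
      "\<And>\<kappa> p s x. x \<in> carrier L \<Longrightarrow> P x (el p s) \<Longrightarrow> P x (el (scalar \<kappa> * p) (\<kappa> * s))"
  shows "P x y"
  using x
proof (induction rule: L_induct)
  case (monomial a j)
  show ?case
    using y
  proof (induction rule: L_induct)
    case zero
    show ?case by (rule assms(6)) (rule L_closed(5)[OF monomial])
  next
    case central
    show ?case by (rule assms(4)) (rule L_closed(5)[OF monomial])
  next
    case (monomial b k)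
    show ?case by (rule assms(7)) fact+
  next
    case (add p s r t)
    show ?case by (rule assms(9)) (rule L_closed(5)[OF monomial] add)+
  next
    case (smult \<kappa> p s)
    show ?case by (rule assms(11)) (rule L_closed(5)[OF monomial] smult)+
  qed
qed (use assms y in auto)

lemma bracket_closed:
  assumes "x \<in> carrier L" "y \<in> carrier L"
  shows "lie_bracket L x y \<in> carrier L"
  using assms
proof (induction rule: bilinear_L_induct)
  fix a j b k :: int
  have "weight q a j b k = 0 \<or> (a + b, j + k) \<noteq> (0, 0)" using weight_0 by blast
  then show "lie_bracket L (el (monomial a j) 0) (el (monomial b k) 0) \<in> carrier L"
    unfolding monomial_bracket by (rule el_split)
next
  fix p s r t y assume y: "y \<in> carrier L" and xy: "lie_bracket L (el p s) y \<in> carrier L" "lie_bracket L (el r t) y \<in> carrier L"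
  obtain p' s' where "y = el p' s'" using L_el[OF y] by blast
  then show "lie_bracket L (el (p + r) (s + t)) y \<in> carrier L"
    using L_closed(2)[OF xy] by (simp add: lie_ops commutator_linear form_linear)
next
  fix p s r t x assume x: "x \<in> carrier L" and xy: "lie_bracket L x (el p s) \<in> carrier L" "lie_bracket L x (el r t) \<in> carrier L"
  obtain p' s' where "x = el p' s'" using L_el[OF x] by blast
  then show "lie_bracket L x (el (p + r) (s + t)) \<in> carrier L"
    using L_closed(2)[OF xy] by (simp add: lie_ops commutator_linear form_linear)
next
  fix \<kappa> p s y assume y: "y \<in> carrier L" and xy: "lie_bracket L (el p s) y \<in> carrier L"
  obtain p' s' where "y = el p' s'" using L_el[OF y] by blast
  then show "lie_bracket L (el (scalar \<kappa> * p) (\<kappa> * s)) y \<in> carrier L"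
    using L_closed(3)[OF xy, of \<kappa>] by (simp add: lie_ops commutator_linear form_linear)
next
  fix \<kappa> p s x assume x: "x \<in> carrier L" and xy: "lie_bracket L x (el p s) \<in> carrier L"
  obtain p' s' where "x = el p' s'" using L_el[OF x] by blast
  then show "lie_bracket L x (el (scalar \<kappa> * p) (\<kappa> * s)) \<in> carrier L"
    using L_closed(3)[OF xy, of \<kappa>] by (simp add: lie_ops commutator_linear form_linear)
qed (use L_el L_closed(1) in \<open>fastforce simp: lie_ops commutator_linear form_linear\<close>)+

lemma enveloping_relations_subalg: "enveloping_relations L \<subseteq> subalg (carrier L)"
  unfolding enveloping_relations_def
  by (auto simp: L_closed bracket_closed subalg_closed)

sublocale U: free_ideal "carrier L" "relation_ideal (carrier L) (enveloping_relations L)"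
  by (rule free_ideal_relation_ideal[OF enveloping_relations_subalg])

lemma U_relations:
  assumes "x \<in> carrier L" "y \<in> carrier L"
  shows "letter (lie_add L x y) - (letter x + letter y) \<in> relation_ideal (carrier L) (enveloping_relations L)"
    "letter (lie_smult L \<kappa> x) - scalar \<kappa> * letter x \<in> relation_ideal (carrier L) (enveloping_relations L)"
    "commutator (letter x) (letter y) - letter (lie_bracket L x y) \<in> relation_ideal (carrier L) (enveloping_relations L)"
  by (rule relation_in_ideal[OF enveloping_relations_subalg];
      use assms in \<open>unfold enveloping_relations_def, blast\<close>)+

text \<open>
  The multiple of \<open>c\<close> that is added to \<open>Z\<^sup>a D\<^sup>j\<close> to make the cocycle homogeneous. It is zero in degree
  \<open>(0, 0)\<close>, because the inverse of zero is zero.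
\<close>

definition shift :: "int \<Rightarrow> int \<Rightarrow> complex" where
  "shift a j = (if j = 0 then inverse (q powi a - 1) else 0)"

lemma form_monomial_shift: "form (monomial a j) (monomial b k) =
    central_term q a j b k + weight q a j b k * shift (a + b) (j + k)"
  by (simp add: form_monomial shift_def)

lemma form_00: "form (monomial 0 0) (monomial b k) = 0" "form (monomial b k) (monomial 0 0) = 0"
  by (simp_all add: form_monomial central_term_def weight_def)

abbreviation "c_U \<equiv> letter (el 0 1)"

text \<open>
  The unit of the torus does not belong to the Lie algebra; the value zero in its place is harmless,
  as \<open>weight\<close> vanishes whenever a bracket has degree \<open>(0, 0)\<close>.
\<close>

definition M :: "int \<Rightarrow> int \<Rightarrow> (torus_letter free_alg set \<times> complex) free_alg" where
  "M a j = (if (a, j) = (0, 0) then 0 else letter (el (monomial a j) 0))"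

lemma M_in: "M a j \<in> subalg (carrier L)"
  by (simp add: M_def subalg_closed L_closed)

lemma lin_letter:
  assumes "u \<in> U.ann" "x \<in> carrier L" "y \<in> carrier L"
  shows "lin u (letter (lie_add L x y)) = lin u (letter x) + lin u (letter y)"
    "lin u (letter (lie_smult L \<kappa> x)) = \<kappa> * lin u (letter x)"
    "lin u (commutator (letter x) (letter y)) = lin u (letter (lie_bracket L x y))"
  using U_relations[OF assms(2,3), THEN U.annD[OF assms(1)]] by (simp_all add: lin_simps)

lemma lin_el:
  assumes u: "u \<in> U.ann" and w: "w = 0 \<or> (a, j) \<noteq> (0, 0)"
  shows "lin u (letter (el (scalar w * monomial a j) s)) = w * lin u (M a j) + s * lin u c_U"
proof -
  have s: "el 0 s \<in> carrier L" "lin u (letter (el 0 s)) = s * lin u c_U"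
    using L_closed(3)[OF L_closed(4), of s] lin_letter(2)[OF u L_closed(4) L_closed(4), of s]
    by (simp_all add: lie_ops)
  show ?thesis
  proof (cases "(a, j) = (0, 0)")
    case True
    then show ?thesis using w s by (simp add: M_def)
  next
    case False
    note m = L_closed(5)[OF False]
    have "M a j = letter (el (monomial a j) 0)"
      unfolding M_def using False by (rule if_not_P)
    then show ?thesis
      using lin_letter(1)[OF u L_closed(3)[OF m] s(1), of w] lin_letter(2)[OF u m m, of w] s(2)
      by (simp add: lie_ops)
  qed
qed

lemma lin_el_0: "u \<in> U.ann \<Longrightarrow> lin u (letter (el 0 0)) = 0"
  using lin_el[of u 0 0 0 0] by simp

lemma c_U_central: "x \<in> carrier L \<Longrightarrow> commutator c_U (letter x) \<in> relation_ideal (carrier L) (enveloping_relations L)"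
proof (rule U.separation)
  fix u assume x: "x \<in> carrier L" and u: "u \<in> U.ann"
  obtain p s where "x = el p s" using L_el[OF x] by blast
  then show "lin u (commutator c_U (letter x)) = 0"
    using lin_letter(3)[OF u L_closed(4) x] lin_el_0[OF u]
    by (simp add: lie_ops commutator_linear form_linear)
qed

lemma M_bracket:
  assumes u: "u \<in> U.ann"
  shows "lin u (commutator (M a j) (M b k)) = weight q a j b k * lin u (M (a + b) (j + k))
    + form (monomial a j) (monomial b k) * lin u c_U"
proof (cases "(a, j) = (0, 0) \<or> (b, k) = (0, 0)")
  case True
  then show ?thesis
    by (auto simp: M_def commutator_linear form_00 weight_def)
next
  case False
  then have m: "el (monomial a j) 0 \<in> carrier L" "el (monomial b k) 0 \<in> carrier L"
    using L_closed(5) by blast+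
  have M: "M a j = letter (el (monomial a j) 0)" "M b k = letter (el (monomial b k) 0)"
    using False by (simp_all only: M_def de_Morgan_disj if_False)
  have "weight q a j b k = 0 \<or> (a + b, j + k) \<noteq> (0, 0)" using weight_0 by blast
  from lin_el[OF u this] show ?thesis
    using lin_letter(3)[OF u m] unfolding monomial_bracket M by simp
qed

definition E_U :: "int \<Rightarrow> int \<Rightarrow> (torus_letter free_alg set \<times> complex) free_alg" where
  "E_U a j = M a j + scalar (shift a j) * c_U"

lemma c_U_M: "commutator c_U (M a j) \<in> relation_ideal (carrier L) (enveloping_relations L)"
  by (simp add: M_def commutator_linear U.zero c_U_central L_closed)

sublocale EU: graded_family q "carrier L" "relation_ideal (carrier L) (enveloping_relations L)" E_U c_U
proof
  show "commutator c_U (E_U a j) \<in> relation_ideal (carrier L) (enveloping_relations L)" for a j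
    unfolding E_U_def commutator_linear
    by (intro U.add U.smult c_U_M c_U_central L_closed)
qed (simp_all add: E_U_def M_in subalg_closed L_closed, simp add: M_def shift_def)

text \<open>
  The change of basis turns the value of the cocycle on monomials into \<open>central_term\<close>.
\<close>

lemma E_U_obeys: "EU.obeys a j b k"
  unfolding EU.obeys_iff
proof
  fix u assume u: "u \<in> U.ann"
  have "lin u (commutator c_U (M a j)) = 0" "lin u (commutator (M a j) c_U) = 0" "lin u (commutator c_U c_U) = 0" for a j
    using U.annD[OF u c_U_M[of a j]] commutator_swap[of "M a j" c_U]
    by (simp_all add: lin_simps) (simp add: commutator_def)
  then show "lin u (commutator (E_U a j) (E_U b k)) =
      weight q a j b k * lin u (E_U (a + b) (j + k)) + central_term q a j b k * lin u c_U"
    unfolding E_U_def commutator_linear lin_simps M_bracket[OF u] form_monomial_shift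
    by (simp add: algebra_simps)
qed

definition gen_image :: "toroidal_letter \<Rightarrow> torus_letter free_alg set \<times> complex" where
  "gen_image x = (case x of
     Le i \<Rightarrow> torus_ext_incl q ((torus_Z q [^]\<^bsub>torus q\<^esub> i) \<otimes>\<^bsub>torus q\<^esub> torus_D q)
   | Lf i \<Rightarrow> torus_ext_incl q
       (\<ominus>\<^bsub>torus q\<^esub> ((torus_D q [^]\<^bsub>torus q\<^esub> (-1 :: int)) \<otimes>\<^bsub>torus q\<^esub> (torus_Z q [^]\<^bsub>torus q\<^esub> i)))
   | LH i \<Rightarrow> lie_add L (lie_smult L (- (1 - q powi (- i))) (torus_ext_incl q (torus_Z q [^]\<^bsub>torus q\<^esub> i)))
       (lie_smult L (- (q powi (- i))) (torus_ext_central q)))"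

lemma gen_image_eq:
  "gen_image (Le i) = el (scalar 1 * monomial i 1) 0"
  "gen_image (Lf i) = el (scalar (- (q powi (- i))) * monomial i (- 1)) 0"
  "gen_image (LH i) = el (scalar (- (1 - q powi (- i))) * monomial i 0) (- (q powi (- i)))"
proof -
  have rel: "letter LZ * letter LZinv - 1 \<in> torus_ideal q" "letter LZinv * letter LZ - 1 \<in> torus_ideal q"
    "letter LD * letter LDinv - 1 \<in> torus_ideal q" "letter LDinv * letter LD - 1 \<in> torus_ideal q"
    using T.relations unfolding T.congr_def by blast+
  have Z: "torus_Z q [^]\<^bsub>torus q\<^esub> i = torus_class q (monomial i 0)" for i
    using torus_letter_int_power[OF rel(1,2), of i]
    by (simp add: torus_Z_def presented_gen_def monomial_word_def)
  have D: "torus_D q [^]\<^bsub>torus q\<^esub> j = torus_class q (monomial 0 j)" for j :: int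
    using torus_letter_int_power[OF rel(3,4), of j]
    by (simp add: torus_D_def presented_gen_def monomial_word_def)
  have "monomial i 0 * letter LD = monomial i 1"
    by (simp add: letter_def mult_single plus_word_def monomial_word_def)
  then show "gen_image (Le i) = el (scalar 1 * monomial i 1) 0"
    by (simp add: gen_image_def Z torus_D_def presented_gen_def torus_class_mult torus_ext_incl_def el_def)
  have "gen_image (Lf i) = el (- (monomial 0 (- 1) * monomial i 0)) 0"
    by (simp add: gen_image_def Z D torus_class_mult torus_uminus torus_ext_incl_def el_def)
  also have "\<dots> = el (scalar (- (q powi (- i))) * monomial i (- 1)) 0"
    using T.uminus[OF T.monomial_mult[of 0 "- 1" i 0, unfolded T.congr_def]]
    by (intro el_cong) (simp add: scalar_uminus)
  finally show "gen_image (Lf i) = el (scalar (- (q powi (- i))) * monomial i (- 1)) 0" .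
  have "torus_ext_incl q (torus_Z q [^]\<^bsub>torus q\<^esub> i) = el (monomial i 0) 0"
    by (simp add: Z torus_ext_incl_def el_def)
  then show "gen_image (LH i) = el (scalar (- (1 - q powi (- i))) * monomial i 0) (- (q powi (- i)))"
    by (simp add: gen_image_def lie_ops)
qed

lemma gen_image_in: "gen_image x \<in> carrier L"
  by (cases x) (simp_all only: gen_image_eq, (rule el_split, auto)+)

sublocale B: bracket_family q "carrier L" "relation_ideal (carrier L) (enveloping_relations L)" E_U c_U
  "\<lambda>x. letter (gen_image x)"
proof
  show "letter (gen_image (Le i)) - E_U i 1 \<in> relation_ideal (carrier L) (enveloping_relations L)" for i
    by (rule U.separation) (use lin_el[of _ 1 i 1 0] in \<open>simp add: gen_image_eq lin_simps E_U_def shift_def\<close>)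
  show "letter (gen_image (Lf i)) + scalar (q powi (- i)) * E_U i (- 1)
      \<in> relation_ideal (carrier L) (enveloping_relations L)" for i
    by (rule U.separation) (simp only: gen_image_eq, simp add: lin_simps lin_el E_U_def shift_def)
  show "letter (gen_image (LH i)) + scalar (1 - q powi (- i)) * E_U i 0 + scalar (if i = 0 then 1 else 0) * c_U
      \<in> relation_ideal (carrier L) (enveloping_relations L)" for i
  proof (rule U.separation)
    fix u assume u: "u \<in> U.ann"
    have "- (1 - q powi (- i)) = 0 \<or> (i, 0) \<noteq> (0, 0 :: int)" by auto
    note el = lin_el[OF u this, of "- (q powi (- i))"]
    show "lin u (letter (gen_image (LH i)) + scalar (1 - q powi (- i)) * E_U i 0
        + scalar (if i = 0 then 1 else 0) * c_U) = 0"
    proof (cases "i = 0")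
      case True
      then show ?thesis using el unfolding gen_image_eq E_U_def lin_simps by simp
    next
      case False
      have "(1 - inverse x) * inverse (x - 1) = inverse x" if "x \<noteq> 0" "x - 1 \<noteq> 0" for x :: complex
        using that by (simp add: field_simps)
      moreover have "q powi i - 1 \<noteq> 0" using False powi_eq_1[of i] by auto
      ultimately have "(1 - q powi (- i)) * shift i 0 = q powi (- i)"
        by (simp add: shift_def power_int_minus)
      then have "(1 - q powi (- i)) * (lin u (M i 0) + shift i 0 * lin u c_U) =
          (1 - q powi (- i)) * lin u (M i 0) + q powi (- i) * lin u c_U"
        by (simp only: distrib_left mult.assoc[symmetric])
      then show ?thesis
        unfolding gen_image_eq E_U_def lin_simps el using False by (simp add: left_diff_distrib)
    qed
  qed
qed (simp_all add: E_U_obeys gen_image_in subalg_closed)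

end

section \<open>The isomorphism\<close>

context torus_lie
begin

abbreviation "e_T \<equiv> \<lambda>i. letter (Le i)"
abbreviation "f_T \<equiv> \<lambda>i. letter (Lf i)"
abbreviation "H_T \<equiv> \<lambda>i. letter (LH i)"

sublocale S: toroidal q UNIV "relation_ideal UNIV (toroidal_relations q)" e_T f_T H_T
proof -
  let ?I = "relation_ideal UNIV (toroidal_relations q)"
  interpret J: free_ideal UNIV ?I by (rule free_ideal_relation_ideal) auto
  have rel: "r \<in> ?I" if "r \<in> toroidal_relations q" for r
    by (rule relation_in_ideal[OF _ that]) auto
  have quad_e: "quad q e_T i j \<in> ?I" for i j
    unfolding quad_eq(1)[OF q_nonzero, symmetric]
    by (rule rel, unfold toroidal_relations_def Let_def) blast
  have quad_f: "- quad q f_T i j \<in> ?I" for i j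
    unfolding quad_eq(2)[OF q_nonzero, symmetric]
    by (rule rel, unfold toroidal_relations_def Let_def) blast
  have f: "quad q f_T i j \<in> ?I" for i j
    using J.uminus[OF quad_f[of i j]] by simp
  have HH: "commutator (H_T i) (H_T j) \<in> ?I" for i j
    by (rule rel, unfold toroidal_relations_def Let_def) blast
  have ef: "commutator (e_T i) (f_T j) - H_T (i + j) \<in> ?I" for i j
    by (rule rel, unfold toroidal_relations_def Let_def) blast
  have He: "commutator (H_T i) (e_T j) + scalar ((1 - q powi i) * (1 - q powi (- i))) * e_T (i + j) \<in> ?I" for i j
    by (rule rel, unfold toroidal_relations_def Let_def) blast
  have Hf: "commutator (H_T i) (f_T j) - scalar ((1 - q powi i) * (1 - q powi (- i))) * f_T (i + j) \<in> ?I" for i j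
    by (rule rel, unfold toroidal_relations_def Let_def) blast
  have serre_e: "sym3 (\<lambda>k1 k2 k3. commutator (e_T k1) (commutator (e_T (k2 + 1)) (e_T (k3 - 1)))) i1 i2 i3 \<in> ?I" for i1 i2 i3
    by (rule rel, unfold toroidal_relations_def Let_def) blast
  have serre_f: "sym3 (\<lambda>k1 k2 k3. commutator (f_T k1) (commutator (f_T (k2 + 1)) (f_T (k3 - 1)))) i1 i2 i3 \<in> ?I" for i1 i2 i3
    by (rule rel, unfold toroidal_relations_def Let_def) blast
  have "current q UNIV ?I e_T"
    by (intro current.intro not_root_of_unity_axioms J.free_ideal_axioms current_axioms.intro
        subalg_UNIV quad_e serre_e)
  moreover have "current q UNIV ?I f_T"
    by (intro current.intro not_root_of_unity_axioms J.free_ideal_axioms current_axioms.intro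
        subalg_UNIV f serre_f)
  ultimately show "toroidal q UNIV ?I e_T f_T H_T"
    by (intro toroidal.intro toroidal_axioms.intro subalg_UNIV HH ef He Hf)
qed

abbreviation "E_T \<equiv> toroidal_family q e_T f_T H_T"
abbreviation "c_T \<equiv> - H_T 0"

text \<open>
  The inverse of \<open>\<theta>\<close> on the Lie algebra: \<open>Z\<^sup>a D\<^sup>j\<close> goes to \<open>E\<^bsub>a,j\<^esub>\<close>, with the change of basis undone.
  The value does not depend on the representative, since \<open>torus_eval\<close> vanishes on the ideal
  of the torus.
\<close>

definition lift :: "torus_letter free_alg set \<times> complex \<Rightarrow> toroidal_letter free_alg" where
  "lift x = torus_eval q (\<lambda>a j. E_T a j - scalar (shift a j) * c_T) (SOME p. p \<in> fst x) + scalar (snd x) * c_T"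

lemma lift_el: "lift (el p s) = torus_eval q (\<lambda>a j. E_T a j - scalar (shift a j) * c_T) p + scalar s * c_T"
proof -
  define p' where "p' = (SOME r. r \<in> torus_class q p)"
  have "p \<in> torus_class q p" by (simp add: T.mem_coset T.zero)
  then have "p' \<in> torus_class q p" unfolding p'_def by (rule someI)
  then have "torus_eval q F (p' - p) = 0" for F :: "int \<Rightarrow> int \<Rightarrow> toroidal_letter free_alg"
    by (intro torus_eval_ideal) (simp_all add: T.mem_coset)
  then show ?thesis
    by (simp add: lift_def el_def torus_eval_linear flip: p'_def)
qed

lemma lift_simps:
  "lift (el (p + r) (s + t)) = lift (el p s) + lift (el r t)"
  "lift (el (scalar \<kappa> * p) (\<kappa> * s)) = scalar \<kappa> * lift (el p s)"
  "lift (el 0 s) = scalar s * c_T"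
  "lift (el (scalar \<kappa> * monomial a j) s) = scalar \<kappa> * (E_T a j - scalar (shift a j) * c_T) + scalar s * c_T"
  "lift (el (monomial a j) 0) = E_T a j - scalar (shift a j) * c_T"
  by (rule free_alg_eqI, simp add: lift_el torus_eval_linear torus_eval_monomial lin_simps algebra_simps scalar_add)+

lemma c_T_lift:
  assumes "x \<in> carrier L"
  shows "commutator c_T (lift x) \<in> relation_ideal UNIV (toroidal_relations q)"
  using assms
proof (induction rule: L_induct)
  case (monomial a j)
  have "commutator c_T c_T = 0" by (simp add: commutator_def)
  then show ?case
    using S.c_central[of a j] unfolding lift_simps commutator_linear by simp
next
  case (smult \<kappa> p s)
  then show ?case unfolding lift_simps(2) commutator_linear(8) by (intro S.e.smult)
next
  case (add p s r t)
  then show ?case unfolding lift_simps(1) commutator_linear(2) by (intro S.e.add)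
next
  case zero
  show ?case unfolding lift_simps(3) by (simp add: commutator_linear S.e.zero)
next
  case central
  show ?case unfolding lift_simps(3) by (simp add: commutator_def S.e.zero)
qed

lemma lift_c_T:
  "x \<in> carrier L \<Longrightarrow> commutator (lift x) c_T \<in> relation_ideal UNIV (toroidal_relations q)"
  using S.e.uminus[OF c_T_lift[of x]] by (simp add: commutator_def)

text \<open>
  On the spanning set this is the bracket rule of the toroidal algebra, with the change of basis undone.
\<close>

lemma lift_bracket:
  assumes "x \<in> carrier L" "y \<in> carrier L"
  shows "commutator (lift x) (lift y) - lift (lie_bracket L x y) \<in> relation_ideal UNIV (toroidal_relations q)"
  using assms
proof (induction rule: bilinear_L_induct)
  fix a j b k :: int
  show "commutator (lift (el (monomial a j) 0)) (lift (el (monomial b k) 0))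
      - lift (lie_bracket L (el (monomial a j) 0) (el (monomial b k) 0)) \<in> relation_ideal UNIV (toroidal_relations q)"
  proof (rule S.e.separation)
    fix u assume u: "u \<in> S.e.ann"
    have c: "lin u (commutator c_T (E_T a j)) = 0" "lin u (commutator (E_T a j) c_T) = 0" for a j
      using S.e.annD[OF u S.c_central[of a j]] commutator_swap[of "E_T a j" c_T] by (simp_all only: lin_uminus minus_zero)
    have cc: "commutator c_T c_T = 0" by (simp add: commutator_def)
    show "lin u (commutator (lift (el (monomial a j) 0)) (lift (el (monomial b k) 0))
      - lift (lie_bracket L (el (monomial a j) 0) (el (monomial b k) 0))) = 0"
      unfolding monomial_bracket lift_simps commutator_linear(3,4,7,8) cc lin_diff lin_add lin_scalar_mult c
        S.obeysD[OF S.bracket_rule u] form_monomial_shift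
      by (simp add: algebra_simps)
  qed
next
  fix y assume "y \<in> carrier L"
  moreover from this obtain p s where "y = el p s" using L_el by blast
  ultimately show "commutator (lift (el 0 1)) (lift y) - lift (lie_bracket L (el 0 1) y) \<in> relation_ideal UNIV (toroidal_relations q)"
    "commutator (lift (el 0 0)) (lift y) - lift (lie_bracket L (el 0 0) y) \<in> relation_ideal UNIV (toroidal_relations q)"
    using c_T_lift[of y] lift_simps(3)[of 0] lift_simps(3)[of 1]
    by (simp_all add: lie_ops commutator_linear(7,9) form_linear S.e.zero)
next
  fix x assume "x \<in> carrier L"
  moreover from this obtain p s where "x = el p s" using L_el by blast
  ultimately show "commutator (lift x) (lift (el 0 1)) - lift (lie_bracket L x (el 0 1)) \<in> relation_ideal UNIV (toroidal_relations q)"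
    "commutator (lift x) (lift (el 0 0)) - lift (lie_bracket L x (el 0 0)) \<in> relation_ideal UNIV (toroidal_relations q)"
    using lift_c_T[of x] lift_simps(3)[of 0] lift_simps(3)[of 1]
    by (simp_all add: lie_ops commutator_linear(8,10) form_linear S.e.zero)
next
  fix p s r t y
  assume y: "y \<in> carrier L"
    and 1: "commutator (lift (el p s)) (lift y) - lift (lie_bracket L (el p s) y) \<in> relation_ideal UNIV (toroidal_relations q)"
      "commutator (lift (el r t)) (lift y) - lift (lie_bracket L (el r t) y) \<in> relation_ideal UNIV (toroidal_relations q)"
  obtain p' s' where "y = el p' s'" using L_el[OF y] by blast
  then show "commutator (lift (el (p + r) (s + t))) (lift y) - lift (lie_bracket L (el (p + r) (s + t)) y)
      \<in> relation_ideal UNIV (toroidal_relations q)"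
    using S.e.add[OF 1] by (simp add: lie_ops commutator_linear(1) form_linear lift_simps(1) algebra_simps)
next
  fix p s r t x
  assume x: "x \<in> carrier L"
    and 1: "commutator (lift x) (lift (el p s)) - lift (lie_bracket L x (el p s)) \<in> relation_ideal UNIV (toroidal_relations q)"
      "commutator (lift x) (lift (el r t)) - lift (lie_bracket L x (el r t)) \<in> relation_ideal UNIV (toroidal_relations q)"
  obtain p' s' where "x = el p' s'" using L_el[OF x] by blast
  then show "commutator (lift x) (lift (el (p + r) (s + t))) - lift (lie_bracket L x (el (p + r) (s + t)))
      \<in> relation_ideal UNIV (toroidal_relations q)"
    using S.e.add[OF 1] by (simp add: lie_ops commutator_linear(2) form_linear lift_simps(1) algebra_simps)
next
  fix \<kappa> p s y
  assume y: "y \<in> carrier L"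
    and 1: "commutator (lift (el p s)) (lift y) - lift (lie_bracket L (el p s) y) \<in> relation_ideal UNIV (toroidal_relations q)"
  obtain p' s' where "y = el p' s'" using L_el[OF y] by blast
  then show "commutator (lift (el (scalar \<kappa> * p) (\<kappa> * s))) (lift y) - lift (lie_bracket L (el (scalar \<kappa> * p) (\<kappa> * s)) y)
      \<in> relation_ideal UNIV (toroidal_relations q)"
    using S.e.smult[OF 1, of \<kappa>]
    by (simp add: lie_ops commutator_linear(7) form_linear lift_simps(2) right_diff_distrib)
next
  fix \<kappa> p s x
  assume x: "x \<in> carrier L"
    and 1: "commutator (lift x) (lift (el p s)) - lift (lie_bracket L x (el p s)) \<in> relation_ideal UNIV (toroidal_relations q)"
  obtain p' s' where "x = el p' s'" using L_el[OF x] by blast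
  then show "commutator (lift x) (lift (el (scalar \<kappa> * p) (\<kappa> * s))) - lift (lie_bracket L x (el (scalar \<kappa> * p) (\<kappa> * s)))
      \<in> relation_ideal UNIV (toroidal_relations q)"
    using S.e.smult[OF 1, of \<kappa>]
    by (simp add: lie_ops commutator_linear(8) form_linear lift_simps(2) right_diff_distrib)
qed

lemma lift_relations:
  assumes "r \<in> enveloping_relations L"
  shows "subst lift r \<in> relation_ideal UNIV (toroidal_relations q)"
proof -
  have add: "lift (lie_add L x y) = lift x + lift y" if xy: "x \<in> carrier L" "y \<in> carrier L" for x y
  proof -
    obtain p s where x: "x = el p s" using L_el[OF xy(1)] by blast
    obtain r t where y: "y = el r t" using L_el[OF xy(2)] by blast
    show ?thesis unfolding x y by (simp add: lie_ops lift_simps(1))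
  qed
  have smult: "lift (lie_smult L \<kappa> x) = scalar \<kappa> * lift x" if x_in: "x \<in> carrier L" for x \<kappa>
  proof -
    obtain p s where x: "x = el p s" using L_el[OF x_in] by blast
    show ?thesis unfolding x by (simp add: lie_ops lift_simps(2))
  qed
  show ?thesis
    using assms unfolding enveloping_relations_def
    by (elim UnE CollectE exE conjE; hypsubst)
      (simp_all only: subst_simps add smult lift_bracket diff_self S.e.zero)
qed

lemma lift_gen_image: "lift (gen_image x) = letter x"
proof (cases x)
  case (Le i)
  then show ?thesis
    by (simp only: gen_image_eq lift_simps) (simp add: shift_def toroidal_family_def)
next
  case (Lf i)
  have "- 1 * q powi (- i) * (- (q powi i)) = 1"
    by (simp add: power_int_minus)
  then show ?thesis
    unfolding Lf gen_image_eq lift_simps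
    by (simp add: shift_def toroidal_family_def scalar_scalar power_int_minus flip: mult.assoc)
next
  case (LH i)
  show ?thesis
  proof (cases "i = 0")
    case True
    then show ?thesis
      unfolding LH gen_image_eq lift_simps by (simp add: scalar_uminus)
  next
    case False
    then have nz: "1 - q powi (- i) \<noteq> 0" "q powi i - 1 \<noteq> 0"
      using powi_eq_1[of "- i"] powi_eq_1[of i] by auto
    then have s: "- (1 - q powi (- i)) * - shift i 0 = q powi (- i)"
      by (simp add: shift_def field_simps power_int_minus)
    show ?thesis
    proof (rule free_alg_eqI)
      fix u
      have "lin u (lift (gen_image (LH i))) = lin u (H_T i) + (- (1 - q powi (- i)) * - shift i 0 - q powi (- i)) * lin u c_T"
        unfolding gen_image_eq lift_simps using nz False
        by (simp add: lin_simps toroidal_family_def algebra_simps)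
          (simp add: field_simps)
      then show "lin u (lift (gen_image x)) = lin u (letter x)"
        unfolding LH s by simp
    qed
  qed
qed

lemma subst_lift:
  assumes "y \<in> carrier L"
  shows "subst (\<lambda>x. letter (gen_image x)) (lift y) - letter y \<in> relation_ideal (carrier L) (enveloping_relations L)"
  using assms
proof (induction rule: L_induct)
  case zero
  then show ?case
    by (intro U.separation) (simp add: lift_simps(3) subst_simps lin_simps lin_el_0)
next
  case central
  have "letter (gen_image (LH 0)) + c_U \<in> relation_ideal (carrier L) (enveloping_relations L)"
    using B.\<sigma>_H[of 0] by (simp add: E_U_def)
  from U.uminus[OF this] show ?case
    by (simp add: lift_simps(3) subst_simps)
next
  case (monomial a j)
  have 1: "letter (gen_image (LH 0)) + c_U \<in> relation_ideal (carrier L) (enveloping_relations L)"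
    using B.\<sigma>_H[of 0] by (simp add: E_U_def)
  have M: "M a j = letter (el (monomial a j) 0)"
    unfolding M_def using monomial by (rule if_not_P)
  have "subst (\<lambda>x. letter (gen_image x)) (E_T a j) - E_U a j \<in> relation_ideal (carrier L) (enveloping_relations L)"
    using B.toroidal_family_eq[of a j] by (simp add: subst_toroidal_family subst_letter)
  from U.add[OF this U.smult[OF 1, of "shift a j"]] show ?case
    by (simp add: lift_simps(5) subst_simps E_U_def M algebra_simps)
next
  case (add p s r t)
  show ?case
  proof (rule U.separation)
    fix u assume u: "u \<in> U.ann"
    show "lin u (subst (\<lambda>x. letter (gen_image x)) (lift (el (p + r) (s + t))) - letter (el (p + r) (s + t))) = 0"
      using U.annD[OF u add.IH(1)] U.annD[OF u add.IH(2)] lin_letter(1)[OF u add.hyps]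
      by (simp add: lift_simps(1) subst_simps lin_simps lie_ops)
  qed
next
  case (smult \<kappa> p s)
  show ?case
  proof (rule U.separation)
    fix u assume u: "u \<in> U.ann"
    show "lin u (subst (\<lambda>x. letter (gen_image x)) (lift (el (scalar \<kappa> * p) (\<kappa> * s))) - letter (el (scalar \<kappa> * p) (\<kappa> * s))) = 0"
      using U.annD[OF u smult.IH] lin_letter(2)[OF u smult.hyps smult.hyps, of \<kappa>]
      by (simp add: lift_simps(2) subst_simps lin_simps lie_ops)
  qed
qed

theorem toroidal_iso:
  "\<exists>\<theta> \<in> algebra_iso (presented_algebra UNIV (toroidal_relations q)) (enveloping_algebra L).
    \<forall>x. \<theta> (presented_gen UNIV (toroidal_relations q) x) = enveloping_incl L (gen_image x)"
proof -
  have "toroidal_relations q \<subseteq> subalg UNIV" by auto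
  moreover have "letter (gen_image x) \<in> subalg (carrier L)" for x
    by (simp add: subalg_closed(4) gen_image_in)
  moreover have "subst lift (letter (gen_image x)) - letter x \<in> relation_ideal UNIV (toroidal_relations q)" for x
    by (simp add: subst_letter lift_gen_image S.e.zero)
  ultimately have "\<exists>\<theta> \<in> algebra_iso (presented_algebra UNIV (toroidal_relations q)) (presented_algebra (carrier L) (enveloping_relations L)).
      \<forall>x \<in> UNIV. \<theta> (presented_gen UNIV (toroidal_relations q) x) = U.coset (letter (gen_image x))"
    using presented_algebra_isoI[OF _ enveloping_relations_subalg _ subalg_UNIV B.subst_toroidal_relations lift_relations _ subst_lift]
    by blast
  then show ?thesis
    unfolding enveloping_algebra_def enveloping_incl_def presented_gen_def[of "carrier L"] by blast
qed

end

theorem theorem5p5: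
  fixes h0 q :: complex
  assumes "h0 \<notin> {of_rat r * (of_real pi * \<i>) | r. True}"
    and "q = exp h0"
  shows "\<exists>\<theta> \<in> algebra_iso (toroidal_algebra h0) (enveloping_algebra (torus_ext0 q)).
    \<forall>i.
      \<theta> (toroidal_gen h0 (Le i)) =
        enveloping_incl (torus_ext0 q) (torus_ext_incl q
          ((torus_Z q [^]\<^bsub>torus q\<^esub> i) \<otimes>\<^bsub>torus q\<^esub> torus_D q)) \<and>
      \<theta> (toroidal_gen h0 (Lf i)) =
        enveloping_incl (torus_ext0 q) (torus_ext_incl q
          (\<ominus>\<^bsub>torus q\<^esub> ((torus_D q [^]\<^bsub>torus q\<^esub> (-1 :: int)) \<otimes>\<^bsub>torus q\<^esub> (torus_Z q [^]\<^bsub>torus q\<^esub> i)))) \<and>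
      \<theta> (toroidal_gen h0 (LH i)) =
        enveloping_incl (torus_ext0 q) (lie_add (torus_ext0 q)
          (lie_smult (torus_ext0 q) (- (1 - q powi (- i)))
            (torus_ext_incl q (torus_Z q [^]\<^bsub>torus q\<^esub> i)))
          (lie_smult (torus_ext0 q) (- (q powi (- i))) (torus_ext_central q)))"
proof -
  interpret torus_lie q
  proof (intro torus_lie.intro not_root_of_unity.intro)
    show "q \<noteq> 0" using assms(2) by simp
    fix n :: int assume "q powi n = 1"
    then have "exp (of_int n * h0) = 1"
      using assms(2) by (simp add: exp_power_int)
    then have "norm (exp (of_int n * h0)) = 1" "Re (exp (of_int n * h0)) = 1" by simp_all
    then have "exp (Re (of_int n * h0)) = 1" "exp (Re (of_int n * h0)) * cos (Im (of_int n * h0)) = 1"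
      unfolding norm_exp_eq_Re Re_exp .
    then obtain m :: int where m: "Re (of_int n * h0) = 0" "Im (of_int n * h0) = of_int (2 * m) * pi"
      by (auto simp: cos_one_2pi_int)
    show "n = 0"
    proof (rule ccontr)
      assume n: "n \<noteq> 0"
      have "h0 = of_rat (Fract (2 * m) n) * (of_real pi * \<i>)"
        using m n by (auto simp: complex_eq_iff of_rat_rat field_simps)
      then show False using assms(1) by blast
    qed
  qed
  obtain \<theta> where "\<theta> \<in> algebra_iso (toroidal_algebra h0) (enveloping_algebra (torus_ext0 q))"
    "\<And>x. \<theta> (toroidal_gen h0 x) = enveloping_incl (torus_ext0 q) (gen_image x)"
    using toroidal_iso unfolding toroidal_algebra_def toroidal_gen_def assms(2)[symmetric] by blast
  then show ?thesis
    by (intro bexI[of _ \<theta>]) (simp_all add: gen_image_def)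
qed

end
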